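(* For any field $K$, the homology $H_*(\mathrm{Map}(\mathbb{R}^2\smallsetminus\mathbb{Z}^2);K)$ does not contain any non-zero classes of positive degree that admit compact support, or even support of finite type. That is, for every properly embedded finite-type subsurface (in particular, every compact subsurface) $\Sigma\subset\mathbb{R}^2\smallsetminus\mathbb{Z}^2$ and every $i\geq 1$, the map $H_i(\mathrm{Map}(\Sigma);K)\to H_i(\mathrm{Map}(\mathbb{R}^2\smallsetminus\mathbb{Z}^2);K)$ is zero.
   Context: All surfaces are second countable, connected, orientable and have compact (possibly empty) boundary. A surface has finite type if its fundamental group is finitely generated. A subsurface of $S$ is properly embedded if it is closed as a subset of $S$. $\mathrm{Map}(S)=\pi_0(\mathrm{Homeo}_\partial(S))$ is the (discrete) group of isotopy classes of orientation-preserving homeomorphisms of $S$ that restrict to the identity on $\partial S$. For a properly embedded subsurface $\Sigma\subseteq S$, the homomorphism $\mathrm{Map}(\Sigma)\to\mathrm{Map}(S)$ is given by extending homeomorphisms by the identity on $S\smallsetminus\Sigma$. *)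

theory Defs
  imports
    "HOL-Complex_Analysis.Winding_Numbers"
    "HOL-Algebra.Bij"
    "HOL-Algebra.Coset"
    "HOL-Algebra.Generated_Groups"
    "HOL-Library.Poly_Mapping"
begin

section \<open>Surfaces in the plane\<close>

text \<open>The Euclidean plane is the type \<^typ>\<open>complex\<close>. A surface is a subset of the plane that is, in its
  subspace topology, a connected 2-manifold with compact boundary. Second countability is
  inherited from the plane, and so is an orientation.\<close>

definition manifold_interior :: "complex set \<Rightarrow> complex set" where
  "manifold_interior X =
     {x. \<exists>U V. x \<in> U \<and> openin (top_of_set X) U \<and> open (V :: complex set) \<and> U homeomorphic V}"

definition manifold_boundary :: "complex set \<Rightarrow> complex set" where
  "manifold_boundary X = X - manifold_interior X"

definition planar_surface :: "complex set \<Rightarrow> bool" where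
  "planar_surface X \<longleftrightarrow>
     X \<noteq> {} \<and> connected X \<and>
     (\<forall>x\<in>X. \<exists>U V. x \<in> U \<and> openin (top_of_set X) U \<and>
        openin (top_of_set {z. 0 \<le> Im z}) V \<and> U homeomorphic V) \<and>
     compact (manifold_boundary X)"

definition properly_embedded_subsurface :: "complex set \<Rightarrow> complex set \<Rightarrow> bool" where
  "properly_embedded_subsurface X S \<longleftrightarrow>
     planar_surface X \<and> X \<subseteq> S \<and> closedin (top_of_set S) X"

definition integer_lattice :: "complex set" where
  "integer_lattice = {z. Re z \<in> \<int> \<and> Im z \<in> \<int>}"


section \<open>The fundamental group and finite type\<close>

definition loops_at :: "'a::topological_space set \<Rightarrow> 'a \<Rightarrow> (real \<Rightarrow> 'a) set" where
  "loops_at X a = {p. path p \<and> path_image p \<subseteq> X \<and> pathstart p = a \<and> pathfinish p = a}"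

definition loop_class :: "'a::topological_space set \<Rightarrow> 'a \<Rightarrow> (real \<Rightarrow> 'a) \<Rightarrow> (real \<Rightarrow> 'a) set" where
  "loop_class X a p = {q \<in> loops_at X a. homotopic_paths X p q}"

definition fundamental_group ::
    "'a::topological_space set \<Rightarrow> 'a \<Rightarrow> (real \<Rightarrow> 'a) set monoid" where
  "fundamental_group X a =
     \<lparr>carrier = loop_class X a ` loops_at X a,
      mult = (\<lambda>A B. \<Union>p\<in>A. \<Union>q\<in>B. loop_class X a (p +++ q)),
      one = loop_class X a (\<lambda>t. a)\<rparr>"

definition finitely_generated_group :: "('a, 'b) monoid_scheme \<Rightarrow> bool" where
  "finitely_generated_group G \<longleftrightarrow>
     (\<exists>A. finite A \<and> A \<subseteq> carrier G \<and> generate G A = carrier G)"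

definition finite_type :: "'a::topological_space set \<Rightarrow> bool" where
  "finite_type X \<longleftrightarrow> (\<forall>a\<in>X. finitely_generated_group (fundamental_group X a))"


section \<open>Mapping class groups\<close>

text \<open>Orientations are compared through the local degree: \<open>f\<close> carries a small positively oriented
  circle around an interior point \<open>z\<close> to a loop that winds exactly once, positively, around \<open>f z\<close>.\<close>

definition orientation_preserving_on :: "complex set \<Rightarrow> (complex \<Rightarrow> complex) \<Rightarrow> bool" where
  "orientation_preserving_on X f \<longleftrightarrow>
     (\<forall>z r. 0 < r \<and> cball z r \<subseteq> X \<longrightarrow> winding_number (f \<circ> circlepath z r) (f z) = 1)"

text \<open>As in \<^theory>\<open>HOL-Algebra.Bij\<close>, self-maps of \<open>X\<close> are represented by functions that are
  \<^const>\<open>undefined\<close> off \<open>X\<close>.\<close>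

definition Homeo_bd :: "complex set \<Rightarrow> (complex \<Rightarrow> complex) set" where
  "Homeo_bd X =
     {f \<in> extensional X. (\<exists>g. homeomorphism X X f g) \<and>
        orientation_preserving_on X f \<and> (\<forall>z\<in>manifold_boundary X. f z = z)}"

definition isotopic_in :: "complex set \<Rightarrow> (complex \<Rightarrow> complex) \<Rightarrow> (complex \<Rightarrow> complex) \<Rightarrow> bool" where
  "isotopic_in X f g \<longleftrightarrow> homotopic_with_canon (\<lambda>h. h \<in> Homeo_bd X) X X f g"

definition isotopy_class :: "complex set \<Rightarrow> (complex \<Rightarrow> complex) \<Rightarrow> (complex \<Rightarrow> complex) set" where
  "isotopy_class X f = {g \<in> Homeo_bd X. isotopic_in X f g}"

definition mapping_class_group :: "complex set \<Rightarrow> (complex \<Rightarrow> complex) set monoid" where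
  "mapping_class_group X =
     \<lparr>carrier = isotopy_class X ` Homeo_bd X,
      mult = (\<lambda>A B. \<Union>f\<in>A. \<Union>g\<in>B. isotopy_class X (compose X f g)),
      one = isotopy_class X (\<lambda>z\<in>X. z)\<rparr>"

definition extend_by_id :: "complex set \<Rightarrow> complex set \<Rightarrow> (complex \<Rightarrow> complex) \<Rightarrow> complex \<Rightarrow> complex" where
  "extend_by_id X S f = (\<lambda>z\<in>S. if z \<in> X then f z else z)"

text \<open>The isotopy classes in the union all coincide: isotopies extend by the identity too.\<close>

definition mapping_class_extend :: "complex set \<Rightarrow> complex set \<Rightarrow>
    (complex \<Rightarrow> complex) set \<Rightarrow> (complex \<Rightarrow> complex) set" where
  "mapping_class_extend X S A = (\<Union>f\<in>A. isotopy_class S (extend_by_id X S f))"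


section \<open>Group homology with coefficients in a field\<close>

text \<open>Homology with trivial coefficients, computed by the inhomogeneous bar complex: the list
  \<open>[g\<^sub>1, \<dots>, g\<^sub>n]\<close> stands for the basis element usually written \<open>[g\<^sub>1 | \<dots> | g\<^sub>n]\<close>.\<close>

definition bar_chains :: "nat \<Rightarrow> ('a, 'b) monoid_scheme \<Rightarrow> ('a list \<Rightarrow>\<^sub>0 'k::field) set" where
  "bar_chains n G = {c. Poly_Mapping.keys c \<subseteq> {xs. length xs = n \<and> set xs \<subseteq> carrier G}}"

definition bar_face :: "('a, 'b) monoid_scheme \<Rightarrow> nat \<Rightarrow> 'a list \<Rightarrow> 'a list" where
  "bar_face G j xs =
     (if j = 0 then tl xs
      else if j = length xs then butlast xs
      else take (j - 1) xs @ (xs ! (j - 1) \<otimes>\<^bsub>G\<^esub> xs ! j) # drop (j + 1) xs)"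

definition bar_boundary :: "('a, 'b) monoid_scheme \<Rightarrow> ('a list \<Rightarrow>\<^sub>0 'k::field) \<Rightarrow> ('a list \<Rightarrow>\<^sub>0 'k)" where
  "bar_boundary G c =
     (\<Sum>xs \<in> Poly_Mapping.keys c - {[]}. \<Sum>j\<le>length xs.
        Poly_Mapping.single (bar_face G j xs) ((-1) ^ j * Poly_Mapping.lookup c xs))"

definition bar_cycle_group ::
    "nat \<Rightarrow> ('a, 'b) monoid_scheme \<Rightarrow> ('a list \<Rightarrow>\<^sub>0 'k::field) monoid" where
  "bar_cycle_group n G =
     \<lparr>carrier = {c \<in> bar_chains n G. bar_boundary G c = 0}, mult = (+), one = 0\<rparr>"

definition bar_boundaries :: "nat \<Rightarrow> ('a, 'b) monoid_scheme \<Rightarrow> ('a list \<Rightarrow>\<^sub>0 'k::field) set" where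
  "bar_boundaries n G = bar_boundary G ` bar_chains (Suc n) G"

text \<open>The field of coefficients is the type \<open>'k\<close>.\<close>

definition group_homology ::
    "'k::field itself \<Rightarrow> nat \<Rightarrow> ('a, 'b) monoid_scheme \<Rightarrow> ('a list \<Rightarrow>\<^sub>0 'k) set monoid" where
  "group_homology _ n G = bar_cycle_group n G Mod bar_boundaries n G"

definition bar_chain_map :: "('a \<Rightarrow> 'c) \<Rightarrow> ('a list \<Rightarrow>\<^sub>0 'k::field) \<Rightarrow> ('c list \<Rightarrow>\<^sub>0 'k)" where
  "bar_chain_map \<phi> c =
     (\<Sum>xs \<in> Poly_Mapping.keys c. Poly_Mapping.single (map \<phi> xs) (Poly_Mapping.lookup c xs))"

text \<open>The map induced on homology by a homomorphism \<open>\<phi>\<close> into \<open>H\<close> sends the class of a cycle \<open>c\<close> to the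
  class of \<open>bar_chain_map \<phi> c\<close>; all members of the union are the same class.\<close>

definition group_homology_map :: "nat \<Rightarrow> ('c, 'd) monoid_scheme \<Rightarrow> ('a \<Rightarrow> 'c) \<Rightarrow>
    ('a list \<Rightarrow>\<^sub>0 'k::field) set \<Rightarrow> ('c list \<Rightarrow>\<^sub>0 'k) set" where
  "group_homology_map n H \<phi> A =
     (\<Union>c\<in>A. bar_boundaries n H #>\<^bsub>bar_cycle_group n H\<^esub> bar_chain_map \<phi> c)"

end

theory Submission
  imports Defs "HOL-Complex_Analysis.Riemann_Mapping"
begin

text \<open>The proof is an infinite swindle. Let \<open>X\<close> be the subsurface and \<open>S\<close> the plane without the lattice.

  Outside a large disc \<open>S\<close> is connected and misses the boundary of \<open>X\<close>, so it lies in \<open>X\<close> or is disjoint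
  from it. In the first case \<open>X\<close> surrounds infinitely many punctures, while finitely many loops wind
  around only finitely many of them, so \<open>X\<close> is neither compact nor of finite type. Hence \<open>X\<close> is bounded
  (\<open>finite_type_imp_bounded\<close>), and \<open>S\<close> contains infinitely many disjoint translates of it.

  For a widely spaced set \<open>P\<close> of lattice points, \<open>place P f\<close> performs a homeomorphism \<open>f\<close> of \<open>X\<close>
  simultaneously in all translates \<open>X + p\<close>. It induces a homomorphism from \<open>Map X\<close> to \<open>Map S\<close>; for
  \<open>P = {0}\<close> this is the homomorphism \<open>\<phi>\<close> of the theorem. Let \<open>\<psi>\<^sub>l\<close> belong to the translates in the row
  \<open>l\<close> of a large square grid in the first quadrant. A shear in the vertical direction moves the original
  copy of \<open>X\<close> to the beginning of this row, and a shear in the horizontal direction then shifts the row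
  by one place. Their composite \<open>d\<^sub>l\<close> therefore satisfies \<open>d\<^sub>l \<phi>(a) \<psi>\<^sub>l(a) = \<psi>\<^sub>l(a) d\<^sub>l\<close>: the homomorphisms
  \<open>a \<mapsto> \<phi>(a) \<psi>\<^sub>l(a)\<close> and \<open>\<psi>\<^sub>l\<close> are conjugate and agree on homology.

  On the other hand, by the Kuenneth formula \<open>a \<mapsto> \<phi>(a) \<psi>\<^sub>l(a)\<close> induces the sum of the maps of \<open>\<phi>\<close> and
  \<open>\<psi>\<^sub>l\<close> and of cross products whose first factor is the image under \<open>\<phi>\<close> of a class of lower positive
  degree. These cross products vanish as soon as \<open>\<phi>\<close> is zero in lower positive degrees already as a map
  into a subgroup that commutes with the image of \<open>\<psi>\<^sub>l\<close>. Here the many rows come in: with \<open>K\<^sub>j\<close> the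
  centralizer of the rows from \<open>j\<close> onwards, induction on \<open>j\<close> shows that \<open>\<phi>\<close> is zero into the homology
  of \<open>K\<^sub>j\<close> in degrees \<open>1, \<dots>, j\<close>. The step uses the row \<open>j\<close>, since \<open>d\<^sub>j\<close> commutes with all later rows
  (\<open>homology_vanishes_of_shifts\<close>).

  The Kuenneth argument is carried out with chains (\<open>push_mult_hom\<close>). The bar complex is a quotient of the
  complex of lists of group elements, whose boundary has a simple recursion along the list; there the
  shuffle product, the Alexander--Whitney diagonal and the homotopy between their composite and the
  diagonal map are elementary. That the coefficients form a field enters through \<open>null_homotopy_exists\<close>:
  a chain map that is zero on homology is null-homotopic.

  The topological part also has to show that mapping classes form a group. Orientations are compared by
  winding numbers, so this rests on the multiplicativity of the local degree, which follows by lifting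
  loops in a punctured disc through the exponential function (\<open>winding_number_mult_degree\<close>).\<close>

section \<open>Linear extension of maps between free vector spaces\<close>

definition scale :: "'k::field \<Rightarrow> ('a \<Rightarrow>\<^sub>0 'k) \<Rightarrow> 'a \<Rightarrow>\<^sub>0 'k" where
  "scale a c = Poly_Mapping.map ((*) a) c"

definition lin :: "('a \<Rightarrow> 'b \<Rightarrow>\<^sub>0 'k::field) \<Rightarrow> ('a \<Rightarrow>\<^sub>0 'k) \<Rightarrow> ('b \<Rightarrow>\<^sub>0 'k)" where
  "lin f c = (\<Sum>x\<in>Poly_Mapping.keys c. scale (Poly_Mapping.lookup c x) (f x))"

abbreviation basis :: "'a \<Rightarrow> ('a \<Rightarrow>\<^sub>0 'k::field)" where
  "basis x \<equiv> Poly_Mapping.single x 1"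

abbreviation push :: "('a \<Rightarrow> 'b) \<Rightarrow> ('a \<Rightarrow>\<^sub>0 'k::field) \<Rightarrow> ('b \<Rightarrow>\<^sub>0 'k)" where
  "push u \<equiv> lin (\<lambda>x. basis (u x))"

lemma lookup_scale [simp]: "Poly_Mapping.lookup (scale a c) x = a * Poly_Mapping.lookup c x"
  by (simp add: scale_def Poly_Mapping.map.rep_eq when_def)

interpretation chain: vector_space "scale :: 'k::field \<Rightarrow> ('a \<Rightarrow>\<^sub>0 'k) \<Rightarrow> 'a \<Rightarrow>\<^sub>0 'k"
  by unfold_locales (auto intro!: poly_mapping_eqI simp: lookup_add algebra_simps)

lemma scale_single [simp]: "scale a (Poly_Mapping.single x b) = Poly_Mapping.single x (a * b)"
  by (rule poly_mapping_eqI) (simp add: lookup_single when_def)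

lemma lin_superset:
  assumes "finite A" "Poly_Mapping.keys c \<subseteq> A"
  shows "lin f c = (\<Sum>x\<in>A. scale (Poly_Mapping.lookup c x) (f x))"
  unfolding lin_def using assms
  by (intro sum.mono_neutral_left) (auto simp: in_keys_iff)

lemma lin_add: "lin f (c + d) = lin f c + lin f d"
proof -
  let ?A = "Poly_Mapping.keys c \<union> Poly_Mapping.keys d"
  have "Poly_Mapping.keys (c + d) \<subseteq> ?A" by (rule Poly_Mapping.keys_add)
  then show ?thesis
    by (simp add: lin_superset[of ?A] lookup_add chain.scale_left_distrib sum.distrib)
qed

lemma lin_scale: "lin f (scale a c) = scale a (lin f c)"
proof -
  have "Poly_Mapping.keys (scale a c) \<subseteq> Poly_Mapping.keys c" by (auto simp: in_keys_iff)
  then show ?thesis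
    by (simp add: lin_superset[of "Poly_Mapping.keys c"] chain.scale_sum_right)
qed

lemma lin_zero [simp]: "lin f 0 = 0"
  by (simp add: lin_def)

lemma lin_single [simp]: "lin f (Poly_Mapping.single x a) = scale a (f x)"
  by (cases "a = 0") (auto simp: lin_def)

lemma linear_lin: "Vector_Spaces.linear scale scale (lin f)"
  by unfold_locales (auto simp: lin_add lin_scale)

lemma lin_uminus: "lin f (- c) = - lin f c"
  by (metis add.right_inverse add_eq_0_iff lin_add lin_zero)

lemma lin_diff: "lin f (c - d) = lin f c - lin f d"
  by (simp only: diff_conv_add_uminus lin_add lin_uminus)

lemma lin_sum: "lin f (sum g A) = (\<Sum>x\<in>A. lin f (g x))"
  by (induction A rule: infinite_finite_induct) (auto simp: lin_add)

lemmas lin_simps = lin_add lin_scale lin_uminus lin_diff lin_sum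

lemma lin_cong: "(\<And>x. x \<in> Poly_Mapping.keys c \<Longrightarrow> f x = g x) \<Longrightarrow> lin f c = lin g c"
  by (simp add: lin_def)

lemma lin_fun_add: "lin (\<lambda>x. f x + g x) c = lin f c + lin g c"
  by (simp add: lin_def chain.scale_right_distrib sum.distrib)

lemma lin_fun_diff: "lin (\<lambda>x. f x - g x) c = lin f c - lin g c"
  by (simp add: lin_def chain.scale_right_diff_distrib sum_subtractf)

lemma lin_fun_zero [simp]: "lin (\<lambda>x. 0) c = 0"
  by (simp add: lin_def)

lemma lin_fun_scale: "lin (\<lambda>x. scale a (f x)) c = scale a (lin f c)"
  by (simp add: lin_def chain.scale_sum_right mult.commute)

lemma lin_basis [simp]: "lin basis c = c"
proof (rule poly_mapping_eqI)
  fix x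
  have "Poly_Mapping.lookup (lin basis c) x =
      (\<Sum>y\<in>Poly_Mapping.keys c. if y = x then Poly_Mapping.lookup c y else 0)"
    unfolding lin_def lookup_sum by (intro sum.cong) (auto simp: lookup_single when_def)
  then show "Poly_Mapping.lookup (lin basis c) x = Poly_Mapping.lookup c x"
    by (simp add: in_keys_iff)
qed

lemma lin_lin: "lin f (lin g c) = lin (\<lambda>x. lin f (g x)) c"
  by (simp add: lin_def[of g] lin_def[of "\<lambda>x. lin f (g x)"] lin_sum lin_scale)

lemma linear_eq_lin:
  assumes "Vector_Spaces.linear scale scale L"
  shows "L c = lin (\<lambda>x. L (basis x)) c"
proof -
  interpret Vector_Spaces.linear scale scale L by (rule assms)
  have "L c = L (lin basis c)" by simp
  also have "\<dots> = lin (\<lambda>x. L (basis x)) c"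
    unfolding lin_def sum scale ..
  finally show ?thesis .
qed

definition chains_on :: "'a set \<Rightarrow> ('a \<Rightarrow>\<^sub>0 'k::field) set" where
  "chains_on A = {c. Poly_Mapping.keys c \<subseteq> A}"

lemma subspace_chains_on: "chain.subspace (chains_on A :: ('a \<Rightarrow>\<^sub>0 'k::field) set)"
  unfolding chain.subspace_def chains_on_def
proof safe
  fix c d :: "'a \<Rightarrow>\<^sub>0 'k" and x
  assume "Poly_Mapping.keys c \<subseteq> A" "Poly_Mapping.keys d \<subseteq> A" "x \<in> Poly_Mapping.keys (c + d)"
  then show "x \<in> A" using Poly_Mapping.keys_add[of c d] by blast
next
  fix a :: 'k and c :: "'a \<Rightarrow>\<^sub>0 'k" and x
  assume "Poly_Mapping.keys c \<subseteq> A" "x \<in> Poly_Mapping.keys (scale a c)"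
  then show "x \<in> A" by (auto simp: in_keys_iff subset_iff)
qed simp

lemma single_in_chains_on: "x \<in> A \<Longrightarrow> Poly_Mapping.single x a \<in> chains_on A"
  by (auto simp: chains_on_def)

lemma lin_in_subspace:
  assumes "chain.subspace V" "\<And>x. x \<in> Poly_Mapping.keys c \<Longrightarrow> f x \<in> V"
  shows "lin f c \<in> V"
  unfolding lin_def using assms by (intro chain.subspace_sum chain.subspace_scale) auto

lemma lin_in_chains_on:
  assumes "c \<in> chains_on A" "\<And>x. x \<in> A \<Longrightarrow> f x \<in> chains_on B"
  shows "lin f c \<in> chains_on B"
  using assms by (intro lin_in_subspace subspace_chains_on) (auto simp: chains_on_def)

lemma lin_cong_on: "c \<in> chains_on A \<Longrightarrow> (\<And>x. x \<in> A \<Longrightarrow> f x = g x) \<Longrightarrow> lin f c = lin g c"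
  by (rule lin_cong) (auto simp: chains_on_def)

lemmas chains_on_closed =
  chain.subspace_0[OF subspace_chains_on] chain.subspace_add[OF subspace_chains_on]
  chain.subspace_diff[OF subspace_chains_on] chain.subspace_scale[OF subspace_chains_on]
  chain.subspace_sum[OF subspace_chains_on]

section \<open>Ordered simplices, shuffles and the Eilenberg--Zilber homotopy\<close>

abbreviation cone :: "'a \<Rightarrow> ('a list \<Rightarrow>\<^sub>0 'k::field) \<Rightarrow> ('a list \<Rightarrow>\<^sub>0 'k)" where
  "cone x \<equiv> push ((#) x)"

text \<open>A list of length \<open>n + 1\<close> is an ordered \<open>n\<close>-simplex. The complex is augmented by the empty list, so that
  coning from a vertex contracts it in every degree (\<open>bd_cone\<close>) and the recursion has no special case.\<close>

primrec bd :: "'a list \<Rightarrow> ('a list \<Rightarrow>\<^sub>0 'k::field)" where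
  "bd [] = 0"
| "bd (x # xs) = basis xs - cone x (bd xs)"

lemma bd_cone: "lin bd (cone x c) = c - cone x (lin bd c)"
  by (simp add: lin_lin lin_fun_diff del: lin_basis) (simp)

lemma bd_bd [simp]: "lin bd (bd xs) = (0 :: 'a list \<Rightarrow>\<^sub>0 'k::field)"
  by (induction xs) (simp_all add: lin_diff bd_cone)

lemma bd_eq_sum:
  "bd xs = (\<Sum>j<length xs. Poly_Mapping.single (take j xs @ drop (Suc j) xs) ((-1) ^ j))"
proof (induction xs)
  case (Cons x xs)
  then show ?case
    by (simp add: sum.lessThan_Suc_shift lin_sum single_uminus sum_negf del: sum.lessThan_Suc)
qed simp

text \<open>Such lists serve two complexes: they have degree \<open>n - 1\<close> as ordered simplices and degree \<open>n\<close> as bar chains.\<close>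

definition simplices :: "nat \<Rightarrow> 'a set \<Rightarrow> 'a list set" where
  "simplices n A = {xs. length xs = n \<and> set xs \<subseteq> A}"

lemma cone_in_chains:
  "c \<in> chains_on (simplices n A) \<Longrightarrow> x \<in> A \<Longrightarrow> cone x c \<in> chains_on (simplices (Suc n) A)"
  by (rule lin_in_chains_on) (auto simp: simplices_def intro!: single_in_chains_on)

lemma bd_in_chains: "xs \<in> simplices (Suc n) A \<Longrightarrow> bd xs \<in> chains_on (simplices n A)"
proof (induction xs arbitrary: n)
  case (Cons x xs)
  show ?case
  proof (cases n)
    case 0
    then show ?thesis using Cons.prems by (auto simp: simplices_def intro: single_in_chains_on)
  next
    case (Suc m)
    then show ?thesis using Cons
      by (auto simp: simplices_def intro!: chains_on_closed single_in_chains_on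
          cone_in_chains[unfolded simplices_def])
  qed
qed (simp add: simplices_def)

lemma push_cone: "push (map u) (cone x c) = cone (u x) (push (map u) c)"
  by (simp add: lin_lin)

lemma push_bd: "push (map u) (bd xs) = bd (map u xs)"
  by (induction xs) (simp_all add: lin_diff push_cone)

text \<open>The shuffle product of two simplices: the sum over all monotone lattice paths through the grid of pairs
  of vertices. A path begins at the corner \<open>(x, y)\<close> and continues with a step in the first or in the second
  direction; a step in the second direction passes the \<open>length xs\<close> remaining steps in the first one, which
  gives the sign. Products with the empty list are \<open>0\<close>, because a path that has used up one of its
  coordinates has already left the grid.\<close>

fun ez :: "'a list \<Rightarrow> 'b list \<Rightarrow> (('a \<times> 'b) list \<Rightarrow>\<^sub>0 'k::field)" where
  "ez (x # xs) (y # ys) = cone (x, y)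
     (if xs = [] \<and> ys = [] then basis []
      else ez xs (y # ys) + scale ((-1) ^ length xs) (ez (x # xs) ys))"
| "ez _ _ = 0"

lemma ez_Nil [simp]: "ez [] ys = 0" "ez xs [] = 0"
  by (cases xs; simp)+

lemma lin_ez_Nil [simp]: "lin (ez []) c = 0"
  by (simp add: lin_def)

lemma push_ez: "push (map (map_prod u v)) (ez xs ys) = ez (map u xs) (map v ys)"
proof (induction xs ys rule: ez.induct)
  case (1 x xs y ys)
  show ?case
  proof (cases "xs = [] \<and> ys = []")
    case False
    then show ?thesis using 1[OF False]
      by (simp only: ez.simps push_cone map_prod_simp lin_add lin_scale list.map if_False map_is_Nil_conv length_map)
  qed (simp add: push_cone)
qed auto

lemma ez_in_chains:
  "xs \<in> simplices m A \<Longrightarrow> ys \<in> simplices n B \<Longrightarrow> ez xs ys \<in> chains_on (simplices (m + n - 1) (A \<times> B))"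
proof (induction xs ys arbitrary: m n rule: ez.induct)
  case (1 x xs y ys)
  show ?case
  proof (cases "xs = [] \<and> ys = []")
    case True
    then show ?thesis using 1(3,4) by (auto simp: simplices_def intro!: single_in_chains_on)
  next
    case False
    define c :: "('a \<times> 'b) list \<Rightarrow>\<^sub>0 'c"
      where "c = ez xs (y # ys) + scale ((-1) ^ length xs) (ez (x # xs) ys)"
    obtain m' n' where mn: "m = Suc m'" "n = Suc n'" "xs \<in> simplices m' A" "ys \<in> simplices n' B"
      "x \<in> A" "y \<in> B" "x # xs \<in> simplices (Suc m') A" "y # ys \<in> simplices (Suc n') B"
      using 1(3,4) by (auto simp: simplices_def)
    have "ez xs (y # ys) \<in> (chains_on (simplices (m' + n') (A \<times> B)) :: (_ \<Rightarrow>\<^sub>0 'c) set)"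
      "ez (x # xs) ys \<in> (chains_on (simplices (m' + n') (A \<times> B)) :: (_ \<Rightarrow>\<^sub>0 'c) set)"
      using 1(1)[OF False, of m' "Suc n'"] 1(2)[OF False, of "Suc m'" n'] mn by auto
    then have "c \<in> chains_on (simplices (m' + n') (A \<times> B))"
      unfolding c_def by (intro chains_on_closed)
    then have "cone (x, y) c \<in> chains_on (simplices (Suc (m' + n')) (A \<times> B))"
      using mn by (intro cone_in_chains) auto
    moreover have "ez (x # xs) (y # ys) = cone (x, y) c" using False by (auto simp: c_def)
    ultimately show ?thesis using mn by simp
  qed
qed (auto intro: chains_on_closed)

text \<open>The recursion of the shuffle product, for a chain of cones in the first argument; \<open>lin_ez_cone2\<close> is the
  same for the second argument. The degree \<open>n\<close> of the chain determines the sign.\<close>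

lemma lin_ez_cone:
  "c \<in> chains_on (simplices n A) \<Longrightarrow> n + length ys \<noteq> 0 \<Longrightarrow>
   lin (\<lambda>u. ez u (y # ys)) (cone x c) =
     cone (x, y) (lin (\<lambda>u. ez u (y # ys)) c + scale ((-1) ^ n) (lin (\<lambda>u. ez u ys) (cone x c)))"
proof -
  assume c: "c \<in> chains_on (simplices n A)" "n + length ys \<noteq> 0"
  have "lin (\<lambda>u. ez u (y # ys)) (cone x c) = lin (\<lambda>u. ez (x # u) (y # ys)) c"
    unfolding lin_lin by simp
  also have "\<dots> = lin (\<lambda>u. cone (x, y) (ez u (y # ys) + scale ((-1) ^ n) (ez (x # u) ys))) c"
    by (rule lin_cong_on[OF c(1)]) (use c(2) in \<open>auto simp: simplices_def\<close>)
  also have "\<dots> = cone (x, y) (lin (\<lambda>u. ez u (y # ys)) c + scale ((-1) ^ n) (lin (\<lambda>u. ez (x # u) ys) c))"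
    unfolding lin_lin[symmetric] lin_fun_add lin_fun_scale ..
  also have "lin (\<lambda>u. ez (x # u) ys) c = lin (\<lambda>u. ez u ys) (cone x c)"
    unfolding lin_lin by simp
  finally show ?thesis .
qed

lemma lin_ez_cone2:
  "c \<in> chains_on (simplices n A) \<Longrightarrow> n + length xs \<noteq> 0 \<Longrightarrow>
   lin (ez (x # xs)) (cone y c) =
     cone (x, y) (lin (ez xs) (cone y c) + scale ((-1) ^ length xs) (lin (ez (x # xs)) c))"
proof -
  assume c: "c \<in> chains_on (simplices n A)" "n + length xs \<noteq> 0"
  have "lin (ez (x # xs)) (cone y c) = lin (\<lambda>u. ez (x # xs) (y # u)) c"
    unfolding lin_lin by simp
  also have "\<dots> = lin (\<lambda>u. cone (x, y) (ez xs (y # u) + scale ((-1) ^ length xs) (ez (x # xs) u))) c"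
    by (rule lin_cong_on[OF c(1)]) (use c(2) in \<open>auto simp: simplices_def\<close>)
  also have "\<dots> = cone (x, y) (lin (\<lambda>u. ez xs (y # u)) c + scale ((-1) ^ length xs) (lin (ez (x # xs)) c))"
    unfolding lin_lin[symmetric] lin_fun_add lin_fun_scale ..
  also have "lin (\<lambda>u. ez xs (y # u)) c = lin (ez xs) (cone y c)"
    unfolding lin_lin by simp
  finally show ?thesis .
qed

text \<open>The Leibniz rule. The corner \<open>(x, y)\<close> is a cone point, so removing it returns the two summands of the
  recursion, and the remaining faces are given by induction. For two single vertices the rule fails: the
  boundary of their product is the augmentation \<open>[]\<close>, whereas products with \<open>[]\<close> are \<open>0\<close>.\<close>

lemma bd_ez:
  "xs \<noteq> [] \<Longrightarrow> ys \<noteq> [] \<Longrightarrow> length xs + length ys \<noteq> 2 \<Longrightarrow>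
   lin bd (ez xs ys) = lin (\<lambda>u. ez u ys) (bd xs) +
     scale ((-1) ^ (length xs - 1)) (lin (ez xs) (bd ys))"
proof (induction xs ys rule: ez.induct)
  case (1 x xs y ys)
  let ?p = "(-1) ^ length xs :: 'c"
  have ne: "\<not> (xs = [] \<and> ys = [])" using 1(5) by auto
  note IH1 = 1(1)[OF ne] and IH2 = 1(2)[OF ne]
  have bx: "xs \<noteq> [] \<Longrightarrow> bd xs \<in> (chains_on (simplices (length xs - 1) UNIV) :: (_ \<Rightarrow>\<^sub>0 'c) set)"
    by (rule bd_in_chains) (auto simp: simplices_def)
  have b_y: "ys \<noteq> [] \<Longrightarrow> bd ys \<in> (chains_on (simplices (length ys - 1) UNIV) :: (_ \<Rightarrow>\<^sub>0 'c) set)"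
    by (rule bd_in_chains) (auto simp: simplices_def)
  consider "length xs + length ys = 1" | "xs = []" "length ys > 1" | "length xs > 1" "ys = []"
    | "xs \<noteq> []" "ys \<noteq> []" using ne by (cases xs; cases ys) auto
  then show ?case
  proof cases
    case 1
    then show ?thesis by (cases xs; cases ys) (auto simp: lin_diff)
  next
    case 2
    then have "ys \<noteq> []" by auto
    then show ?thesis
      using 2 IH2 lin_ez_cone2[OF b_y, of xs x y] by (simp add: lin_diff bd_cone)
  next
    case 3
    then have "xs \<noteq> []" by auto
    then show ?thesis
      using 3 IH1 lin_ez_cone[OF bx, of ys y x] by (simp add: lin_diff bd_cone)
  next
    case 4
    have p: "?p * ?p = 1" "(-1) ^ (length xs - 1) = - ?p"
      using 4 by (auto simp flip: power_add) (cases xs; simp)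
    define C :: "(('a \<times> 'b) list \<Rightarrow>\<^sub>0 'c) \<Rightarrow> _" where "C = cone (x, y)"
    define U W E V Z where "U = lin (\<lambda>u. ez u (y # ys)) (bd xs :: _ \<Rightarrow>\<^sub>0 'c)"
      and "W = lin (\<lambda>u. ez u ys) (cone x (bd xs) :: _ \<Rightarrow>\<^sub>0 'c)"
      and "E = (ez xs ys :: _ \<Rightarrow>\<^sub>0 'c)"
      and "V = lin (ez xs) (cone y (bd ys) :: _ \<Rightarrow>\<^sub>0 'c)"
      and "Z = lin (ez (x # xs)) (bd ys :: _ \<Rightarrow>\<^sub>0 'c)"
    note defs = C_def U_def W_def E_def V_def Z_def
    have b1: "lin bd (ez xs (y # ys)) = U - scale ?p (E - V)"
    proof -
      have "lin bd (ez xs (y # ys)) = lin (\<lambda>u. ez u (y # ys)) (bd xs) +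
          scale ((-1) ^ (length xs - 1)) (lin (ez xs) (bd (y # ys)) :: _ \<Rightarrow>\<^sub>0 'c)"
        by (rule IH1) (use 4 in \<open>auto simp: neq_Nil_conv\<close>)
      then show ?thesis
        unfolding p(2) bd.simps lin_diff lin_single chain.scale_one chain.scale_minus_left defs by simp
    qed
    have b2: "lin bd (ez (x # xs) ys) = E - W + scale ?p Z"
    proof -
      have "lin bd (ez (x # xs) ys) = lin (\<lambda>u. ez u ys) (bd (x # xs)) +
          scale ((-1) ^ (length (x # xs) - 1)) (lin (ez (x # xs)) (bd ys) :: _ \<Rightarrow>\<^sub>0 'c)"
        by (rule IH2) (use 4 in \<open>auto simp: neq_Nil_conv\<close>)
      then show ?thesis
        unfolding bd.simps lin_diff lin_single chain.scale_one defs by simp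
    qed
    have l1: "lin (\<lambda>u. ez u (y # ys)) (cone x (bd xs)) = C (U - scale ?p W)"
      using lin_ez_cone[OF bx, of ys y x] 4 unfolding defs p(2) by simp
    have l2: "lin (ez (x # xs)) (cone y (bd ys)) = C (V + scale ?p Z)"
      using lin_ez_cone2[OF b_y, of xs x y] 4 unfolding defs by simp
    have e: "ez (x # xs) (y # ys) = C (ez xs (y # ys) + scale ?p (ez (x # xs) ys))"
      using ne by (auto simp: C_def)
    have bdC: "lin bd (C w) = w - C (lin bd w)" for w
      unfolding C_def by (rule bd_cone)
    have "lin bd (ez (x # xs) (y # ys)) =
        ez xs (y # ys) + scale ?p (ez (x # xs) ys)
        - C (U - scale ?p (E - V) + scale ?p (E - W + scale ?p Z))"
      unfolding e bdC lin_add lin_scale b1 b2 ..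
    also have "U - scale ?p (E - V) + scale ?p (E - W + scale ?p Z)
        = (U - scale ?p W) + scale ?p (V + scale ?p Z)"
      by (simp add: chain.scale_right_distrib chain.scale_right_diff_distrib p(1))
    also have "C \<dots> = C (U - scale ?p W) + scale ?p (C (V + scale ?p Z))"
      unfolding C_def by (simp only: lin_add lin_scale)
    finally show ?thesis
      unfolding l1[symmetric] l2[symmetric] bd.simps lin_diff lin_single chain.scale_one list.size
      by (simp only: chain.scale_right_diff_distrib) simp
  qed
qed auto

text \<open>The Alexander--Whitney diagonal, which splits a simplex into a front and a back face with a common
  vertex. An arbitrary pairing \<open>B\<close> of the two faces takes the place of the tensor product of complexes.\<close>

definition aw :: "('a list \<Rightarrow> 'a list \<Rightarrow> ('b \<Rightarrow>\<^sub>0 'k::field)) \<Rightarrow> 'a list \<Rightarrow> ('b \<Rightarrow>\<^sub>0 'k)" where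
  "aw B xs = (\<Sum>p<length xs. B (take (Suc p) xs) (drop p xs))"

text \<open>The pairing \<open>B\<close> applied to the boundary, in the tensor product, of the diagonal of \<open>xs\<close>.\<close>

definition aw_diff :: "('a list \<Rightarrow> 'a list \<Rightarrow> ('b \<Rightarrow>\<^sub>0 'k::field)) \<Rightarrow> 'a list \<Rightarrow> ('b \<Rightarrow>\<^sub>0 'k)" where
  "aw_diff B xs = (\<Sum>p<length xs. lin (\<lambda>u. B u (drop p xs)) (bd (take (Suc p) xs))
     + scale ((-1) ^ p) (lin (B (take (Suc p) xs)) (bd (drop p xs))))"

lemma aw_Cons: "aw B (x # xs) = B [x] (x # xs) + aw (\<lambda>u. B (x # u)) xs"
  by (simp add: aw_def sum.lessThan_Suc_shift del: sum.lessThan_Suc)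

lemma aw_diff_Cons:
  "aw_diff B (x # xs) = B [] (x # xs) + lin (B [x]) (bd (x # xs)) + aw B xs
     - aw_diff (\<lambda>u. B (x # u)) xs"
  by (simp add: aw_diff_def aw_def sum.lessThan_Suc_shift lin_diff lin_lin sum.distrib sum_subtractf
      sum_negf algebra_simps del: sum.lessThan_Suc)

text \<open>The Alexander--Whitney diagonal is a chain map, because the last face of a front part and the first
  face of the next back part cancel. At the two ends this leaves pairings with \<open>[]\<close>; they are kept here,
  since the induction replaces \<open>B\<close> by a pairing for which they do not vanish.\<close>

lemma aw_bd_general:
  "xs \<noteq> [] \<Longrightarrow> aw_diff B xs = lin (aw B) (bd xs) + B [] xs + scale ((-1) ^ (length xs - 1)) (B xs [])"
proof (induction xs arbitrary: B)
  case (Cons x xs)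
  show ?case
  proof (cases "xs = []")
    case True
    then show ?thesis by (simp add: aw_diff_def aw_def)
  next
    case False
    have s: "scale ((-1) ^ length xs) c = - scale ((-1) ^ (length xs - 1)) c" for c :: "'b \<Rightarrow>\<^sub>0 'c"
      using False by (cases xs) auto
    have "lin (aw B) (cone x (bd xs))
        = lin (\<lambda>w. B [x] (x # w)) (bd xs) + lin (aw (\<lambda>u. B (x # u))) (bd xs)"
      unfolding lin_lin lin_fun_add[symmetric] by (simp add: aw_Cons)
    then show ?thesis
      using Cons.IH[OF False, of "\<lambda>u. B (x # u)"]
      by (simp add: aw_diff_Cons lin_diff lin_lin s)
  qed
qed simp

lemma aw_bd:
  assumes "\<And>v. B [] v = 0" "\<And>u. B u [] = 0"
  shows "lin (aw B) (bd xs) = aw_diff B xs"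
  using aw_bd_general[of xs B] assms by (cases "xs = []") (auto simp: aw_diff_def)

text \<open>The error between the diagonal map and the shuffle product of the Alexander--Whitney diagonal.\<close>

definition diag :: "'a list \<Rightarrow> (('a \<times> 'a) list \<Rightarrow>\<^sub>0 'k::field)" where
  "diag xs = (if xs = [] then 0 else basis (map (\<lambda>x. (x, x)) xs)) - aw ez xs"

lemma diag_singleton: "diag [x] = 0"
  by (simp add: diag_def aw_def)

lemma bd_diag:
  assumes "length xs \<ge> 2"
  shows "lin bd (diag xs) = lin diag (bd xs :: _ \<Rightarrow>\<^sub>0 'k::field)"
proof -
  have "lin bd (aw ez xs) = (aw_diff ez xs :: _ \<Rightarrow>\<^sub>0 'k)"
    unfolding aw_def lin_sum aw_diff_def
  proof (rule sum.cong)
    fix p assume "p \<in> {..<length xs}"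
    then show "lin bd (ez (take (Suc p) xs) (drop p xs)) =
        lin (\<lambda>u. ez u (drop p xs)) (bd (take (Suc p) xs))
        + scale ((-1) ^ p) (lin (ez (take (Suc p) xs)) (bd (drop p xs)) :: _ \<Rightarrow>\<^sub>0 'k)"
      using assms by (subst bd_ez) auto
  qed simp
  then have 1: "lin bd (aw ez xs) = lin (aw ez) (bd xs :: _ \<Rightarrow>\<^sub>0 'k)"
    by (subst aw_bd) auto
  have "lin bd (basis (map (\<lambda>x. (x, x)) xs)) = push (map (\<lambda>x. (x, x))) (bd xs :: _ \<Rightarrow>\<^sub>0 'k)"
    by (simp add: push_bd)
  also have "\<dots> = lin (\<lambda>xs. if xs = [] then 0 else basis (map (\<lambda>x. (x, x)) xs)) (bd xs)"
  proof (rule lin_cong_on)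
    show "bd xs \<in> chains_on (simplices (length xs - 1) UNIV)"
      using assms by (intro bd_in_chains) (auto simp: simplices_def)
  qed (use assms in \<open>auto simp: simplices_def\<close>)
  finally show ?thesis
    using assms 1 unfolding diag_def lin_fun_diff by (auto simp: lin_diff)
qed

text \<open>A null-homotopy of the natural chain map \<open>diag\<close>, by the method of acyclic models: in each degree the
  part of \<open>diag\<close> that lower degrees leave over is a cycle, and it is filled by coning it off from the
  first vertex. The first argument is the length of the list.\<close>

primrec htp :: "nat \<Rightarrow> 'a list \<Rightarrow> (('a \<times> 'a) list \<Rightarrow>\<^sub>0 'k::field)" where
  "htp 0 xs = 0"
| "htp (Suc n) xs = cone (hd xs, hd xs) (diag xs - lin (htp n) (bd xs))"

lemma bd_htp:
  "length xs = Suc n \<Longrightarrow> lin bd (htp (Suc n) xs) = diag xs - lin (htp n) (bd xs :: _ \<Rightarrow>\<^sub>0 'k::field)"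
proof (induction n arbitrary: xs)
  case 0
  then show ?case by (auto simp: length_Suc_conv diag_singleton)
next
  case (Suc n)
  have b: "bd xs \<in> (chains_on (simplices (Suc n) UNIV) :: (_ \<Rightarrow>\<^sub>0 'k) set)"
    using Suc.prems by (intro bd_in_chains) (auto simp: simplices_def)
  have "lin bd (lin (htp (Suc n)) (bd xs)) = lin (\<lambda>u. lin bd (htp (Suc n) u)) (bd xs :: _ \<Rightarrow>\<^sub>0 'k)"
    by (rule lin_lin)
  also have "\<dots> = lin (\<lambda>u. diag u - lin (htp n) (bd u)) (bd xs)"
    by (rule lin_cong_on[OF b]) (use Suc.IH in \<open>auto simp: simplices_def\<close>)
  also have "\<dots> = lin diag (bd xs) - lin (htp n) (lin bd (bd xs))"
    unfolding lin_fun_diff lin_lin ..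
  also have "\<dots> = lin diag (bd xs)" by simp
  finally have *: "lin bd (lin (htp (Suc n)) (bd xs)) = lin diag (bd xs :: _ \<Rightarrow>\<^sub>0 'k)" .
  have d: "lin bd (diag xs) = lin diag (bd xs :: _ \<Rightarrow>\<^sub>0 'k)"
    using Suc.prems by (intro bd_diag) simp
  show ?case
    unfolding htp.simps(2)[of "Suc n"] bd_cone lin_diff * d by (simp del: htp.simps)
qed

lemma push_aw_ez: "push (map (map_prod u u)) (aw ez xs) = aw ez (map u xs)"
  by (simp add: aw_def lin_sum push_ez take_map drop_map)

lemma push_diag: "push (map (map_prod u u)) (diag xs) = diag (map u xs)"
  by (simp add: diag_def lin_diff push_aw_ez comp_def)

lemma push_htp:
  "length xs = n \<Longrightarrow> push (map (map_prod u u)) (htp n xs :: _ \<Rightarrow>\<^sub>0 'k::field) = htp n (map u xs)"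
proof (induction n arbitrary: xs)
  case (Suc n)
  have b: "bd xs \<in> (chains_on (simplices n UNIV) :: (_ \<Rightarrow>\<^sub>0 'k) set)"
    using Suc.prems by (intro bd_in_chains) (auto simp: simplices_def)
  have "push (map (map_prod u u)) (lin (htp n) (bd xs))
      = lin (\<lambda>w. push (map (map_prod u u)) (htp n w)) (bd xs :: _ \<Rightarrow>\<^sub>0 'k)"
    by (rule lin_lin)
  also have "\<dots> = lin (\<lambda>w. htp n (map u w)) (bd xs)"
    by (rule lin_cong_on[OF b]) (use Suc.IH in \<open>auto simp: simplices_def\<close>)
  also have "\<dots> = lin (htp n) (bd (map u xs))"
    unfolding push_bd[symmetric] lin_lin by simp
  finally have *: "push (map (map_prod u u)) (lin (htp n) (bd xs))
      = lin (htp n) (bd (map u xs) :: _ \<Rightarrow>\<^sub>0 'k)" .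
  have "xs \<noteq> []" using Suc.prems by auto
  then show ?case
    unfolding htp.simps push_cone lin_diff push_diag * by (simp add: hd_map)
qed simp

lemma aw_ez_in_chains: "xs \<in> simplices n A \<Longrightarrow> aw ez xs \<in> chains_on (simplices n (A \<times> A))"
  unfolding aw_def
proof (rule chains_on_closed)
  fix p assume xs: "xs \<in> simplices n A" and p: "p \<in> {..<length xs}"
  then have "take (Suc p) xs \<in> simplices (Suc p) A" "drop p xs \<in> simplices (n - p) A"
    by (auto simp: simplices_def dest!: in_set_takeD in_set_dropD)
  from ez_in_chains[OF this] show "ez (take (Suc p) xs) (drop p xs) \<in> chains_on (simplices n (A \<times> A))"
    using p xs by (simp add: simplices_def)
qed

lemma htp_in_chains: "xs \<in> simplices n A \<Longrightarrow> htp n xs \<in> (chains_on (simplices (Suc n) (A \<times> A)) :: (_ \<Rightarrow>\<^sub>0 'k::field) set)"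
proof (induction n arbitrary: xs)
  case (Suc n)
  have d: "diag xs \<in> (chains_on (simplices (Suc n) (A \<times> A)) :: (_ \<Rightarrow>\<^sub>0 'k) set)"
    unfolding diag_def using Suc.prems aw_ez_in_chains[OF Suc.prems]
    by (auto intro!: chains_on_closed single_in_chains_on simp: simplices_def)
  have "lin (htp n) (bd xs) \<in> (chains_on (simplices (Suc n) (A \<times> A)) :: (_ \<Rightarrow>\<^sub>0 'k) set)"
    by (rule lin_in_chains_on[OF bd_in_chains[OF Suc.prems]]) (rule Suc.IH)
  with d show ?case
    unfolding htp.simps using Suc.prems
    by (intro cone_in_chains chains_on_closed) (auto simp: simplices_def neq_Nil_conv length_Suc_conv)
qed (simp add: chains_on_closed)

section \<open>From ordered simplices in a group to its bar complex\<close>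

text \<open>The value of \<^const>\<open>bar_boundary\<close> on a basis element.\<close>

definition bar_bd :: "('a, 'b) monoid_scheme \<Rightarrow> 'a list \<Rightarrow> ('a list \<Rightarrow>\<^sub>0 'k::field)" where
  "bar_bd G xs =
     (if xs = [] then 0 else \<Sum>j\<le>length xs. Poly_Mapping.single (bar_face G j xs) ((-1) ^ j))"

lemma bar_boundary_eq_lin: "bar_boundary G = lin (bar_bd G)"
proof
  fix c :: "'a list \<Rightarrow>\<^sub>0 'k::field"
  have "lin (bar_bd G) c = (\<Sum>x\<in>Poly_Mapping.keys c - {[]}. scale (Poly_Mapping.lookup c x) (bar_bd G x))"
    unfolding lin_def by (intro sum.mono_neutral_right) (auto simp: bar_bd_def)
  then show "bar_boundary G c = lin (bar_bd G) c"
    by (simp add: bar_boundary_def bar_bd_def chain.scale_sum_right mult.commute)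
qed

lemma bar_chain_map_eq_push: "bar_chain_map \<phi> = push (map \<phi>)"
  by (auto simp: bar_chain_map_def lin_def)

lemma bar_chains_eq: "bar_chains n G = chains_on (simplices n (carrier G))"
  by (simp add: bar_chains_def chains_on_def simplices_def)

lemma bar_face_Cons:
  "Suc j \<le> length w \<Longrightarrow> bar_face G (Suc (Suc j)) (a # w) = a # bar_face G (Suc j) w"
  by (auto simp: bar_face_def)

text \<open>The passage from homogeneous to inhomogeneous chains, that is, to the quotient by left translations;
  \<open>psums\<close> is its section with prescribed first vertex.\<close>

fun diffs :: "('a, 'b) monoid_scheme \<Rightarrow> 'a list \<Rightarrow> 'a list" where
  "diffs G (x # y # xs) = (inv\<^bsub>G\<^esub> x \<otimes>\<^bsub>G\<^esub> y) # diffs G (y # xs)"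
| "diffs G _ = []"

primrec psums :: "('a, 'b) monoid_scheme \<Rightarrow> 'a \<Rightarrow> 'a list \<Rightarrow> 'a list" where
  "psums G x [] = [x]"
| "psums G x (g # w) = x # psums G (x \<otimes>\<^bsub>G\<^esub> g) w"

lemma length_diffs [simp]: "length (diffs G xs) = length xs - 1"
  by (induction xs rule: induct_list012) auto

lemma length_psums [simp]: "length (psums G x w) = Suc (length w)"
  by (induction w arbitrary: x) auto

lemma psums_neq_Nil [simp]: "psums G x w \<noteq> []"
  by (cases w) auto

lemma take_psums: "take (Suc p) (psums G x w) = psums G x (take p w)"
  by (induction w arbitrary: x p) (auto simp: take_Cons split: nat.split)

context group
begin

lemma diffs_closed: "set xs \<subseteq> carrier G \<Longrightarrow> set (diffs G xs) \<subseteq> carrier G"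
  by (induction xs rule: induct_list012) auto

lemma psums_closed: "x \<in> carrier G \<Longrightarrow> set w \<subseteq> carrier G \<Longrightarrow> set (psums G x w) \<subseteq> carrier G"
  by (induction w arbitrary: x) auto

lemma diffs_psums: "x \<in> carrier G \<Longrightarrow> set w \<subseteq> carrier G \<Longrightarrow> diffs G (psums G x w) = w"
proof (induction w arbitrary: x)
  case (Cons g w)
  then show ?case
    by (cases w) (auto simp: m_assoc[symmetric])
qed auto

lemma diffs_translate:
  "g \<in> carrier G \<Longrightarrow> set xs \<subseteq> carrier G \<Longrightarrow> diffs G (map ((\<otimes>) g) xs) = diffs G xs"
proof (induction xs rule: induct_list012)
  case (3 x y xs)
  then show ?case by (simp add: inv_mult_group m_assoc inv_solve_left')
qed auto

lemma psums_translate: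
  "g \<in> carrier G \<Longrightarrow> x \<in> carrier G \<Longrightarrow> set w \<subseteq> carrier G \<Longrightarrow>
   psums G (g \<otimes> x) w = map ((\<otimes>) g) (psums G x w)"
  by (induction w arbitrary: x) (auto simp: m_assoc)

lemma drop_psums:
  "x \<in> carrier G \<Longrightarrow> set w \<subseteq> carrier G \<Longrightarrow> p \<le> length w \<Longrightarrow>
   \<exists>y\<in>carrier G. drop p (psums G x w) = psums G y (drop p w)"
proof (induction w arbitrary: x p)
  case (Cons g w)
  then show ?case
    using Cons.IH[of "x \<otimes> g" "p - 1"] by (cases p) auto
qed auto

lemma diffs_face:
  "set xs \<subseteq> carrier G \<Longrightarrow> 2 \<le> length xs \<Longrightarrow> j < length xs \<Longrightarrow>
   diffs G (take j xs @ drop (Suc j) xs) = bar_face G j (diffs G xs)"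
proof (induction xs arbitrary: j)
  case (Cons x xs')
  then obtain y xs where xs': "xs' = y # xs" by (cases xs') auto
  have car: "x \<in> carrier G" "y \<in> carrier G" "set xs \<subseteq> carrier G" using Cons.prems xs' by auto
  consider "j = 0" | "j = 1" | i where "j = Suc (Suc i)" by (metis One_nat_def not0_implies_Suc)
  then show ?case
  proof cases
    case 2
    show ?thesis
    proof (cases xs)
      case (Cons z zs)
      then have "inv x \<otimes> z = (inv x \<otimes> y) \<otimes> (inv y \<otimes> z)"
      proof -
        have "y \<otimes> (inv y \<otimes> z) = z" using car Cons by (simp add: m_assoc[symmetric])
        then show ?thesis using car Cons by (simp add: m_assoc)
      qed
      then show ?thesis using 2 xs' Cons by (simp add: bar_face_def)
    qed (simp add: 2 xs' bar_face_def)
  next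
    case 3
    then have ne: "xs \<noteq> []" "Suc i \<le> length xs" using Cons.prems xs' by auto
    have "diffs G (take (Suc i) xs' @ drop (Suc (Suc i)) xs') = bar_face G (Suc i) (diffs G xs')"
      using Cons.IH[of "Suc i"] Cons.prems xs' ne by (cases xs) auto
    then show ?thesis using 3 xs' ne by (simp add: bar_face_Cons)
  qed (simp add: xs' bar_face_def)
qed simp

lemma psums_face:
  "x \<in> carrier G \<Longrightarrow> set w \<subseteq> carrier G \<Longrightarrow> w \<noteq> [] \<Longrightarrow> j \<le> length w \<Longrightarrow>
   take j (psums G x w) @ drop (Suc j) (psums G x w) =
     psums G (if j = 0 then x \<otimes> hd w else x) (bar_face G j w)"
proof (induction w arbitrary: x j)
  case (Cons g w)
  have car: "g \<in> carrier G" "set w \<subseteq> carrier G" "x \<in> carrier G" using Cons.prems by auto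
  consider "j = 0" | "j = 1" | i where "j = Suc (Suc i)" by (metis One_nat_def not0_implies_Suc)
  then show ?case
  proof cases
    case 2
    show ?thesis
    proof (cases w)
      case (Cons h v)
      then show ?thesis using 2 car by (simp add: bar_face_def m_assoc)
    qed (simp add: 2 bar_face_def)
  next
    case 3
    then have ne: "w \<noteq> []" "Suc i \<le> length w" using Cons.prems by auto
    then show ?thesis using 3 Cons.IH[of "x \<otimes> g" "Suc i"] car by (simp add: bar_face_Cons)
  qed (simp add: bar_face_def)
qed simp

lemma push_diffs_bd:
  assumes "set xs \<subseteq> carrier G" "2 \<le> length xs"
  shows "push (diffs G) (bd xs) = bar_bd G (diffs G xs)"
proof -
  have "diffs G xs \<noteq> []"
    using assms(2) length_diffs[of G xs] by (auto simp del: length_diffs)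
  have i: "{..length (diffs G xs)} = {..<length xs}" using assms(2) by auto
  have "push (diffs G) (bd xs) = (\<Sum>j<length xs. Poly_Mapping.single (bar_face G j (diffs G xs)) ((-1) ^ j))"
    unfolding bd_eq_sum lin_sum lin_single scale_single mult_1_right
    by (intro sum.cong refl) (simp add: diffs_face[OF assms])
  with \<open>diffs G xs \<noteq> []\<close> show ?thesis
    unfolding bar_bd_def i by simp
qed

text \<open>Ordered simplices in any set \<open>P\<close> yield bar chains of a group through a map of the vertices. Lists of
  length \<open>1\<close> are excluded: their boundary in the ordered complex is the augmentation, but the bar complex
  is not augmented.\<close>

lemma bar_boundary_push:
  assumes "c \<in> chains_on (simplices n P)" "2 \<le> n" "F ` P \<subseteq> carrier G"
  shows "bar_boundary G (push (\<lambda>z. diffs G (map F z)) c) = push (\<lambda>z. diffs G (map F z)) (lin bd c)"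
proof -
  have "bar_boundary G (push (\<lambda>z. diffs G (map F z)) c) = lin (\<lambda>z. bar_bd G (diffs G (map F z))) c"
    by (simp add: bar_boundary_eq_lin lin_lin)
  also have "\<dots> = lin (\<lambda>z. push (diffs G) (bd (map F z))) c"
    using assms(2,3) by (intro lin_cong_on[OF assms(1)] push_diffs_bd[symmetric]) (auto simp: simplices_def)
  also have "\<dots> = push (\<lambda>z. diffs G (map F z)) (lin bd c)"
    by (simp add: push_bd[symmetric] lin_lin)
  finally show ?thesis .
qed

lemma bar_bd_in_chains:
  assumes "w \<in> simplices (Suc n) (carrier G)"
  shows "bar_bd G w \<in> (chains_on (simplices n (carrier G)) :: (_ \<Rightarrow>\<^sub>0 'k::field) set)"
proof -
  have w: "length w = Suc n" "set w \<subseteq> carrier G" using assms by (auto simp: simplices_def)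
  have "bar_bd G w = (push (diffs G) (bd (psums G \<one> w)) :: _ \<Rightarrow>\<^sub>0 'k)"
    using w by (subst push_diffs_bd) (auto simp: psums_closed diffs_psums)
  also have "\<dots> \<in> chains_on (simplices n (carrier G))"
  proof (rule lin_in_chains_on)
    show "bd (psums G \<one> w) \<in> (chains_on (simplices (Suc n) (carrier G)) :: (_ \<Rightarrow>\<^sub>0 'k) set)"
      using w by (intro bd_in_chains) (simp add: simplices_def psums_closed)
    fix x assume "x \<in> simplices (Suc n) (carrier G)"
    then show "basis (diffs G x) \<in> (chains_on (simplices n (carrier G)) :: (_ \<Rightarrow>\<^sub>0 'k) set)"
      using diffs_closed by (auto simp: simplices_def intro!: single_in_chains_on)
  qed
  finally show ?thesis .
qed

lemma bar_bd_singleton [simp]: "length w = Suc 0 \<Longrightarrow> bar_bd G w = 0"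
  by (cases w) (auto simp: bar_bd_def bar_face_def simp flip: single_add)

lemma bar_boundary_bar_bd:
  assumes "set w \<subseteq> carrier G"
  shows "bar_boundary G (bar_bd G w) = (0 :: _ \<Rightarrow>\<^sub>0 'k::field)"
proof -
  consider "w = []" | "length w = Suc 0" | n where "length w = Suc (Suc n)"
    by (cases w; cases "tl w") auto
  then show ?thesis
  proof cases
    case 3
    let ?x = "psums G \<one> w"
    have x: "set ?x \<subseteq> carrier G" by (simp add: psums_closed assms)
    have "bar_bd G w = (push (\<lambda>z. diffs G (map (\<lambda>x. x) z)) (bd ?x) :: _ \<Rightarrow>\<^sub>0 'k)"
      using 3 assms by (subst list.map_ident, subst push_diffs_bd) (auto simp: psums_closed diffs_psums x)
    moreover have "bd ?x \<in> (chains_on (simplices (Suc (Suc n)) (carrier G)) :: (_ \<Rightarrow>\<^sub>0 'k) set)"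
      using x 3 by (intro bd_in_chains) (simp add: simplices_def)
    ultimately show ?thesis
      using bar_boundary_push[of "bd ?x :: _ \<Rightarrow>\<^sub>0 'k" "Suc (Suc n)" "carrier G" "\<lambda>x. x"] by simp
  qed (auto simp: bar_boundary_eq_lin, auto simp: bar_bd_def)
qed

text \<open>A function of ordered simplices that is invariant under left translation is a function on the bar
  complex, compatibly with the two boundaries: all faces of a section \<open>psums\<close> are sections again, except
  that the first one begins at a different vertex.\<close>

lemma lin_bd_psums:
  assumes "T [] = (0 :: 'c \<Rightarrow>\<^sub>0 'k::field)"
    and "\<And>g xs. g \<in> carrier G \<Longrightarrow> set xs \<subseteq> carrier G \<Longrightarrow> T (map ((\<otimes>) g) xs) = T xs"
    and "z \<in> carrier G" "set w \<subseteq> carrier G"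
  shows "lin T (bd (psums G z w)) = lin (\<lambda>v. T (psums G \<one> v)) (bar_bd G w)"
proof (cases "w = []")
  case False
  have T: "T (psums G x v) = T (psums G \<one> v)" if "x \<in> carrier G" "set v \<subseteq> carrier G" for x v
    using that assms(2)[of x "psums G \<one> v"] psums_translate[of x \<one> v] by (simp add: psums_closed)
  have f: "set (bar_face G j w) \<subseteq> carrier G" if "j \<le> length w" for j
  proof -
    have "set (tl w) \<subseteq> carrier G" "set (butlast w) \<subseteq> carrier G" "set (take i w) \<subseteq> carrier G"
      "set (drop i w) \<subseteq> carrier G" for i
      using assms(4) by (auto dest: in_set_butlastD in_set_takeD in_set_dropD list.set_sel(2)[OF False])
    moreover have "w ! i \<in> carrier G" if "i < length w" for i
      using assms(4) that by (auto simp: subset_iff)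
    ultimately show ?thesis using that by (auto simp: bar_face_def)
  qed
  have hd: "hd w \<in> carrier G" using False assms(4) by (auto simp: subset_iff)
  have face: "T (take j (psums G z w) @ drop (Suc j) (psums G z w)) = T (psums G \<one> (bar_face G j w))"
    if "j \<le> length w" for j
    unfolding psums_face[OF assms(3,4) False that]
    by (rule T) (use hd assms(3) f[OF that] in auto)
  have "lin T (bd (psums G z w)) = (\<Sum>j<Suc (length w).
      scale ((-1) ^ j) (T (take j (psums G z w) @ drop (Suc j) (psums G z w))))"
    by (simp only: bd_eq_sum lin_sum lin_single length_psums)
  also have "\<dots> = (\<Sum>j\<le>length w. scale ((-1) ^ j) (T (psums G \<one> (bar_face G j w))))"
    by (intro sum.cong) (auto simp only: lessThan_Suc_atMost atMost_iff face)
  also have "\<dots> = lin (\<lambda>v. T (psums G \<one> v)) (bar_bd G w)"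
    using False by (simp add: bar_bd_def lin_sum)
  finally show ?thesis .
qed (use assms in \<open>auto simp: bar_bd_def\<close>)

end

section \<open>Products of commuting homomorphisms on homology\<close>

lemma chains_on_mono: "A \<subseteq> B \<Longrightarrow> chains_on A \<subseteq> chains_on B"
  by (auto simp: chains_on_def)

lemma lin_swap: "lin (\<lambda>x. lin (\<lambda>y. f x y) d) c = lin (\<lambda>y. lin (\<lambda>x. f x y) c) d"
proof -
  have "lin (\<lambda>x. lin (\<lambda>y. f x y) d) c
      = (\<Sum>x\<in>Poly_Mapping.keys c. \<Sum>y\<in>Poly_Mapping.keys d.
          scale (Poly_Mapping.lookup c x) (scale (Poly_Mapping.lookup d y) (f x y)))"
    by (simp only: lin_def chain.scale_sum_right)
  also have "\<dots> = (\<Sum>y\<in>Poly_Mapping.keys d. \<Sum>x\<in>Poly_Mapping.keys c.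
          scale (Poly_Mapping.lookup d y) (scale (Poly_Mapping.lookup c x) (f x y)))"
    by (subst sum.swap) (simp add: mult.commute)
  also have "\<dots> = lin (\<lambda>y. lin (\<lambda>x. f x y) c) d"
    by (simp only: lin_def chain.scale_sum_right)
  finally show ?thesis .
qed

lemma map_hom_simplices:
  "\<phi> \<in> hom G H \<Longrightarrow> w \<in> simplices n (carrier G) \<Longrightarrow> map \<phi> w \<in> simplices n (carrier H)"
  by (auto simp: simplices_def hom_def)

lemma psums_hom:
  assumes "\<phi> \<in> hom G H" "group G"
  shows "x \<in> carrier G \<Longrightarrow> set w \<subseteq> carrier G \<Longrightarrow> map \<phi> (psums G x w) = psums H (\<phi> x) (map \<phi> w)"
proof (induction w arbitrary: x)
  case (Cons g w)
  interpret group G by (rule assms)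
  show ?case using Cons assms(1) by (simp add: hom_mult)
qed simp

lemma bar_face_hom:
  assumes "\<phi> \<in> hom G H" "set w \<subseteq> carrier G" "j \<le> length w"
  shows "map \<phi> (bar_face G j w) = bar_face H j (map \<phi> w)"
proof (cases "j = 0 \<or> j = length w")
  case False
  then have "w ! (j - 1) \<in> carrier G" "w ! j \<in> carrier G" using assms by (auto simp: subset_iff)
  moreover have "j - 1 < length w" "j < length w" using False assms(3) by auto
  ultimately show ?thesis using False assms(1) by (simp add: bar_face_def hom_mult take_map drop_map)
qed (auto simp: bar_face_def map_tl map_butlast)

lemma push_bar_bd:
  assumes "\<phi> \<in> hom G H" "set w \<subseteq> carrier G"
  shows "push (map \<phi>) (bar_bd G w) = bar_bd H (map \<phi> w)"
  using bar_face_hom[OF assms] by (simp add: bar_bd_def lin_sum)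

lemma psums_restrict [simp]: "psums (G\<lparr>carrier := K\<rparr>) x w = psums G x w"
  by (induction w arbitrary: x) auto

lemma bar_face_restrict [simp]: "bar_face (G\<lparr>carrier := K\<rparr>) j xs = bar_face G j xs"
  by (simp add: bar_face_def)

lemma bar_bd_restrict [simp]: "bar_bd (G\<lparr>carrier := K\<rparr>) = bar_bd G"
  by (intro ext) (simp add: bar_bd_def)

definition bar_aw :: "('a list \<Rightarrow> 'a list \<Rightarrow> ('b \<Rightarrow>\<^sub>0 'k::field)) \<Rightarrow> 'a list \<Rightarrow> ('b \<Rightarrow>\<^sub>0 'k)" where
  "bar_aw B w = (\<Sum>p\<le>length w. B (take p w) (drop p w))"

text \<open>The chain map property of the Alexander--Whitney diagonal descends from ordered simplices to the bar
  complex. The signs and faces are those of \<open>aw_diff\<close>.\<close>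

lemma (in group) bar_aw_bar_bd:
  fixes B :: "'a list \<Rightarrow> 'a list \<Rightarrow> ('c \<Rightarrow>\<^sub>0 'k::field)"
  assumes w: "set w \<subseteq> carrier G"
  shows "lin (bar_aw B) (bar_bd G w) = (\<Sum>p\<le>length w. lin (\<lambda>u. B u (drop p w)) (bar_bd G (take p w))
     + scale ((-1) ^ p) (lin (B (take p w)) (bar_bd G (drop p w))))"
proof -
  define B' where "B' u v = (if u = [] \<or> v = [] then 0 else B (diffs G u) (diffs G v))" for u v
  have tk: "set (take p v) \<subseteq> carrier G" "set (drop p v) \<subseteq> carrier G" if "set v \<subseteq> carrier G" for p v
    using that by (auto dest: in_set_takeD in_set_dropD)
  have aw: "aw B' (psums G \<one> v) = bar_aw B v" if v: "set v \<subseteq> carrier G" for v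
    unfolding aw_def bar_aw_def length_psums lessThan_Suc_atMost
  proof (rule sum.cong)
    fix p assume "p \<in> {..length v}"
    then obtain y where "y \<in> carrier G" "drop p (psums G \<one> v) = psums G y (drop p v)"
      using drop_psums[OF one_closed v] by auto
    then show "B' (take (Suc p) (psums G \<one> v)) (drop p (psums G \<one> v)) = B (take p v) (drop p v)"
      by (simp add: take_psums B'_def diffs_psums tk[OF v])
  qed simp
  have inv: "aw B' (map ((\<otimes>) g) xs) = aw B' xs" if "g \<in> carrier G" "set xs \<subseteq> carrier G" for g xs
    using that unfolding aw_def length_map
    by (intro sum.cong) (simp_all add: take_map drop_map B'_def diffs_translate tk)
  have "lin (bar_aw B) (bar_bd G w) = lin (\<lambda>v. aw B' (psums G \<one> v)) (bar_bd G w)"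
  proof (cases w)
    case (Cons a v)
    then have "bar_bd G w \<in> (chains_on (simplices (length v) (carrier G)) :: (_ \<Rightarrow>\<^sub>0 'k) set)"
      using w by (intro bar_bd_in_chains) (auto simp: simplices_def)
    then show ?thesis by (rule lin_cong_on) (simp add: aw simplices_def)
  qed (simp add: bar_bd_def)
  also have "\<dots> = lin (aw B') (bd (psums G \<one> w))"
    using w inv by (intro lin_bd_psums[symmetric]) (auto simp: aw_def)
  also have "\<dots> = aw_diff B' (psums G \<one> w)"
    by (rule aw_bd) (auto simp: B'_def)
  also have "\<dots> = (\<Sum>p\<le>length w. lin (\<lambda>u. B u (drop p w)) (bar_bd G (take p w))
     + scale ((-1) ^ p) (lin (B (take p w)) (bar_bd G (drop p w))))"
    unfolding aw_diff_def length_psums lessThan_Suc_atMost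
  proof (rule sum.cong)
    fix p assume "p \<in> {..length w}"
    then obtain y where y: "y \<in> carrier G" "drop p (psums G \<one> w) = psums G y (drop p w)"
      using drop_psums[OF one_closed w] by auto
    have "lin (\<lambda>u. B' u (psums G y (drop p w))) (bd (psums G \<one> (take p w)))
        = lin (\<lambda>v. B' (psums G \<one> v) (psums G y (drop p w))) (bar_bd G (take p w))"
      by (rule lin_bd_psums) (auto simp: B'_def diffs_translate tk[OF w])
    also have "\<dots> = lin (\<lambda>u. B u (drop p w)) (bar_bd G (take p w))"
    proof (cases "take p w")
      case (Cons a v)
      then have "bar_bd G (take p w) \<in> (chains_on (simplices (length v) (carrier G)) :: (_ \<Rightarrow>\<^sub>0 'k) set)"
        using tk(1)[OF w, of p] by (intro bar_bd_in_chains) (auto simp: simplices_def)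
      then show ?thesis
        by (rule lin_cong_on) (simp add: B'_def diffs_psums y tk[OF w] simplices_def)
    qed (simp add: bar_bd_def)
    finally have 1: "lin (\<lambda>u. B' u (psums G y (drop p w))) (bd (psums G \<one> (take p w)))
        = lin (\<lambda>u. B u (drop p w)) (bar_bd G (take p w))" .
    have "lin (B' (psums G \<one> (take p w))) (bd (psums G y (drop p w)))
        = lin (\<lambda>v. B' (psums G \<one> (take p w)) (psums G \<one> v)) (bar_bd G (drop p w))"
      by (rule lin_bd_psums) (auto simp: B'_def diffs_translate tk[OF w] y)
    also have "\<dots> = lin (B (take p w)) (bar_bd G (drop p w))"
    proof (cases "drop p w")
      case (Cons a v)
      then have "bar_bd G (drop p w) \<in> (chains_on (simplices (length v) (carrier G)) :: (_ \<Rightarrow>\<^sub>0 'k) set)"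
        using tk(2)[OF w, of p] by (intro bar_bd_in_chains) (auto simp: simplices_def)
      then show ?thesis
        by (rule lin_cong_on) (simp add: B'_def diffs_psums y tk[OF w] simplices_def)
    qed (simp add: bar_bd_def)
    finally have 2: "lin (B' (psums G \<one> (take p w))) (bd (psums G y (drop p w)))
        = lin (B (take p w)) (bar_bd G (drop p w))" .
    show "lin (\<lambda>u. B' u (drop p (psums G \<one> w))) (bd (take (Suc p) (psums G \<one> w))) +
      scale ((-1) ^ p) (lin (B' (take (Suc p) (psums G \<one> w))) (bd (drop p (psums G \<one> w)))) =
      lin (\<lambda>u. B u (drop p w)) (bar_bd G (take p w)) +
      scale ((-1) ^ p) (lin (B (take p w)) (bar_bd G (drop p w)))"
      unfolding take_psums y(2) 1 2 ..
  qed simp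
  finally show ?thesis .
qed

text \<open>The homology cross product followed by multiplication: shuffle, multiply the coordinates of each vertex,
  and pass to bar chains. For commuting factors \<open>K\<close> and \<open>B\<close> it is invariant under translation in each
  argument and so defined on bar chains, as \<open>bar_cross\<close>.\<close>

definition cross :: "('a, 'b) monoid_scheme \<Rightarrow> 'a list \<Rightarrow> 'a list \<Rightarrow> ('a list \<Rightarrow>\<^sub>0 'k::field)" where
  "cross G x y = push (\<lambda>z. diffs G (map (\<lambda>(s, t). s \<otimes>\<^bsub>G\<^esub> t) z)) (ez x y)"

definition bar_cross :: "('a, 'b) monoid_scheme \<Rightarrow> 'a list \<Rightarrow> 'a list \<Rightarrow> ('a list \<Rightarrow>\<^sub>0 'k::field)" where
  "bar_cross G x y = cross G (psums G \<one>\<^bsub>G\<^esub> x) (psums G \<one>\<^bsub>G\<^esub> y)"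

lemma ez_singleton_left: "ys \<noteq> [] \<Longrightarrow> ez [x] ys = basis (map (Pair x) ys)"
  by (induction ys) (auto simp: neq_Nil_conv)

lemma ez_singleton_right: "xs \<noteq> [] \<Longrightarrow> ez xs [y] = basis (map (\<lambda>x. (x, y)) xs)"
  by (induction xs) (auto simp: neq_Nil_conv)

locale commuting_subgroups = group G for G (structure) +
  fixes K B :: "'a set"
  assumes subK: "subgroup K G" and subB: "subgroup B G"
    and commute: "\<And>k b. k \<in> K \<Longrightarrow> b \<in> B \<Longrightarrow> k \<otimes> b = b \<otimes> k"
begin

lemma memK [simp]: "k \<in> K \<Longrightarrow> k \<in> carrier G" and memB [simp]: "b \<in> B \<Longrightarrow> b \<in> carrier G"
  using subK subB by (auto dest: subgroup.mem_carrier)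

text \<open>Invariance under any change of the two vertex sets that multiplies all products on the left by one
  element \<open>a\<close>.\<close>

lemma cross_translate:
  assumes a: "a \<in> carrier G" and f: "\<And>x. x \<in> set u \<Longrightarrow> f x \<in> K" and g: "\<And>y. y \<in> set v \<Longrightarrow> g y \<in> B"
    and uv: "set u \<subseteq> K" "set v \<subseteq> B"
    and eq: "\<And>x y. x \<in> set u \<Longrightarrow> y \<in> set v \<Longrightarrow> f x \<otimes> g y = a \<otimes> (x \<otimes> y)"
  shows "cross G (map f u) (map g v) = (cross G u v :: _ \<Rightarrow>\<^sub>0 'k::field)"
proof -
  have e: "ez u v \<in> (chains_on (simplices (length u + length v - 1) (set u \<times> set v)) :: (_ \<Rightarrow>\<^sub>0 'k) set)"
    by (rule ez_in_chains) (auto simp: simplices_def)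
  have "cross G (map f u) (map g v)
      = (push (\<lambda>z. diffs G (map (\<lambda>(s, t). s \<otimes> t) (map (map_prod f g) z))) (ez u v) :: _ \<Rightarrow>\<^sub>0 'k)"
    unfolding cross_def push_ez[symmetric] lin_lin by simp
  also have "\<dots> = cross G u v"
    unfolding cross_def
  proof (rule lin_cong_on[OF e])
    fix z assume "z \<in> simplices (length u + length v - 1) (set u \<times> set v)"
    then have z: "set z \<subseteq> set u \<times> set v" by (simp add: simplices_def)
    have "map (\<lambda>(s, t). s \<otimes> t) (map (map_prod f g) z) = map ((\<otimes>) a) (map (\<lambda>(s, t). s \<otimes> t) z)"
      using z eq by (auto simp: subset_iff)
    moreover have "set (map (\<lambda>(s, t). s \<otimes> t) z) \<subseteq> carrier G"
      using z uv by (force simp: subset_iff)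
    ultimately show "basis (diffs G (map (\<lambda>(s, t). s \<otimes> t) (map (map_prod f g) z))) =
        (basis (diffs G (map (\<lambda>(s, t). s \<otimes> t) z)) :: _ \<Rightarrow>\<^sub>0 'k)"
      using diffs_translate[OF a] by metis
  qed
  finally show ?thesis .
qed

lemma cross_translate_left:
  assumes "k \<in> K" "set u \<subseteq> K" "set v \<subseteq> B"
  shows "cross G (map ((\<otimes>) k) u) v = cross G u v"
  using cross_translate[of k u "(\<otimes>) k" v "\<lambda>x. x"] assms subgroup.m_closed[OF subK]
  by (auto simp: m_assoc subset_iff)

lemma cross_translate_right:
  assumes "b \<in> B" "set u \<subseteq> K" "set v \<subseteq> B"
  shows "cross G u (map ((\<otimes>) b) v) = cross G u v"
proof -
  have "x \<otimes> (b \<otimes> y) = b \<otimes> (x \<otimes> y)" if "x \<in> K" "y \<in> B" for x y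
    using that assms(1) commute by (simp add: m_assoc[symmetric])
  then show ?thesis
    using cross_translate[of b u "\<lambda>x. x" v "(\<otimes>) b"] assms subgroup.m_closed[OF subB]
    by (auto simp: subset_iff)
qed

lemma bar_cross_Nil_left: "set y \<subseteq> B \<Longrightarrow> bar_cross G [] y = basis y"
proof -
  assume y: "set y \<subseteq> B"
  then have "set y \<subseteq> carrier G" using memB by blast
  moreover from this have "map ((\<otimes>) \<one>) (psums G \<one> y) = psums G \<one> y"
    using psums_closed[of \<one> y] by (auto intro!: map_idI)
  ultimately show ?thesis
    by (simp add: bar_cross_def cross_def ez_singleton_left comp_def diffs_psums)
qed

lemma bar_cross_Nil_right: "set x \<subseteq> K \<Longrightarrow> bar_cross G x [] = basis x"
proof -
  assume x: "set x \<subseteq> K"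
  then have "set x \<subseteq> carrier G" using memK by blast
  moreover from this have "map (\<lambda>s. s \<otimes> \<one>) (psums G \<one> x) = psums G \<one> x"
    using psums_closed[of \<one> x] by (auto intro!: map_idI)
  ultimately show ?thesis
    by (simp add: bar_cross_def cross_def ez_singleton_right comp_def diffs_psums)
qed

lemma psums_closed_sub: "subgroup L G \<Longrightarrow> z \<in> L \<Longrightarrow> set w \<subseteq> L \<Longrightarrow> set (psums G z w) \<subseteq> L"
  by (induction w arbitrary: z) (auto intro: subgroup.m_closed)

lemma lin_bd_psums_sub:
  assumes "subgroup L G" "T [] = (0 :: 'c \<Rightarrow>\<^sub>0 'k::field)"
    and "\<And>g xs. g \<in> L \<Longrightarrow> set xs \<subseteq> L \<Longrightarrow> T (map ((\<otimes>) g) xs) = T xs" "z \<in> L" "set w \<subseteq> L"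
  shows "lin T (bd (psums G z w)) = lin (\<lambda>v. T (psums G \<one> v)) (bar_bd G w)"
  using group.lin_bd_psums[OF subgroup_imp_group[OF assms(1)], of T z w] assms by simp

lemma bar_cross_in_chains:
  assumes "x \<in> simplices m K" "y \<in> simplices n B"
  shows "bar_cross G x y \<in> (chains_on (simplices (m + n) (carrier G)) :: (_ \<Rightarrow>\<^sub>0 'k::field) set)"
  unfolding bar_cross_def cross_def
proof (rule lin_in_chains_on)
  show "ez (psums G \<one> x) (psums G \<one> y) \<in> (chains_on (simplices (Suc m + Suc n - 1) (K \<times> B)) :: (_ \<Rightarrow>\<^sub>0 'k) set)"
    using assms subK subB
    by (intro ez_in_chains) (auto simp: simplices_def psums_closed_sub subgroup.one_closed)
  fix z assume z: "z \<in> simplices (Suc m + Suc n - 1) (K \<times> B)"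
  then have "set (map (\<lambda>(s, t). s \<otimes> t) z) \<subseteq> carrier G"
    by (force simp: simplices_def)
  from diffs_closed[OF this] z
  show "basis (diffs G (map (\<lambda>(s, t). s \<otimes> t) z)) \<in> (chains_on (simplices (m + n) (carrier G)) :: (_ \<Rightarrow>\<^sub>0 'k) set)"
    by (intro single_in_chains_on) (auto simp: simplices_def)
qed

lemma bar_boundary_cross:
  assumes x: "set x \<subseteq> K" and y: "set y \<subseteq> B"
  shows "bar_boundary G (bar_cross G x y) = lin (\<lambda>u. bar_cross G u y) (bar_bd G x)
     + scale ((-1) ^ length x) (lin (bar_cross G x) (bar_bd G y) :: _ \<Rightarrow>\<^sub>0 'k::field)"
proof (cases "x = [] \<and> y = []")
  case True
  then show ?thesis
    by (simp add: bar_cross_Nil_left bar_boundary_eq_lin bar_bd_def)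
next
  case False
  let ?x = "psums G \<one> x" and ?y = "psums G \<one> y"
  have c: "set ?x \<subseteq> K" "set ?y \<subseteq> B" "\<one> \<in> K" "\<one> \<in> B"
    using x y subK subB by (auto simp: psums_closed_sub subgroup.one_closed)
  have e: "ez ?x ?y \<in> (chains_on (simplices (length ?x + length ?y - 1) (K \<times> B)) :: (_ \<Rightarrow>\<^sub>0 'k) set)"
    using c by (intro ez_in_chains) (auto simp: simplices_def)
  let ?P = "push (\<lambda>z. diffs G (map (\<lambda>(s, t). s \<otimes> t) z)) :: _ \<Rightarrow> (_ \<Rightarrow>\<^sub>0 'k)"
  have "bar_boundary G (bar_cross G x y) = ?P (lin bd (ez ?x ?y))"
    unfolding bar_cross_def cross_def using False
    by (intro bar_boundary_push[OF e]) (auto simp: Suc_le_eq)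
  also have "lin bd (ez ?x ?y) = lin (\<lambda>u. ez u ?y) (bd ?x) + scale ((-1) ^ length x) (lin (ez ?x) (bd ?y))"
    using False by (subst bd_ez) auto
  also have "?P \<dots> = lin (\<lambda>u. cross G u ?y) (bd ?x) + scale ((-1) ^ length x) (lin (cross G ?x) (bd ?y))"
    unfolding lin_add lin_scale lin_lin cross_def ..
  also have "lin (\<lambda>u. cross G u ?y) (bd ?x) = lin (\<lambda>v. cross G (psums G \<one> v) ?y) (bar_bd G x)"
    using x c cross_translate_left by (intro lin_bd_psums_sub[OF subK]) (auto simp: cross_def)
  also have "lin (cross G ?x) (bd ?y) = lin (\<lambda>v. cross G ?x (psums G \<one> v)) (bar_bd G y)"
    using y c cross_translate_right by (intro lin_bd_psums_sub[OF subB]) (auto simp: cross_def)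
  finally show ?thesis unfolding bar_cross_def .
qed

end

text \<open>A natural homotopy \<open>D\<close> on ordered simplices induces a homotopy of bar chains, because the map \<open>F\<close> of
  vertices turns the action \<open>u\<close> of \<open>H\<close>, for which \<open>D\<close> is equivariant, into left translations, and \<open>diffs\<close>
  is invariant under these.\<close>

lemma (in group) natural_homotopy_descends:
  fixes D E :: "'h list \<Rightarrow> ('p list \<Rightarrow>\<^sub>0 'k::field)" and F :: "'p \<Rightarrow> 'a" and u :: "'h \<Rightarrow> 'p \<Rightarrow> 'p"
  assumes "group H" and D_Nil: "D [] = 0"
    and D_in: "\<And>xs. set xs \<subseteq> carrier H \<Longrightarrow> D xs \<in> chains_on (simplices (Suc (length xs)) P)"
    and D_map: "\<And>g xs. D (map ((\<otimes>\<^bsub>H\<^esub>) g) xs) = push (map (u g)) (D xs)"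
    and bd_D: "\<And>xs. xs \<noteq> [] \<Longrightarrow> lin bd (D xs) = E xs - lin D (bd xs)"
    and F: "F ` P \<subseteq> carrier G"
    and F_u: "\<And>g p. g \<in> carrier H \<Longrightarrow> p \<in> P \<Longrightarrow> F (u g p) = m g \<otimes> F p"
    and m: "\<And>g. g \<in> carrier H \<Longrightarrow> m g \<in> carrier G"
    and c: "c \<in> chains_on (simplices n (carrier H))" "bar_boundary H c = 0"
  shows "lin (\<lambda>w. push (\<lambda>z. diffs G (map F z)) (E (psums H \<one>\<^bsub>H\<^esub> w))) c \<in>
    bar_boundary G ` chains_on (simplices (Suc n) (carrier G))"
proof -
  interpret H: group H by fact
  let ?P = "push (\<lambda>z. diffs G (map F z)) :: _ \<Rightarrow> (_ \<Rightarrow>\<^sub>0 'k)"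
  define T where "T xs = ?P (D xs)" for xs
  have inv: "T (map ((\<otimes>\<^bsub>H\<^esub>) g) xs) = T xs" if g: "g \<in> carrier H" and xs: "set xs \<subseteq> carrier H" for g xs
  proof -
    have "T (map ((\<otimes>\<^bsub>H\<^esub>) g) xs) = lin (\<lambda>z. basis (diffs G (map F (map (u g) z)))) (D xs)"
      unfolding T_def D_map lin_lin by simp
    also have "\<dots> = T xs"
      unfolding T_def
    proof (rule lin_cong_on[OF D_in[OF xs]])
      fix z assume "z \<in> simplices (Suc (length xs)) P"
      then have z: "set z \<subseteq> P" by (simp add: simplices_def)
      then have "map F (map (u g) z) = map ((\<otimes>) (m g)) (map F z)"
        using F_u[OF g] by auto
      moreover have "set (map F z) \<subseteq> carrier G" using z F by auto
      ultimately show "basis (diffs G (map F (map (u g) z))) = (basis (diffs G (map F z)) :: _ \<Rightarrow>\<^sub>0 'k)"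
        by (simp only: diffs_translate[OF m[OF g]])
    qed
    finally show ?thesis .
  qed
  have T_in: "T (psums H \<one>\<^bsub>H\<^esub> w) \<in> chains_on (simplices (Suc n) (carrier G))"
    if "w \<in> simplices n (carrier H)" for w
    unfolding T_def
  proof (rule lin_in_chains_on[OF D_in])
    fix z assume z: "z \<in> simplices (Suc (length (psums H \<one>\<^bsub>H\<^esub> w))) P"
    then have "set (map F z) \<subseteq> carrier G" using F by (auto simp: simplices_def)
    from diffs_closed[OF this] show "basis (diffs G (map F z)) \<in> (chains_on (simplices (Suc n) (carrier G)) :: (_ \<Rightarrow>\<^sub>0 'k) set)"
      using that z by (intro single_in_chains_on) (auto simp: simplices_def)
  qed (use that H.psums_closed in \<open>auto simp: simplices_def\<close>)
  have "bar_boundary G (T (psums H \<one>\<^bsub>H\<^esub> w)) =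
      ?P (E (psums H \<one>\<^bsub>H\<^esub> w)) - lin (\<lambda>v. T (psums H \<one>\<^bsub>H\<^esub> v)) (bar_bd H w)"
    if w: "w \<in> simplices n (carrier H)" for w
  proof -
    let ?w = "psums H \<one>\<^bsub>H\<^esub> w"
    have wc: "set w \<subseteq> carrier H" "set ?w \<subseteq> carrier H" using w by (auto simp: simplices_def H.psums_closed)
    have "bar_boundary G (T ?w) = ?P (lin bd (D ?w))"
      unfolding T_def by (rule bar_boundary_push[OF D_in _ F]) (use wc in auto)
    also have "\<dots> = ?P (E ?w) - lin T (bd ?w)"
      by (simp add: bd_D lin_diff lin_lin T_def[abs_def])
    also have "lin T (bd ?w) = lin (\<lambda>v. T (psums H \<one>\<^bsub>H\<^esub> v)) (bar_bd H w)"
      by (rule H.lin_bd_psums) (use inv wc in \<open>auto simp: T_def D_Nil\<close>)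
    finally show ?thesis .
  qed
  then have "bar_boundary G (lin (\<lambda>w. T (psums H \<one>\<^bsub>H\<^esub> w)) c) =
      lin (\<lambda>w. ?P (E (psums H \<one>\<^bsub>H\<^esub> w)) - lin (\<lambda>v. T (psums H \<one>\<^bsub>H\<^esub> v)) (bar_bd H w)) c"
    unfolding bar_boundary_eq_lin lin_lin by (intro lin_cong_on[OF c(1)]) (simp add: lin_lin)
  also have "\<dots> = lin (\<lambda>w. ?P (E (psums H \<one>\<^bsub>H\<^esub> w))) c - lin (\<lambda>v. T (psums H \<one>\<^bsub>H\<^esub> v)) (bar_boundary H c)"
    unfolding lin_fun_diff bar_boundary_eq_lin lin_lin ..
  finally have "lin (\<lambda>w. ?P (E (psums H \<one>\<^bsub>H\<^esub> w))) c = bar_boundary G (lin (\<lambda>w. T (psums H \<one>\<^bsub>H\<^esub> w)) c)"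
    using c(2) by simp
  then show ?thesis
    using T_in by (auto intro!: lin_in_chains_on[OF c(1)])
qed

text \<open>Conjugate homomorphisms agree on homology. The prism over a simplex is its shuffle product with an
  interval.\<close>

lemma (in group) bar_boundary_conjugation:
  assumes "group H" and \<alpha>: "\<alpha> \<in> hom H G" and d: "d \<in> carrier G"
    and c: "c \<in> chains_on (simplices n (carrier H))" "bar_boundary H c = 0"
  shows "push (map (\<lambda>a. inv d \<otimes> \<alpha> a \<otimes> d)) c - push (map \<alpha>) c \<in>
    (bar_boundary G ` chains_on (simplices (Suc n) (carrier G)) :: (_ \<Rightarrow>\<^sub>0 'k::field) set)"
proof -
  interpret H: group H by fact
  \<comment> \<open>Right multiplication by \<open>d\<close> stands for the conjugation, from which it differs by left translation by \<open>d\<close>.\<close>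
  define F where "F = (\<lambda>(t, x). if t then \<alpha> x \<otimes> d else \<alpha> x)"
  let ?P = "push (\<lambda>z. diffs G (map F z)) :: _ \<Rightarrow> (_ \<Rightarrow>\<^sub>0 'k)"
  let ?E = "\<lambda>xs. basis (map (Pair True) xs) - basis (map (Pair False) xs) :: _ \<Rightarrow>\<^sub>0 'k"
  let ?\<beta> = "\<lambda>a. inv d \<otimes> \<alpha> a \<otimes> d"
  have \<alpha>c [simp]: "\<alpha> x \<in> carrier G" if "x \<in> carrier H" for x using that \<alpha> by (auto simp: hom_def)
  have "lin (\<lambda>w. ?P (?E (psums H \<one>\<^bsub>H\<^esub> w))) c \<in> bar_boundary G ` chains_on (simplices (Suc n) (carrier G))"
  proof (rule natural_homotopy_descends[OF \<open>group H\<close> _ _ _ _ _ _ _ c, of "ez [False, True]" "UNIV \<times> carrier H"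
        "\<lambda>g. map_prod (\<lambda>x. x) ((\<otimes>\<^bsub>H\<^esub>) g)" _ _ \<alpha>])
    show "ez [False, True] xs \<in> (chains_on (simplices (Suc (length xs)) (UNIV \<times> carrier H)) :: (_ \<Rightarrow>\<^sub>0 'k) set)"
      if "set xs \<subseteq> carrier H" for xs
      using ez_in_chains[of "[False, True]" 2 UNIV xs "length xs" "carrier H"] that
      by (simp add: simplices_def)
    show "ez [False, True] (map ((\<otimes>\<^bsub>H\<^esub>) g) xs) =
        (push (map (map_prod (\<lambda>x. x) ((\<otimes>\<^bsub>H\<^esub>) g))) (ez [False, True] xs) :: _ \<Rightarrow>\<^sub>0 'k)" for g xs
      by (simp only: push_ez list.map)
    show "lin bd (ez [False, True] xs) = ?E xs - lin (ez [False, True]) (bd xs)" if "xs \<noteq> []" for xs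
      using that by (subst bd_ez) (auto simp: lin_diff ez_singleton_left)
    show "F (map_prod (\<lambda>x. x) ((\<otimes>\<^bsub>H\<^esub>) g) p) = \<alpha> g \<otimes> F p" if "g \<in> carrier H" "p \<in> UNIV \<times> carrier H" for g p
      using that \<alpha> d by (auto simp: F_def hom_mult m_assoc)
    show "F ` (UNIV \<times> carrier H) \<subseteq> carrier G" using d by (auto simp: F_def)
  qed simp_all
  also have "lin (\<lambda>w. ?P (?E (psums H \<one>\<^bsub>H\<^esub> w))) c = lin (\<lambda>w. basis (map ?\<beta> w) - basis (map \<alpha> w)) c"
  proof (rule lin_cong_on[OF c(1)])
    fix w assume w: "w \<in> simplices n (carrier H)"
    let ?w = "psums H \<one>\<^bsub>H\<^esub> w"
    have wc: "set w \<subseteq> carrier H" "set ?w \<subseteq> carrier H" using w by (auto simp: simplices_def H.psums_closed)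
    have "?P (?E ?w) = basis (diffs G (map (\<lambda>x. \<alpha> x \<otimes> d) ?w)) - basis (diffs G (map \<alpha> ?w))"
      by (simp add: lin_diff F_def comp_def)
    also have "map \<alpha> ?w = psums G (\<alpha> \<one>\<^bsub>H\<^esub>) (map \<alpha> w)"
      by (rule psums_hom[OF \<alpha>]) (use wc assms in auto)
    also have "diffs G \<dots> = map \<alpha> w"
      by (rule diffs_psums) (use wc in auto)
    also have "map (\<lambda>x. \<alpha> x \<otimes> d) ?w = map ((\<otimes>) d) (map ?\<beta> ?w)"
      using wc d by (auto simp: m_assoc[symmetric])
    also have "diffs G \<dots> = diffs G (map ?\<beta> ?w)"
      by (rule diffs_translate) (use wc d in auto)
    also have "map ?\<beta> ?w = psums G (?\<beta> \<one>\<^bsub>H\<^esub>) (map ?\<beta> w)"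
    proof (rule psums_hom)
      show "?\<beta> \<in> hom H G"
      proof (rule homI)
        fix x y assume "x \<in> carrier H" "y \<in> carrier H"
        moreover have "d \<otimes> (inv d \<otimes> z) = z" if "z \<in> carrier G" for z
          using that d by (simp add: m_assoc[symmetric])
        ultimately show "?\<beta> (x \<otimes>\<^bsub>H\<^esub> y) = ?\<beta> x \<otimes> ?\<beta> y"
          using d \<alpha> by (simp add: hom_mult m_assoc)
      qed (use d in auto)
    qed (use wc assms in auto)
    also have "diffs G \<dots> = map ?\<beta> w"
      by (rule diffs_psums) (use wc d in auto)
    finally show "?P (?E ?w) = basis (map ?\<beta> w) - basis (map \<alpha> w)" .
  qed
  finally show ?thesis by (simp only: lin_fun_diff)
qed

text \<open>On cycles the product homomorphism is homologous to the cross product of \<open>\<phi>\<close> and \<open>\<psi>\<close> applied to the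
  Alexander--Whitney diagonal: the homotopy \<open>htp\<close> descends to the bar complex.\<close>

lemma (in group) bar_boundary_eilenberg_zilber:
  fixes \<phi> \<psi> :: "'h \<Rightarrow> 'a"
  assumes "group H" and \<phi>: "\<phi> \<in> hom H G" "\<phi> ` carrier H \<subseteq> K" and \<psi>: "\<psi> \<in> hom H G" "\<psi> ` carrier H \<subseteq> B"
    and KB: "commuting_subgroups G K B"
    and c: "c \<in> chains_on (simplices n (carrier H))" "bar_boundary H c = 0"
  shows "push (map (\<lambda>a. \<phi> a \<otimes> \<psi> a)) c - lin (bar_aw (\<lambda>x y. bar_cross G (map \<phi> x) (map \<psi> y))) c \<in>
    (bar_boundary G ` chains_on (simplices (Suc n) (carrier G)) :: (_ \<Rightarrow>\<^sub>0 'k::field) set)"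
proof -
  interpret H: group H by fact
  interpret commuting_subgroups G K B by fact
  define F where "F = (\<lambda>(x, y). \<phi> x \<otimes> \<psi> y)"
  let ?P = "push (\<lambda>z. diffs G (map F z)) :: _ \<Rightarrow> (_ \<Rightarrow>\<^sub>0 'k)"
  let ?\<chi> = "\<lambda>a. \<phi> a \<otimes> \<psi> a"
  let ?A = "bar_aw (\<lambda>x y. bar_cross G (map \<phi> x) (map \<psi> y)) :: _ \<Rightarrow> (_ \<Rightarrow>\<^sub>0 'k)"
  have \<phi>c [simp]: "\<phi> x \<in> carrier G" "\<psi> x \<in> carrier G" if "x \<in> carrier H" for x
    using that \<phi> \<psi> by (auto simp: hom_def)
  have comm: "\<psi> x \<otimes> (\<phi> y \<otimes> z) = \<phi> y \<otimes> (\<psi> x \<otimes> z)" if "x \<in> carrier H" "y \<in> carrier H" "z \<in> carrier G" for x y z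
  proof -
    have "\<psi> x \<otimes> \<phi> y = \<phi> y \<otimes> \<psi> x" using \<phi> \<psi> that by (intro commute[symmetric]) auto
    then show ?thesis using that by (simp add: m_assoc[symmetric])
  qed
  have \<chi>: "?\<chi> \<in> hom H G"
    using \<phi> \<psi> comm by (intro homI) (auto simp: hom_mult m_assoc)
  have sub: "set (map \<phi> v) \<subseteq> K" "set (map \<psi> v) \<subseteq> B" if "set v \<subseteq> carrier H" for v
    using that \<phi> \<psi> by auto
  have "lin (\<lambda>w. ?P (diag (psums H \<one>\<^bsub>H\<^esub> w))) c \<in> bar_boundary G ` chains_on (simplices (Suc n) (carrier G))"
  proof (rule natural_homotopy_descends[OF \<open>group H\<close> _ _ _ _ _ _ _ c, of "\<lambda>xs. htp (length xs) xs" "carrier H \<times> carrier H"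
        "\<lambda>g. map_prod ((\<otimes>\<^bsub>H\<^esub>) g) ((\<otimes>\<^bsub>H\<^esub>) g)" _ _ ?\<chi>])
    show "htp (length xs) xs \<in> (chains_on (simplices (Suc (length xs)) (carrier H \<times> carrier H)) :: (_ \<Rightarrow>\<^sub>0 'k) set)"
      if "set xs \<subseteq> carrier H" for xs
      using that by (intro htp_in_chains) (simp add: simplices_def)
    show "htp (length (map ((\<otimes>\<^bsub>H\<^esub>) g) xs)) (map ((\<otimes>\<^bsub>H\<^esub>) g) xs) =
        (push (map (map_prod ((\<otimes>\<^bsub>H\<^esub>) g) ((\<otimes>\<^bsub>H\<^esub>) g))) (htp (length xs) xs) :: _ \<Rightarrow>\<^sub>0 'k)" for g xs
      by (simp only: push_htp[OF refl] length_map)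
    show "lin bd (htp (length xs) xs) = diag xs - lin (\<lambda>xs. htp (length xs) xs) (bd xs :: _ \<Rightarrow>\<^sub>0 'k)"
      if ne: "xs \<noteq> []" for xs :: "'h list"
    proof -
      obtain k where k: "length xs = Suc k" using ne by (cases xs) auto
      have "bd xs \<in> (chains_on (simplices k UNIV) :: (_ \<Rightarrow>\<^sub>0 'k) set)"
        using k by (intro bd_in_chains) (simp add: simplices_def)
      then have "lin (\<lambda>xs. htp (length xs) xs) (bd xs) = lin (htp k) (bd xs :: _ \<Rightarrow>\<^sub>0 'k)"
        by (rule lin_cong_on) (simp add: simplices_def)
      then show ?thesis unfolding k using bd_htp[OF k] by simp
    qed
    show "F (map_prod ((\<otimes>\<^bsub>H\<^esub>) g) ((\<otimes>\<^bsub>H\<^esub>) g) p) = ?\<chi> g \<otimes> F p"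
      if "g \<in> carrier H" "p \<in> carrier H \<times> carrier H" for g p
      using that \<phi> \<psi> by (auto simp: F_def hom_mult m_assoc comm)
    show "F ` (carrier H \<times> carrier H) \<subseteq> carrier G" by (auto simp: F_def)
  qed simp_all
  also have "lin (\<lambda>w. ?P (diag (psums H \<one>\<^bsub>H\<^esub> w))) c = lin (\<lambda>w. basis (map ?\<chi> w) - ?A w) c"
  proof (rule lin_cong_on[OF c(1)])
    fix w assume w: "w \<in> simplices n (carrier H)"
    let ?w = "psums H \<one>\<^bsub>H\<^esub> w"
    have wc: "set w \<subseteq> carrier H" "set ?w \<subseteq> carrier H" using w by (auto simp: simplices_def H.psums_closed)
    have "?P (diag ?w) = basis (diffs G (map ?\<chi> ?w)) - ?P (aw ez ?w)"
      by (simp add: diag_def lin_diff F_def comp_def)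
    also have "map ?\<chi> ?w = psums G (?\<chi> \<one>\<^bsub>H\<^esub>) (map ?\<chi> w)"
      by (rule psums_hom[OF \<chi>]) (use wc assms in auto)
    also have "diffs G \<dots> = map ?\<chi> w"
      by (rule diffs_psums) (use wc in auto)
    also have "?P (aw ez ?w) = ?A w"
      unfolding aw_def bar_aw_def lin_sum length_psums lessThan_Suc_atMost
    proof (rule sum.cong)
      fix p assume p: "p \<in> {..length w}"
      then obtain y where y: "y \<in> carrier H" "drop p ?w = psums H y (drop p w)"
        using H.drop_psums[OF H.one_closed wc(1)] by auto
      have tk: "set (take p w) \<subseteq> carrier H" "set (drop p w) \<subseteq> carrier H"
        using wc by (auto dest: in_set_takeD in_set_dropD)
      have one: "\<phi> \<one>\<^bsub>H\<^esub> = \<one>" using \<phi>(1) assms(1) by (simp add: hom_one)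
      have \<psi>y: "\<psi> y \<in> B" using y \<psi> by auto
      have 1: "map \<phi> (psums H \<one>\<^bsub>H\<^esub> (take p w)) = psums G \<one> (map \<phi> (take p w))"
        using psums_hom[OF \<phi>(1) assms(1) H.one_closed tk(1)] one by simp
      have "map \<psi> (psums H y (drop p w)) = psums G (\<psi> y \<otimes> \<one>) (map \<psi> (drop p w))"
        using psums_hom[OF \<psi>(1) assms(1) y(1) tk(2)] y by simp
      also have "\<dots> = map ((\<otimes>) (\<psi> y)) (psums G \<one> (map \<psi> (drop p w)))"
        using y tk by (intro psums_translate) auto
      finally have 2: "map \<psi> (psums H y (drop p w)) = map ((\<otimes>) (\<psi> y)) (psums G \<one> (map \<psi> (drop p w)))" .
      have "?P (ez (take (Suc p) ?w) (drop p ?w)) =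
          push (\<lambda>z. diffs G (map (\<lambda>(s, t). s \<otimes> t) z)) (push (map (map_prod \<phi> \<psi>)) (ez (take (Suc p) ?w) (drop p ?w)))"
        unfolding lin_lin by (simp add: F_def comp_def case_prod_unfold)
      also have "\<dots> = cross G (map \<phi> (psums H \<one>\<^bsub>H\<^esub> (take p w))) (map \<psi> (psums H y (drop p w)))"
        unfolding push_ez cross_def take_psums y(2) ..
      also have "\<dots> = bar_cross G (map \<phi> (take p w)) (map \<psi> (drop p w))"
        unfolding 1 2 bar_cross_def using \<psi>y sub[OF tk(1)] sub[OF tk(2)] subK subB
        by (intro cross_translate_right psums_closed_sub) (auto simp: subgroup.one_closed)
      finally show "?P (ez (take (Suc p) ?w) (drop p ?w)) = bar_cross G (map \<phi> (take p w)) (map \<psi> (drop p w))" .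
    qed simp
    finally show "?P (diag ?w) = basis (map ?\<chi> w) - ?A w" .
  qed
  finally show ?thesis by (simp only: lin_fun_diff)
qed

interpretation chain_pair: vector_space_pair
  "scale :: 'k::field \<Rightarrow> ('a \<Rightarrow>\<^sub>0 'k) \<Rightarrow> 'a \<Rightarrow>\<^sub>0 'k" "scale :: 'k \<Rightarrow> ('b \<Rightarrow>\<^sub>0 'k) \<Rightarrow> 'b \<Rightarrow>\<^sub>0 'k" ..

text \<open>Boundaries can be lifted linearly to chains; this is where field coefficients are needed.\<close>

lemma lin_section:
  fixes f :: "'a \<Rightarrow> ('b \<Rightarrow>\<^sub>0 'k::field)"
  shows "\<exists>s. (\<forall>y. s y \<in> chains_on A) \<and> Vector_Spaces.linear scale scale s \<and>
    (\<forall>y \<in> lin f ` chains_on A. lin f (s y) = y)"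
  using chain_pair.linear_exists_right_inverse_on[OF linear_lin[of f] subspace_chains_on[of A]]
  by (auto simp: image_subset_iff)

text \<open>Over a field a chain map that is zero on homology in degrees \<open>1, \<dots>, n - 1\<close> is null-homotopic there.
  Chains split, not canonically, into boundaries, classes of cycles and lifts of boundaries. On a boundary
  the homotopy is the image of its lift, on a class it is a filling of the image, and on a lift it is zero.\<close>

lemma null_homotopy_exists:
  fixes \<phi> :: "'h \<Rightarrow> 'a" and n :: nat
  assumes H: "group H" and \<phi>: "\<phi> \<in> hom H G" "\<phi> ` carrier H \<subseteq> K"
    and van: "\<And>p c. 1 \<le> p \<Longrightarrow> p < n \<Longrightarrow> c \<in> chains_on (simplices p (carrier H)) \<Longrightarrow>
      bar_boundary H c = 0 \<Longrightarrow>
      push (map \<phi>) c \<in> (bar_boundary G ` chains_on (simplices (Suc p) K) :: (_ \<Rightarrow>\<^sub>0 'k::field) set)"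
  obtains h :: "nat \<Rightarrow> 'h list \<Rightarrow> ('a list \<Rightarrow>\<^sub>0 'k::field)" where
    "\<And>p w. w \<in> simplices p (carrier H) \<Longrightarrow> h p w \<in> chains_on (simplices (Suc p) K)"
    "\<And>p w. p = 0 \<or> n \<le> p \<Longrightarrow> h p w = 0"
    "\<And>p w. 1 \<le> p \<Longrightarrow> p < n \<Longrightarrow> w \<in> simplices p (carrier H) \<Longrightarrow>
      bar_boundary G (h p w) + lin (h (p - 1)) (bar_bd H w) = basis (map \<phi> w)"
proof -
  interpret H: group H by (rule H)
  let ?V = "\<lambda>p. chains_on (simplices p (carrier H)) :: (_ \<Rightarrow>\<^sub>0 'k) set"
  let ?U = "\<lambda>p. chains_on (simplices p K) :: (_ \<Rightarrow>\<^sub>0 'k) set"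
  let ?dH = "lin (bar_bd H) :: _ \<Rightarrow> (_ \<Rightarrow>\<^sub>0 'k)" and ?dG = "lin (bar_bd G) :: _ \<Rightarrow> (_ \<Rightarrow>\<^sub>0 'k)"
  let ?\<phi> = "push (map \<phi>) :: _ \<Rightarrow> (_ \<Rightarrow>\<^sub>0 'k)"
  obtain \<sigma> where \<sigma>: "\<And>p y. \<sigma> p y \<in> ?V (Suc p)" "\<And>p. Vector_Spaces.linear scale scale (\<sigma> p)"
      "\<And>p y. y \<in> ?dH ` ?V (Suc p) \<Longrightarrow> ?dH (\<sigma> p y) = y"
    using lin_section[of "simplices (Suc _) (carrier H)" "bar_bd H"] by metis
  obtain \<tau> where \<tau>: "\<And>p y. \<tau> p y \<in> ?U (Suc p)" "\<And>p. Vector_Spaces.linear scale scale (\<tau> p)"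
      "\<And>p y. y \<in> ?dG ` ?U (Suc p) \<Longrightarrow> ?dG (\<tau> p y) = y"
    using lin_section[of "simplices (Suc _) K" "bar_bd G"] by metis
  interpret \<sigma>: Vector_Spaces.linear scale scale "\<sigma> p" for p by (rule \<sigma>)
  interpret \<tau>: Vector_Spaces.linear scale scale "\<tau> p" for p by (rule \<tau>)
  define Z where "Z p u = ?\<phi> (\<sigma> p u) + \<tau> p (?\<phi> (u - ?dH (\<sigma> p u)))" for p u
  \<comment> \<open>\<open>Z\<close> treats cycles: it splits \<open>u\<close> into the boundary \<open>\<partial> (\<sigma> u)\<close> and the rest. To apply it to a chain \<open>c\<close>,
    the lift of \<open>\<partial> c\<close> is subtracted first.\<close>
  define L where "L p c = Z p (c - \<sigma> (p - 1) (?dH c))" for p c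
  have Z_add: "Z p (u + v) = Z p u + Z p v" for p u v
    by (simp add: Z_def lin_simps \<sigma>.add \<tau>.add \<tau>.diff algebra_simps)
  have Z_scale: "Z p (scale a u) = scale a (Z p u)" for p a u
    by (simp add: Z_def lin_simps \<sigma>.scale \<tau>.scale \<tau>.diff chain.scale_right_distrib chain.scale_right_diff_distrib)
  have L_add: "L p (u + v) = L p u + L p v" for p u v
    by (simp add: L_def lin_simps \<sigma>.add Z_add[symmetric] algebra_simps)
  have L_scale: "L p (scale a u) = scale a (L p u)" for p a u
    by (simp add: L_def lin_simps \<sigma>.scale Z_scale[symmetric] chain.scale_right_diff_distrib)
  have L_lin: "Vector_Spaces.linear scale scale (L p)" for p
    by unfold_locales (simp_all add: L_add L_scale)
  have dd: "?dH (?dH c) = 0" if "c \<in> ?V p" for c p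
  proof -
    have "?dH (?dH c) = lin (\<lambda>w. bar_boundary H (bar_bd H w)) c"
      by (simp add: lin_lin bar_boundary_eq_lin)
    also have "\<dots> = lin (\<lambda>w. 0) c"
      by (rule lin_cong_on[OF that]) (simp add: H.bar_boundary_bar_bd simplices_def)
    finally show ?thesis by simp
  qed
  have d_in: "?dH c \<in> ?V p" if "c \<in> ?V (Suc p)" for c p
    using that by (rule lin_in_chains_on) (rule H.bar_bd_in_chains)
  have \<phi>_in: "?\<phi> c \<in> ?U p" if "c \<in> ?V p" for c p
    using that by (rule lin_in_chains_on) (use \<phi> in \<open>force simp: simplices_def intro!: single_in_chains_on\<close>)
  have d\<phi>: "?dG (?\<phi> c) = ?\<phi> (?dH c)" if "c \<in> ?V p" for c p
    unfolding lin_lin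
    by (rule lin_cong_on[OF that]) (simp add: push_bar_bd[OF \<phi>(1)] simplices_def)
  have dZ: "?dG (Z p u) = ?\<phi> u" if "1 \<le> p" "p < n" "u \<in> ?V p" "?dH u = 0" for p u
  proof -
    let ?v = "u - ?dH (\<sigma> p u)"
    have v: "?v \<in> ?V p" "?dH ?v = 0"
      using that dd[OF \<sigma>(1)] d_in[OF \<sigma>(1)] by (auto intro!: chains_on_closed simp: lin_diff)
    have "?\<phi> ?v \<in> ?dG ` ?U (Suc p)"
      using van[OF that(1,2) v(1)] v(2) by (simp add: bar_boundary_eq_lin)
    then have "?dG (Z p u) = ?\<phi> (?dH (\<sigma> p u)) + ?\<phi> ?v"
      unfolding Z_def lin_add by (simp add: \<tau>(3) d\<phi>[OF \<sigma>(1)])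
    then show ?thesis by (simp add: lin_diff)
  qed
  have dL: "?dG (L p c) + (if p = 1 then 0 else L (p - 1) (?dH c)) = ?\<phi> c"
    if p: "1 \<le> p" "p < n" and c: "c \<in> ?V p" for p c
  proof -
    obtain q where q: "p = Suc q" using p by (cases p) auto
    have b: "?dH (\<sigma> q (?dH c)) = ?dH c" using c q by (intro \<sigma>(3)) auto
    let ?u = "c - \<sigma> q (?dH c)"
    have u: "?u \<in> ?V p" "?dH ?u = 0"
      using c q \<sigma>(1)[of q] b by (auto intro!: chains_on_closed simp: lin_diff)
    have L: "?dG (L p c) = ?\<phi> c - ?\<phi> (\<sigma> q (?dH c))"
      using dZ[OF p u] q by (simp add: L_def lin_diff)
    show ?thesis
    proof (cases "q = 0")
      case True
      have "?dH c = lin (\<lambda>w. 0) c"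
        using c q True H.bar_bd_singleton by (intro lin_cong_on) (auto simp: simplices_def)
      then show ?thesis using L True q by (simp add: \<sigma>.zero)
    next
      case False
      have "L q (?dH c) = Z q (?dH c)"
        by (simp add: L_def dd[OF c] \<sigma>.zero)
      also have "\<dots> = ?\<phi> (\<sigma> q (?dH c))"
        by (simp add: Z_def b \<tau>.zero)
      finally show ?thesis using L False q by simp
    qed
  qed
  have L_in: "L p c \<in> ?U (Suc p)" if p: "1 \<le> p" and c: "c \<in> ?V p" for p c
  proof -
    obtain q where q: "p = Suc q" using p by (cases p) auto
    show ?thesis
      unfolding L_def Z_def using \<sigma>(1) \<tau>(1) \<phi>_in by (intro chains_on_closed) auto
  qed
  define h where "h p w = (if p = 0 \<or> n \<le> p then 0 else L p (basis w))" for p w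
  have lin_h: "lin (h p) c = L p c" if "1 \<le> p" "p < n" for p c
  proof -
    have "h p = (\<lambda>w. L p (basis w))" using that by (auto simp: h_def)
    then show ?thesis using linear_eq_lin[OF L_lin, of p c] by simp
  qed
  show thesis
  proof
    fix p w assume "w \<in> simplices p (carrier H)"
    then show "h p w \<in> ?U (Suc p)"
      using L_in[of p "basis w"] by (auto simp: h_def single_in_chains_on intro: chains_on_closed)
  next
    fix p :: nat and w :: "'h list" assume "p = 0 \<or> n \<le> p"
    then show "h p w = 0" by (auto simp: h_def)
  next
    fix p w assume p: "1 \<le> p" "p < n" and w: "w \<in> simplices p (carrier H)"
    then have b: "basis w \<in> ?V p" by (auto intro: single_in_chains_on)
    have "lin (h (p - 1)) (bar_bd H w) = (if p = 1 then 0 else L (p - 1) (bar_bd H w))"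
    proof (cases "p = 1")
      case True
      then have "h (p - 1) = (\<lambda>w. 0)" by (auto simp: h_def)
      then show ?thesis using True by simp
    qed (use p lin_h in auto)
    then show "bar_boundary G (h p w) + lin (h (p - 1)) (bar_bd H w) = basis (map \<phi> w)"
      using dL[OF p b] p by (auto simp: bar_boundary_eq_lin h_def split: if_splits)
  qed
qed

text \<open>The map induced by \<open>\<phi>\<close> times \<open>\<psi>\<close> is the sum of the induced maps, provided that \<open>\<phi>\<close> is zero in the
  homology of \<open>K\<close> in lower positive degrees. The outer terms of the Alexander--Whitney diagonal give \<open>\<phi>\<close>
  and \<open>\<psi>\<close>. In each middle term \<open>\<phi>\<close> is applied to a front face of degree between \<open>1\<close> and \<open>n - 1\<close> and can be
  replaced by a null-homotopy.\<close>

lemma (in commuting_subgroups) push_mult_hom: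
  fixes \<phi> \<psi> :: "'h \<Rightarrow> 'a"
  assumes H: "group H" and \<phi>: "\<phi> \<in> hom H G" "\<phi> ` carrier H \<subseteq> K"
    and \<psi>: "\<psi> \<in> hom H G" "\<psi> ` carrier H \<subseteq> B" and n: "1 \<le> n"
    and van: "\<And>p c. 1 \<le> p \<Longrightarrow> p < n \<Longrightarrow> c \<in> chains_on (simplices p (carrier H)) \<Longrightarrow>
      bar_boundary H c = 0 \<Longrightarrow>
      push (map \<phi>) c \<in> (bar_boundary G ` chains_on (simplices (Suc p) K) :: (_ \<Rightarrow>\<^sub>0 'k::field) set)"
    and c: "c \<in> chains_on (simplices n (carrier H))" "bar_boundary H c = 0"
  shows "push (map (\<lambda>a. \<phi> a \<otimes> \<psi> a)) c - (push (map \<phi>) c + push (map \<psi>) c) \<in>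
    (bar_boundary G ` chains_on (simplices (Suc n) (carrier G)) :: (_ \<Rightarrow>\<^sub>0 'k::field) set)"
proof -
  interpret H: group H by (rule H)
  obtain h :: "nat \<Rightarrow> 'h list \<Rightarrow> ('a list \<Rightarrow>\<^sub>0 'k)" where
    h_in: "\<And>p w. w \<in> simplices p (carrier H) \<Longrightarrow> h p w \<in> chains_on (simplices (Suc p) K)" and
    h0: "\<And>p w. p = 0 \<or> n \<le> p \<Longrightarrow> h p w = 0" and
    h: "\<And>p w. 1 \<le> p \<Longrightarrow> p < n \<Longrightarrow> w \<in> simplices p (carrier H) \<Longrightarrow>
      bar_boundary G (h p w) + lin (h (p - 1)) (bar_bd H w) = basis (map \<phi> w)"
    using null_homotopy_exists[OF H \<phi> van] by blast
  let ?C = "\<lambda>x' y. bar_cross G x' (map \<psi> y) :: _ \<Rightarrow>\<^sub>0 'k"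
  \<comment> \<open>the pairing of the middle terms, with \<open>\<phi>\<close> on the front face replaced by its null-homotopy\<close>
  define B' where "B' x y = lin (\<lambda>x'. ?C x' y) (h (length x) x)" for x y
  let ?A = "bar_aw (\<lambda>x y. bar_cross G (map \<phi> x) (map \<psi> y)) :: _ \<Rightarrow> (_ \<Rightarrow>\<^sub>0 'k)"
  have \<psi>B: "set (map \<psi> y) \<subseteq> B" if "set y \<subseteq> carrier H" for y using that \<psi> by auto
  have \<phi>K: "set (map \<phi> y) \<subseteq> K" if "set y \<subseteq> carrier H" for y using that \<phi> by auto
  have dB: "bar_boundary G (B' x y) + lin (\<lambda>u. B' u y) (bar_bd H x) + scale ((-1) ^ length x) (lin (B' x) (bar_bd H y))
      = lin (\<lambda>x'. ?C x' y) (bar_boundary G (h (length x) x) + lin (h (length x - 1)) (bar_bd H x))"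
    if x: "set x \<subseteq> carrier H" and y: "set y \<subseteq> carrier H" for x y
  proof -
    have hx: "h (length x) x \<in> chains_on (simplices (Suc (length x)) K)"
      using x by (intro h_in) (auto simp: simplices_def)
    have "bar_boundary G (B' x y) = lin (\<lambda>x'. bar_boundary G (?C x' y)) (h (length x) x)"
      by (simp add: B'_def bar_boundary_eq_lin lin_lin)
    also have "\<dots> = lin (\<lambda>x'. lin (\<lambda>u. ?C u y) (bar_bd G x')
        - scale ((-1) ^ length x) (lin (bar_cross G x') (bar_bd G (map \<psi> y)))) (h (length x) x)"
      using \<psi>B[OF y] by (intro lin_cong_on[OF hx], subst bar_boundary_cross) (auto simp: simplices_def)
    also have "\<dots> = lin (\<lambda>u. ?C u y) (bar_boundary G (h (length x) x))
        - scale ((-1) ^ length x) (lin (\<lambda>x'. lin (bar_cross G x') (bar_bd G (map \<psi> y))) (h (length x) x))"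
      unfolding lin_fun_diff lin_fun_scale bar_boundary_eq_lin lin_lin ..
    also have "lin (\<lambda>x'. lin (bar_cross G x') (bar_bd G (map \<psi> y))) (h (length x) x)
        = lin (\<lambda>x'. lin (?C x') (bar_bd H y)) (h (length x) x)"
      unfolding push_bar_bd[OF \<psi>(1) y, symmetric] lin_lin by simp
    also have "\<dots> = lin (B' x) (bar_bd H y)"
      by (subst lin_swap) (simp add: B'_def[abs_def])
    finally have 1: "bar_boundary G (B' x y) = lin (\<lambda>u. ?C u y) (bar_boundary G (h (length x) x))
        - scale ((-1) ^ length x) (lin (B' x) (bar_bd H y))" .
    have 2: "lin (\<lambda>u. B' u y) (bar_bd H x) = lin (\<lambda>x'. ?C x' y) (lin (h (length x - 1)) (bar_bd H x))"
    proof (cases x)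
      case (Cons a v)
      then have b: "bar_bd H x \<in> (chains_on (simplices (length v) (carrier H)) :: (_ \<Rightarrow>\<^sub>0 'k) set)"
        using x by (intro H.bar_bd_in_chains) (auto simp: simplices_def)
      show ?thesis
        unfolding lin_lin by (rule lin_cong_on[OF b]) (auto simp: B'_def Cons simplices_def)
    qed (simp add: bar_bd_def)
    show ?thesis unfolding 1 2 lin_add by simp
  qed
  have B'_in: "bar_aw B' w \<in> chains_on (simplices (Suc n) (carrier G))" if w: "w \<in> simplices n (carrier H)" for w n
    unfolding bar_aw_def
  proof (rule chains_on_closed)
    fix p assume p: "p \<in> {..length w}"
    have t: "take p w \<in> simplices p (carrier H)" "set (drop p w) \<subseteq> carrier H" "length w = n"
      using w p by (auto simp: simplices_def dest: in_set_takeD in_set_dropD)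
    show "B' (take p w) (drop p w) \<in> chains_on (simplices (Suc n) (carrier G))"
      unfolding B'_def
    proof (rule lin_in_chains_on)
      show "h (length (take p w)) (take p w) \<in> chains_on (simplices (Suc p) K)"
        using h_in[OF t(1)] p by (simp add: min_absorb2)
      fix x assume "x \<in> simplices (Suc p) K"
      from bar_cross_in_chains[OF this, of "map \<psi> (drop p w)" "n - p"]
      show "?C x (drop p w) \<in> chains_on (simplices (Suc n) (carrier G))"
        using \<psi>B[OF t(2)] t p by (simp add: simplices_def)
    qed
  qed
  have key: "bar_boundary G (bar_aw B' w) + lin (bar_aw B') (bar_bd H w) =
      ?A w - basis (map \<psi> w) - basis (map \<phi> w) + lin (h (n - 1)) (bar_bd H w)"
    if w: "w \<in> simplices n (carrier H)" for w
  proof -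
    have wc: "set w \<subseteq> carrier H" "length w = n" using w by (auto simp: simplices_def)
    have tk: "set (take p w) \<subseteq> carrier H" "set (drop p w) \<subseteq> carrier H" for p
      using wc by (auto dest: in_set_takeD in_set_dropD)
    let ?t = "\<lambda>p. lin (\<lambda>x'. ?C x' (drop p w)) (bar_boundary G (h p (take p w)) + lin (h (p - 1)) (bar_bd H (take p w)))"
    let ?c = "\<lambda>p. bar_cross G (map \<phi> (take p w)) (map \<psi> (drop p w)) :: _ \<Rightarrow>\<^sub>0 'k"
    have "bar_boundary G (bar_aw B' w) + lin (bar_aw B') (bar_bd H w) = (\<Sum>p\<le>n. ?t p)"
      unfolding H.bar_aw_bar_bd[OF wc(1)] bar_boundary_eq_lin bar_aw_def lin_sum sum.distrib[symmetric] wc(2)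
    proof (rule sum.cong)
      fix p assume p: "p \<in> {..n}"
      then have "length (take p w) = p" using wc by simp
      from dB[OF tk, of p p, unfolded this bar_boundary_eq_lin]
      show "lin (bar_bd G) (B' (take p w) (drop p w)) +
         (lin (\<lambda>u. B' u (drop p w)) (bar_bd H (take p w)) + scale ((-1) ^ p) (lin (B' (take p w)) (bar_bd H (drop p w)))) =
         lin (\<lambda>x'. ?C x' (drop p w)) (lin (bar_bd G) (h p (take p w)) + lin (h (p - 1)) (bar_bd H (take p w)))"
        by (simp add: add.assoc)
    qed simp
    also have "\<dots> = (\<Sum>p\<in>{1..<n}. ?t p) + (?t 0 + ?t n)"
    proof -
      have "{..n} = insert 0 (insert n {1..<n})" using n by auto
      then show ?thesis using n by (simp add: add_ac)
    qed
    also have "(\<Sum>p\<in>{1..<n}. ?t p) = (\<Sum>p\<in>{1..<n}. ?c p)"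
    proof (rule sum.cong)
      fix p assume p: "p \<in> {1..<n}"
      then have "take p w \<in> simplices p (carrier H)" using wc tk by (auto simp: simplices_def)
      then have "bar_boundary G (h p (take p w)) + lin (h (p - 1)) (bar_bd H (take p w)) = basis (map \<phi> (take p w))"
        using p by (intro h) auto
      then show "?t p = ?c p" by simp
    qed simp
    also have "?t 0 = 0" using h0 by (simp add: bar_bd_def bar_boundary_eq_lin)
    also have "?t n = lin (h (n - 1)) (bar_bd H w)"
    proof -
      obtain m where m: "n = Suc m" using n by (cases n) auto
      have "lin (h (n - 1)) (bar_bd H w) \<in> chains_on (simplices n K)"
        unfolding m by (rule lin_in_chains_on[OF H.bar_bd_in_chains]) (use w m h_in in auto)
      then have "lin (\<lambda>x'. ?C x' []) (lin (h (n - 1)) (bar_bd H w)) = lin basis (lin (h (n - 1)) (bar_bd H w))"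
        by (rule lin_cong_on) (simp add: bar_cross_Nil_right simplices_def)
      then show ?thesis using h0 wc by (simp add: bar_boundary_eq_lin)
    qed
    also have "(\<Sum>p\<in>{1..<n}. ?c p) = ?A w - basis (map \<psi> w) - basis (map \<phi> w)"
    proof -
      have "{..n} = insert 0 (insert n {1..<n})" using n by auto
      then have "?A w = ?c 0 + (?c n + (\<Sum>p\<in>{1..<n}. ?c p))"
        using n wc by (simp add: bar_aw_def)
      moreover have "?c 0 = basis (map \<psi> w)" "?c n = basis (map \<phi> w)"
        using wc \<psi>B \<phi>K by (auto simp: bar_cross_Nil_left bar_cross_Nil_right)
      ultimately show ?thesis by simp
    qed
    finally show ?thesis by simp
  qed
  have "bar_boundary G (lin (bar_aw B') c) + lin (bar_aw B') (bar_boundary H c)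
      = lin (\<lambda>w. bar_boundary G (bar_aw B' w) + lin (bar_aw B') (bar_bd H w)) c"
    by (simp add: bar_boundary_eq_lin lin_lin lin_fun_add)
  also have "\<dots> = lin (\<lambda>w. ?A w - basis (map \<psi> w) - basis (map \<phi> w) + lin (h (n - 1)) (bar_bd H w)) c"
    by (rule lin_cong_on[OF c(1)]) (rule key)
  also have "\<dots> = lin ?A c - push (map \<psi>) c - push (map \<phi>) c + lin (h (n - 1)) (bar_boundary H c)"
    by (simp add: lin_fun_add lin_fun_diff bar_boundary_eq_lin lin_lin)
  finally have A: "lin ?A c - push (map \<psi>) c - push (map \<phi>) c = bar_boundary G (lin (bar_aw B') c)"
    using c(2) by simp
  obtain e where e: "e \<in> chains_on (simplices (Suc n) (carrier G))"
      "push (map (\<lambda>a. \<phi> a \<otimes> \<psi> a)) c - lin ?A c = bar_boundary G e"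
    using bar_boundary_eilenberg_zilber[OF H \<phi> \<psi> _ c] commuting_subgroups_axioms by blast
  have "push (map (\<lambda>a. \<phi> a \<otimes> \<psi> a)) c - (push (map \<phi>) c + push (map \<psi>) c)
      = bar_boundary G e + bar_boundary G (lin (bar_aw B') c)"
    unfolding A[symmetric] e(2)[symmetric] by simp
  also have "\<dots> = bar_boundary G (e + lin (bar_aw B') c)"
    by (simp add: bar_boundary_eq_lin lin_add)
  finally show ?thesis
    using e(1) B'_in by (auto intro!: imageI chains_on_closed lin_in_chains_on[OF c(1)])
qed

section \<open>Homomorphisms that absorb a shifted copy of themselves\<close>

text \<open>Conjugation by \<open>d l\<close> turns the product of \<open>\<phi>\<close> and \<open>\<psi> l\<close> into \<open>\<psi> l\<close>, so on homology the sum of their maps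
  is the map of \<open>\<psi> l\<close> and \<open>\<phi>\<close> is zero, as long as the cross terms vanish. For this the target of \<open>\<phi>\<close> grows
  with the degree, and each degree consumes one of the homomorphisms \<open>\<psi> l\<close>.\<close>

theorem homology_vanishes_of_shifts:
  fixes \<phi> :: "'h \<Rightarrow> 'a" and \<psi> :: "nat \<Rightarrow> 'h \<Rightarrow> 'a" and d :: "nat \<Rightarrow> 'a"
  assumes H: "group H" and G: "group G"
    and \<phi>: "\<phi> \<in> hom H G" and \<psi>: "\<And>l. \<psi> l \<in> hom H G" and d: "\<And>l. d l \<in> carrier G"
    and \<phi>\<psi>: "\<And>l a b. a \<in> carrier H \<Longrightarrow> b \<in> carrier H \<Longrightarrow> \<phi> a \<otimes>\<^bsub>G\<^esub> \<psi> l b = \<psi> l b \<otimes>\<^bsub>G\<^esub> \<phi> a"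
    and \<psi>\<psi>: "\<And>k l a b. a \<in> carrier H \<Longrightarrow> b \<in> carrier H \<Longrightarrow> k < l \<Longrightarrow> \<psi> k a \<otimes>\<^bsub>G\<^esub> \<psi> l b = \<psi> l b \<otimes>\<^bsub>G\<^esub> \<psi> k a"
    and d\<psi>: "\<And>k l a. a \<in> carrier H \<Longrightarrow> k < l \<Longrightarrow> d k \<otimes>\<^bsub>G\<^esub> \<psi> l a = \<psi> l a \<otimes>\<^bsub>G\<^esub> d k"
    and shift: "\<And>l a. a \<in> carrier H \<Longrightarrow> d l \<otimes>\<^bsub>G\<^esub> (\<phi> a \<otimes>\<^bsub>G\<^esub> \<psi> l a) = \<psi> l a \<otimes>\<^bsub>G\<^esub> d l"
    and n: "1 \<le> n"
    and c: "c \<in> chains_on (simplices n (carrier H))" "bar_boundary H c = 0"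
  shows "push (map \<phi>) c \<in> (bar_boundary G ` chains_on (simplices (Suc n) (carrier G)) :: (_ \<Rightarrow>\<^sub>0 'k::field) set)"
proof -
  interpret G: group G by (rule G)
  interpret H: group H by (rule H)
  \<comment> \<open>These subgroups increase with \<open>j\<close>; in degrees up to \<open>j\<close> the map of \<open>\<phi>\<close> into \<open>K j\<close> will be zero.\<close>
  define K where "K j = {m \<in> carrier G. \<forall>l\<ge>j. \<forall>a\<in>carrier H. m \<otimes>\<^bsub>G\<^esub> \<psi> l a = \<psi> l a \<otimes>\<^bsub>G\<^esub> m}" for j
  have \<psi>c [simp]: "\<psi> l a \<in> carrier G" "\<phi> a \<in> carrier G" if "a \<in> carrier H" for l a
    using that \<psi> \<phi> by (auto simp: hom_def)
  have subK: "subgroup (K j) G" for j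
  proof
    show "K j \<subseteq> carrier G" by (auto simp: K_def)
    fix x y assume x: "x \<in> K j" and y: "y \<in> K j"
    show "x \<otimes>\<^bsub>G\<^esub> y \<in> K j" using x y by (auto simp: K_def G.m_assoc) (simp add: G.m_assoc[symmetric])
  next
    show "\<one>\<^bsub>G\<^esub> \<in> K j" by (auto simp: K_def)
  next
    fix x assume x: "x \<in> K j"
    have "inv\<^bsub>G\<^esub> x \<otimes>\<^bsub>G\<^esub> b = b \<otimes>\<^bsub>G\<^esub> inv\<^bsub>G\<^esub> x" if b: "b \<in> carrier G" "x \<otimes>\<^bsub>G\<^esub> b = b \<otimes>\<^bsub>G\<^esub> x" for b
    proof -
      have xc: "x \<in> carrier G" using x by (simp add: K_def)
      then have "inv\<^bsub>G\<^esub> x \<otimes>\<^bsub>G\<^esub> b = inv\<^bsub>G\<^esub> x \<otimes>\<^bsub>G\<^esub> (b \<otimes>\<^bsub>G\<^esub> x) \<otimes>\<^bsub>G\<^esub> inv\<^bsub>G\<^esub> x"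
        using b by (simp add: G.m_assoc)
      also have "inv\<^bsub>G\<^esub> x \<otimes>\<^bsub>G\<^esub> (b \<otimes>\<^bsub>G\<^esub> x) = b"
        using xc b(1) unfolding b(2)[symmetric] by (simp add: G.m_assoc[symmetric])
      finally show ?thesis .
    qed
    then show "inv\<^bsub>G\<^esub> x \<in> K j" using x by (auto simp: K_def)
  qed
  have \<phi>K: "\<phi> ` carrier H \<subseteq> K j" for j using \<phi>\<psi> by (auto simp: K_def)
  have \<psi>K: "\<psi> k ` carrier H \<subseteq> K j" if "k < j" for k j using \<psi>\<psi> that by (auto simp: K_def)
  have dK: "d k \<in> K j" if "k < j" for k j using d d\<psi> that by (auto simp: K_def)
  have "push (map \<phi>) c \<in> (bar_boundary G ` chains_on (simplices (Suc i) (K j)) :: (_ \<Rightarrow>\<^sub>0 'k) set)"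
    if "1 \<le> i" "i \<le> j" "c \<in> chains_on (simplices i (carrier H))" "bar_boundary H c = 0" for i j c
    using that
  proof (induction j arbitrary: i c)
    case (Suc j)
    let ?M = "G\<lparr>carrier := K (Suc j)\<rparr>"
    have M: "group ?M" by (rule G.subgroup_imp_group[OF subK])
    interpret M: group ?M by (rule M)
    have le: "K j \<subseteq> K (Suc j)" by (auto simp: K_def)
    have homM: "f \<in> hom H ?M" if "f \<in> hom H G" "f ` carrier H \<subseteq> K (Suc j)" for f
      using that by (auto simp: hom_def)
    have \<psi>M: "\<psi> j \<in> hom H ?M" by (intro homM \<psi> \<psi>K) simp
    have \<phi>M: "\<phi> \<in> hom H ?M" by (intro homM \<phi> \<phi>K)
    interpret commuting_subgroups ?M "K j" "\<psi> j ` carrier H"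
    proof (intro commuting_subgroups.intro M commuting_subgroups_axioms.intro)
      show "subgroup (K j) ?M" by (rule G.subgroup_incl[OF subK subK le])
      show "subgroup (\<psi> j ` carrier H) ?M"
        using group_hom.img_is_subgroup[of H ?M "\<psi> j"] \<psi>M M H by (auto simp: group_hom_def group_hom_axioms_def)
      fix k b assume "k \<in> K j" "b \<in> \<psi> j ` carrier H"
      then show "k \<otimes>\<^bsub>?M\<^esub> b = b \<otimes>\<^bsub>?M\<^esub> k" by (auto simp: K_def)
    qed
    have bM: "bar_boundary ?M = (bar_boundary G :: (_ \<Rightarrow>\<^sub>0 'k) \<Rightarrow> _)" by (simp add: bar_boundary_eq_lin)
    let ?\<chi> = "\<lambda>a. \<phi> a \<otimes>\<^bsub>?M\<^esub> \<psi> j a"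
    have "push (map ?\<chi>) c - (push (map \<phi>) c + push (map (\<psi> j)) c)
        \<in> (bar_boundary ?M ` chains_on (simplices (Suc i) (carrier ?M)) :: (_ \<Rightarrow>\<^sub>0 'k) set)"
    proof (rule push_mult_hom[OF H \<phi>M \<phi>K \<psi>M order.refl Suc.prems(1) _ Suc.prems(3,4)])
      fix p and c' :: "'h list \<Rightarrow>\<^sub>0 'k"
      assume "1 \<le> p" "p < i" "c' \<in> chains_on (simplices p (carrier H))" "bar_boundary H c' = 0"
      with Suc.prems show "push (map \<phi>) c' \<in> bar_boundary ?M ` chains_on (simplices (Suc p) (K j))"
        unfolding bM by (intro Suc.IH) auto
    qed
    then obtain e1 where e1: "e1 \<in> chains_on (simplices (Suc i) (K (Suc j)))"
        "push (map ?\<chi>) c - (push (map \<phi>) c + push (map (\<psi> j)) c) = bar_boundary G e1"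
      unfolding bM by auto
    have dM: "d j \<in> carrier ?M" using dK[of j "Suc j"] by simp
    have "push (map (\<lambda>a. inv\<^bsub>?M\<^esub> (d j) \<otimes>\<^bsub>?M\<^esub> \<psi> j a \<otimes>\<^bsub>?M\<^esub> d j)) c - push (map (\<psi> j)) c
        \<in> (bar_boundary ?M ` chains_on (simplices (Suc i) (carrier ?M)) :: (_ \<Rightarrow>\<^sub>0 'k) set)"
      by (rule M.bar_boundary_conjugation[OF H \<psi>M dM Suc.prems(3,4)])
    also have "push (map (\<lambda>a. inv\<^bsub>?M\<^esub> (d j) \<otimes>\<^bsub>?M\<^esub> \<psi> j a \<otimes>\<^bsub>?M\<^esub> d j)) c = push (map ?\<chi>) c"
    proof (rule lin_cong_on[OF Suc.prems(3)])
      fix w assume w: "w \<in> simplices i (carrier H)"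
      have "inv\<^bsub>?M\<^esub> (d j) \<otimes>\<^bsub>?M\<^esub> \<psi> j a \<otimes>\<^bsub>?M\<^esub> d j = ?\<chi> a" if a: "a \<in> carrier H" for a
      proof -
        have m: "\<phi> a \<in> carrier ?M" "\<psi> j a \<in> carrier ?M" using a \<phi>K \<psi>K[of j "Suc j"] by auto
        have "\<psi> j a \<otimes>\<^bsub>?M\<^esub> d j = d j \<otimes>\<^bsub>?M\<^esub> ?\<chi> a" using shift[OF a] by simp
        then show ?thesis
          using m dM M.m_assoc[of "inv\<^bsub>?M\<^esub> (d j)" "\<psi> j a" "d j"]
            M.m_assoc[of "inv\<^bsub>?M\<^esub> (d j)" "d j" "?\<chi> a", symmetric]
          by (metis M.inv_closed M.l_inv M.l_one M.m_closed)
      qed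
      then show "basis (map (\<lambda>a. inv\<^bsub>?M\<^esub> (d j) \<otimes>\<^bsub>?M\<^esub> \<psi> j a \<otimes>\<^bsub>?M\<^esub> d j) w) = (basis (map ?\<chi> w) :: _ \<Rightarrow>\<^sub>0 'k)"
        using w by (intro arg_cong[of _ _ basis] map_cong) (auto simp: simplices_def)
    qed
    finally obtain e2 where e2: "e2 \<in> chains_on (simplices (Suc i) (K (Suc j)))"
        "push (map ?\<chi>) c - push (map (\<psi> j)) c = bar_boundary G e2"
      unfolding bM by auto
    have "push (map \<phi>) c = bar_boundary G e2 - bar_boundary G e1"
      unfolding e1(2)[symmetric] e2(2)[symmetric] by simp
    also have "\<dots> = bar_boundary G (e2 - e1)" by (simp add: bar_boundary_eq_lin lin_diff)
    finally show ?case using e1(1) e2(1) by (auto intro: chains_on_closed)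
  qed simp
  from this[OF n order.refl c] have "push (map \<phi>) c \<in> bar_boundary G ` chains_on (simplices (Suc n) (K n))" .
  moreover have "chains_on (simplices (Suc n) (K n)) \<subseteq> (chains_on (simplices (Suc n) (carrier G)) :: (_ \<Rightarrow>\<^sub>0 'k) set)"
    by (rule chains_on_mono) (auto simp: simplices_def K_def)
  ultimately show ?thesis by blast
qed

section \<open>Local degree of planar homeomorphisms\<close>

lemma winding_number_compose_homotopic:
  assumes "homotopic_loops A p q" "continuous_on A f" "w \<notin> f ` A"
  shows "winding_number (f \<circ> p) w = winding_number (f \<circ> q) w"
proof (rule winding_number_homotopic_loops)
  show "homotopic_loops (- {w}) (f \<circ> p) (f \<circ> q)"
    using assms by (intro homotopic_loops_continuous_image[of A p q f "- {w}"]) auto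
qed

lemma circlepath_in_cball: "0 \<le> r \<Longrightarrow> t \<in> {0..1} \<Longrightarrow> circlepath z r t \<in> cball z r"
  by (simp add: circlepath dist_norm norm_mult)

text \<open>The local degree does not change when the circle is moved and shrunk inside the disc. The circles are
  homotopic by segments that avoid \<open>y\<close>, and \<open>f y\<close> can be moved to \<open>f z\<close> within the image of the open disc,
  which the image of the outer circle does not meet.\<close>

lemma winding_number_small_circle:
  assumes f: "continuous_on (cball z r) f" "inj_on f (cball z r)"
    and r: "0 < r" "0 < s" and sub: "cball y s \<subseteq> ball z r"
  shows "winding_number (f \<circ> circlepath y s) (f y) = winding_number (f \<circ> circlepath z r) (f z)"
proof -
  have y: "y \<in> ball z r" using sub r(2) by (meson centre_in_cball less_imp_le subsetD)
  have "homotopic_loops (cball z r - {y}) (circlepath y s) (circlepath z r)"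
  proof (rule homotopic_loops_linear)
    fix t :: real assume t: "t \<in> {0..1}"
    let ?e = "exp (2 * of_real pi * \<i> * of_real t) :: complex"
    have e: "norm ?e = 1" by simp
    have "circlepath y s t \<in> cball z r" "circlepath z r t \<in> cball z r"
      using circlepath_in_cball[of s t y] circlepath_in_cball[of r t z] sub t r by auto
    then have "closed_segment (circlepath y s t) (circlepath z r t) \<subseteq> cball z r"
      by (intro closed_segment_subset) auto
    moreover have "y \<notin> closed_segment (circlepath y s t) (circlepath z r t)"
    proof
      assume "y \<in> closed_segment (circlepath y s t) (circlepath z r t)"
      then obtain u where u: "0 \<le> u" "u \<le> 1"
        and "y = (1 - u) *\<^sub>R (y + of_real s * ?e) + u *\<^sub>R (z + of_real r * ?e)"
        by (auto simp: in_segment circlepath)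
      then have "of_real u * (y - z) = of_real ((1 - u) * s + u * r) * ?e"
        by (simp add: scaleR_conv_of_real algebra_simps)
      then have "norm (of_real u * (y - z)) = norm (of_real ((1 - u) * s + u * r) * ?e)" by simp
      then have "u * norm (y - z) = \<bar>(1 - u) * s + u * r\<bar>"
        using u by (simp only: norm_mult e norm_of_real) simp
      moreover have "0 \<le> (1 - u) * s" "0 \<le> u * r" using u r by auto
      ultimately have eq: "u * norm (y - z) = (1 - u) * s + u * r" by simp
      have "norm (y - z) < r" using y by (simp add: dist_norm norm_minus_commute)
      show False
      proof (cases "u = 0")
        case False
        then have "u * norm (y - z) < u * r" using u \<open>norm (y - z) < r\<close> by simp
        then show False using eq \<open>0 \<le> (1 - u) * s\<close> by linarith
      qed (use eq r in simp)
    qed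
    ultimately show "closed_segment (circlepath y s t) (circlepath z r t) \<subseteq> cball z r - {y}" by blast
  qed auto
  then have "winding_number (f \<circ> circlepath y s) (f y) = winding_number (f \<circ> circlepath z r) (f y)"
  proof (rule winding_number_compose_homotopic)
    show "continuous_on (cball z r - {y}) f" using f(1) by (rule continuous_on_subset) auto
    show "f y \<notin> f ` (cball z r - {y})" using f(2) y by (auto simp: inj_on_def)
  qed
  also have "\<dots> = winding_number (f \<circ> circlepath z r) (f z)"
  proof (rule winding_number_eq)
    show "path (f \<circ> circlepath z r)"
      using f(1) r by (intro path_continuous_image) (auto intro: continuous_on_subset)
    show "connected (f ` ball z r)"
      using f(1) by (intro connected_continuous_image) (auto intro: continuous_on_subset)
    show "f ` ball z r \<inter> path_image (f \<circ> circlepath z r) = {}"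
    proof -
      have "f ` (ball z r \<inter> sphere z r) = f ` ball z r \<inter> f ` sphere z r"
        using f(2) by (rule inj_on_image_Int) auto
      moreover have "ball z r \<inter> sphere z r = {}" by auto
      ultimately show ?thesis using r by (simp add: path_image_compose)
    qed
  qed (use y r in \<open>auto simp: pathfinish_compose pathstart_compose\<close>)
  finally show ?thesis .
qed

text \<open>The local degree is locally constant, so it suffices to know it at one point.\<close>

lemma orientation_preserving_connected:
  assumes U: "open U" "connected U" and f: "continuous_on U f" "inj_on f U"
    and z: "0 < r" "cball z r \<subseteq> U" "winding_number (f \<circ> circlepath z r) (f z) = 1"
  shows "orientation_preserving_on U f"
proof -
  define P where "P x \<longleftrightarrow> (\<forall>r>0. cball x r \<subseteq> U \<longrightarrow> winding_number (f \<circ> circlepath x r) (f x) = 1)" for x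
  have eq: "winding_number (f \<circ> circlepath y s) (f y) = winding_number (f \<circ> circlepath x r) (f x)"
    if h: "0 < r" "cball x r \<subseteq> U" "0 < s" "cball y s \<subseteq> U" "y \<in> ball x r" for x y r s
  proof -
    obtain e where e: "e > 0" "ball y e \<subseteq> ball x r" using open_ball h(5) by (meson open_contains_ball)
    let ?t = "min (e/2) (s/2)"
    have t: "0 < ?t" "cball y ?t \<subseteq> ball x r" "cball y ?t \<subseteq> ball y s"
      using e h(3) by (auto simp: subset_iff)
    have c: "continuous_on (cball x r) f" "inj_on f (cball x r)" "continuous_on (cball y s) f" "inj_on f (cball y s)"
      using h f by (auto intro: continuous_on_subset inj_on_subset)
    show ?thesis
      using winding_number_small_circle[OF c(1,2) h(1) t(1,2)]
        winding_number_small_circle[OF c(3,4) h(3) t(1,3)] by simp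
  qed
  have "P x" if "x \<in> U" for x
  proof (rule connected_induction_simple[OF U(2)])
    show "z \<in> U" using z by auto
    show "P z" unfolding P_def using eq[of r z _ z] z by auto
    show "x \<in> U" by fact
    fix a assume a: "a \<in> U"
    then obtain e where e: "e > 0" "cball a e \<subseteq> U" using U(1) open_contains_cball by blast
    show "\<exists>T. openin (top_of_set U) T \<and> a \<in> T \<and> (\<forall>x\<in>T. \<forall>y\<in>T. P x \<longrightarrow> P y)"
    proof (intro exI conjI ballI impI)
      show "openin (top_of_set U) (ball a e)" using e U(1) by (auto simp: openin_open_eq)
      fix x y assume x: "x \<in> ball a e" and y: "y \<in> ball a e" and "P x"
      have "x \<in> U" using x e by auto
      then obtain s where s: "s > 0" "cball x s \<subseteq> U" using U(1) open_contains_cball by blast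
      have "winding_number (f \<circ> circlepath a e) (f a) = 1"
        using eq[OF e s x] s \<open>P x\<close> by (simp add: P_def)
      then show "P y" unfolding P_def using eq[OF e _ _ y] by auto
    qed (use e in auto)
  qed
  then show ?thesis unfolding orientation_preserving_on_def P_def
    by (meson centre_in_cball less_imp_le subsetD)
qed

text \<open>Multiplicativity of the local degree. In logarithmic coordinates around \<open>w\<close> and \<open>f w\<close> the map \<open>f\<close> becomes
  a function \<open>h\<close> on a half-plane for which \<open>h (u + 2 * pi * \<i>) - h u\<close> is constant, namely \<open>2 * pi * \<i>\<close> times
  the degree. A loop of winding number \<open>n\<close> lifts to a path whose end points differ by \<open>n\<close> periods.\<close>

lemma winding_number_mult_degree:
  assumes r: "0 < r" and f: "continuous_on (cball w r) f" "\<And>x. x \<in> cball w r \<Longrightarrow> x \<noteq> w \<Longrightarrow> f x \<noteq> f w"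
    and p: "path p" "pathfinish p = pathstart p" "path_image p \<subseteq> cball w r - {w}"
  shows "winding_number (f \<circ> p) (f w) = winding_number (f \<circ> circlepath w r) (f w) * winding_number p w"
proof -
  \<comment> \<open>\<open>u \<mapsto> w + exp u\<close> covers the punctured disc by this half-plane\<close>
  define H where "H = {u. Re u \<le> ln r}"
  have H: "convex H" unfolding H_def by (rule convex_halfspace_Re_le)
  have Hin: "w + exp u \<in> cball w r" if "u \<in> H" for u
    using that r by (simp add: H_def dist_norm) (metis exp_le_cancel_iff exp_ln)
  have Hsh: "u + 2 * of_real pi * \<i> * of_int n \<in> H" if "u \<in> H" for u n
    using that by (simp add: H_def)
  have c1: "continuous_on H (\<lambda>u. f (w + exp u) - f w)"
    using Hin by (intro continuous_intros continuous_on_compose2[OF f(1)]) auto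
  have c2: "contractible H" using H by (rule convex_imp_contractible)
  have c3: "f (w + exp u) - f w \<noteq> 0" if "u \<in> H" for u
    using f(2)[OF Hin[OF that]] by simp
  obtain h where h: "continuous_on H h" "\<And>u. u \<in> H \<Longrightarrow> f (w + exp u) - f w = exp (h u)"
    by (rule continuous_logarithm_on_contractible[OF c1 c2 c3]) (auto intro: that)
  let ?c = "2 * of_real pi * \<i> :: complex"
  have wn: "winding_number (f \<circ> q) (f w) = (h (pathfinish k) - h (pathstart k)) / ?c"
    if k: "path k" "path_image k \<subseteq> H" and q: "\<And>t. t \<in> {0..1} \<Longrightarrow> q t = w + exp (k t)" for q k
  proof -
    have "winding_number (f \<circ> q) (f w) = winding_number (\<lambda>t. (f \<circ> q) t - f w) 0"
      by (rule winding_number_offset)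
    also have "\<dots> = winding_number (exp \<circ> (h \<circ> k)) 0"
    proof (rule winding_number_cong)
      fix t :: real assume "0 \<le> t" "t \<le> 1"
      then have t: "t \<in> {0..1}" by simp
      then have "k t \<in> H" using k(2) unfolding path_image_def by blast
      then show "(f \<circ> q) t - f w = (exp \<circ> (h \<circ> k)) t"
        using q[OF t] h(2)[of "k t"] by simp
    qed
    also have "\<dots> = (pathfinish (h \<circ> k) - pathstart (h \<circ> k)) / ?c"
      using k h(1) by (intro winding_number_compose_exp path_continuous_image) (auto intro: continuous_on_subset)
    finally show ?thesis by (simp add: pathfinish_compose pathstart_compose)
  qed
  define D where "D u = h (u + ?c) - h u" for u
  have Hsh1: "u + ?c \<in> H" if "u \<in> H" for u using Hsh[OF that, of 1] by simp
  have D_exp: "exp (D u) = 1" if "u \<in> H" for u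
  proof -
    have "exp (h (u + ?c)) = exp (h u)"
      using h(2)[OF that] h(2)[OF Hsh1[OF that]] by (simp add: exp_add)
    then show ?thesis by (simp add: D_def exp_diff)
  qed
  have "D constant_on H"
  proof (rule continuous_discrete_range_constant)
    show "connected H" using H by (rule convex_connected)
    show "continuous_on H D" unfolding D_def
      using Hsh1 by (intro continuous_intros continuous_on_compose2[OF h(1)] h(1)) auto
    fix u assume u: "u \<in> H"
    show "\<exists>e>0. \<forall>y. y \<in> H \<and> D y \<noteq> D u \<longrightarrow> e \<le> norm (D y - D u)"
    proof (intro exI[of _ "2 * pi"] conjI allI impI)
      fix y assume y: "y \<in> H \<and> D y \<noteq> D u"
      then have "exp (D y - D u) = 1" using D_exp u by (simp add: exp_diff)
      then obtain n :: int where "Re (D y - D u) = 0" "Im (D y - D u) = of_int (2 * n) * pi"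
        unfolding exp_eq_1 by blast
      then have n: "D y - D u = of_real (2 * pi * of_int n) * \<i>" by (simp add: complex_eq_iff)
      with y have "n \<noteq> 0" by auto
      then have "1 \<le> \<bar>real_of_int n\<bar>" by linarith
      then show "2 * pi \<le> norm (D y - D u)"
        unfolding n norm_mult norm_of_real by (simp add: abs_mult)
    qed auto
  qed
  then obtain d where d: "\<And>u. u \<in> H \<Longrightarrow> h (u + ?c) = h u + d"
    unfolding constant_on_def D_def by (metis add.commute diff_add_cancel)
  have nat: "h (u + ?c * of_nat m) = h u + of_nat m * d" if "u \<in> H" for u m
  proof (induction m)
    case (Suc m)
    have "u + ?c * of_nat m \<in> H" using Hsh[OF that, of "int m"] by simp
    from d[OF this] show ?case using Suc by (simp add: algebra_simps)
  qed simp
  have int: "h (u + ?c * of_int n) = h u + of_int n * d" if u: "u \<in> H" for u n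
  proof (cases "n \<ge> 0")
    case True
    then show ?thesis using nat[OF u, of "nat n"] by simp
  next
    case False
    then have "h u = h (u + ?c * of_int n) + of_nat (nat (- n)) * d"
      using nat[OF Hsh[OF u, of n], of "nat (- n)"] by (simp add: algebra_simps)
    then show ?thesis using False by simp
  qed
  have 1: "winding_number (f \<circ> circlepath w r) (f w) = d / ?c"
  proof -
    let ?k = "\<lambda>t. of_real (ln r) + ?c * of_real t"
    have "winding_number (f \<circ> circlepath w r) (f w) = (h (pathfinish ?k) - h (pathstart ?k)) / ?c"
    proof (rule wn)
      show "path ?k" unfolding path_def by (intro continuous_intros)
      show "path_image ?k \<subseteq> H" by (auto simp: path_image_def H_def)
      fix t :: real assume "t \<in> {0..1}"
      show "circlepath w r t = w + exp (?k t)"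
        using r by (simp add: circlepath exp_add exp_of_real)
    qed
    moreover have "of_real (ln r) \<in> H" by (simp add: H_def)
    ultimately show ?thesis using d[of "of_real (ln r)"] by (simp add: pathfinish_def pathstart_def)
  qed
  have w: "w \<notin> path_image p" using p by auto
  obtain q where q: "path q" "pathfinish q - pathstart q = ?c * winding_number p w"
      "\<And>t. t \<in> {0..1} \<Longrightarrow> p t = w + exp (q t)"
    by (rule winding_number_as_continuous_log[OF p(1) w]) (auto intro: that)
  obtain n where n: "winding_number p w = of_int n"
    using integer_winding_number[OF p(1,2) w] by (auto simp: Ints_def)
  have qH: "path_image q \<subseteq> H"
  proof
    fix u assume "u \<in> path_image q"
    then obtain t where t: "t \<in> {0..1}" "u = q t" by (auto simp: path_image_def)
    have "p t \<in> cball w r" using p(3) t(1) unfolding path_image_def by blast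
    then have "exp (Re u) \<le> r" using q(3)[OF t(1)] t by (simp add: dist_norm)
    then show "u \<in> H" using r by (simp add: H_def) (metis exp_gt_zero ln_exp ln_le_cancel_iff)
  qed
  have "winding_number (f \<circ> p) (f w) = (h (pathfinish q) - h (pathstart q)) / ?c"
    by (rule wn) (use q qH in auto)
  also have "pathfinish q = pathstart q + ?c * of_int n" using q(2) n by (simp add: algebra_simps)
  also have "h \<dots> = h (pathstart q) + of_int n * d"
    using qH by (intro int) (auto intro: pathstart_in_path_image[THEN subsetD[rotated]])
  finally show ?thesis unfolding 1 n by (simp add: comp_def mult.commute)
qed

text \<open>By invariance of domain the image of a disc contains a disc around \<open>g z\<close>, and a smaller circle is mapped
  into that. So local degrees of composites can be computed by \<open>winding_number_mult_degree\<close>.\<close>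

lemma small_circle_image:
  fixes g :: "complex \<Rightarrow> complex"
  assumes g: "continuous_on (cball z r) g" "inj_on g (cball z r)" and r: "0 < r"
  obtains \<rho> s where "0 < \<rho>" "0 < s" "s < r" "cball (g z) \<rho> \<subseteq> g ` ball z r"
    "path_image (g \<circ> circlepath z s) \<subseteq> cball (g z) \<rho> - {g z}"
proof -
  have c: "continuous_on (ball z r) g" "inj_on g (ball z r)"
    using g by (auto intro: continuous_on_subset inj_on_subset)
  have "open (g ` ball z r)" using invariance_of_domain[OF c(1) open_ball c(2)] .
  moreover have "g z \<in> g ` ball z r" using r by auto
  ultimately obtain \<rho> where \<rho>: "\<rho> > 0" "cball (g z) \<rho> \<subseteq> g ` ball z r" by (meson open_contains_cball)
  have "open (ball z r \<inter> g -` ball (g z) \<rho>)"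
    using c by (intro continuous_open_preimage) auto
  moreover have "z \<in> ball z r \<inter> g -` ball (g z) \<rho>" using r \<rho> by auto
  ultimately obtain s where s: "s > 0" "cball z s \<subseteq> ball z r \<inter> g -` ball (g z) \<rho>"
    by (meson open_contains_cball)
  let ?s = "min s (r / 2)"
  show thesis
  proof
    have "cball z ?s \<subseteq> cball z s" by (rule cball_subset_cball_iff[THEN iffD2]) auto
    then have "sphere z ?s \<subseteq> g -` ball (g z) \<rho>" using s(2) sphere_cball[of z ?s] by blast
    then have "g ` sphere z ?s \<subseteq> cball (g z) \<rho>" using ball_subset_cball by blast
    moreover have "sphere z ?s \<subseteq> cball z r - {z}" using r s by auto
    then have "g ` sphere z ?s \<subseteq> - {g z}" using g(2) r by (auto simp: inj_on_def)
    moreover have "path_image (g \<circ> circlepath z ?s) = g ` sphere z ?s"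
      using r s by (simp add: path_image_compose)
    ultimately show "path_image (g \<circ> circlepath z ?s) \<subseteq> cball (g z) \<rho> - {g z}" by blast
  qed (use r \<rho> s in auto)
qed

lemma orientation_preserving_compose:
  assumes f: "orientation_preserving_on Y f" "continuous_on Y f" "inj_on f Y"
    and g: "orientation_preserving_on Y g" "continuous_on Y g" "inj_on g Y" "g ` Y \<subseteq> Y"
  shows "orientation_preserving_on Y (f \<circ> g)"
  unfolding orientation_preserving_on_def
proof (intro allI impI)
  fix z r assume zr: "0 < r \<and> cball z r \<subseteq> Y"
  then have g': "continuous_on (cball z r) g" "inj_on g (cball z r)"
    using g by (auto intro: continuous_on_subset inj_on_subset)
  obtain \<rho> s where s: "0 < \<rho>" "0 < s" "s < r" "cball (g z) \<rho> \<subseteq> g ` ball z r"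
    and p: "path_image (g \<circ> circlepath z s) \<subseteq> cball (g z) \<rho> - {g z}"
    using small_circle_image[OF g'] zr by blast
  have sub: "cball (g z) \<rho> \<subseteq> Y" using s(4) zr g(4) by force
  have sr: "cball z s \<subseteq> ball z r" using s by auto
  have "winding_number ((f \<circ> g) \<circ> circlepath z r) ((f \<circ> g) z) = winding_number ((f \<circ> g) \<circ> circlepath z s) ((f \<circ> g) z)"
  proof (rule winding_number_small_circle[symmetric])
    show "continuous_on (cball z r) (f \<circ> g)"
      using g'(1) f(2) g(4) zr by (intro continuous_on_compose) (auto intro: continuous_on_subset)
    show "inj_on (f \<circ> g) (cball z r)"
      using g'(2) f(3) g(4) zr by (intro comp_inj_on) (auto intro: inj_on_subset)
  qed (use zr s sr in auto)
  also have "\<dots> = winding_number (f \<circ> (g \<circ> circlepath z s)) (f (g z))" by (simp add: comp_assoc)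
  also have "\<dots> = winding_number (f \<circ> circlepath (g z) \<rho>) (f (g z)) * winding_number (g \<circ> circlepath z s) (g z)"
  proof (rule winding_number_mult_degree[OF s(1) _ _ _ _ p])
    show "continuous_on (cball (g z) \<rho>) f" using f(2) sub by (rule continuous_on_subset)
    show "f x \<noteq> f (g z)" if "x \<in> cball (g z) \<rho>" "x \<noteq> g z" for x
      using f(3) sub that s(1) by (meson centre_in_cball inj_on_def less_imp_le subsetD)
    show "path (g \<circ> circlepath z s)"
      using g'(1) s by (intro path_continuous_image) (auto intro: continuous_on_subset)
  qed (auto simp: pathfinish_compose pathstart_compose)
  also have "\<dots> = 1"
  proof -
    have "cball z s \<subseteq> Y" using sr zr by (meson ball_subset_cball order_trans)
    then show ?thesis using f(1) g(1) s sub by (simp add: orientation_preserving_on_def)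
  qed
  finally show "winding_number ((f \<circ> g) \<circ> circlepath z r) ((f \<circ> g) z) = 1" .
qed

lemma orientation_preserving_inverse:
  assumes f: "orientation_preserving_on Y f" "homeomorphism Y Y f g"
  shows "orientation_preserving_on Y g"
  unfolding orientation_preserving_on_def
proof (intro allI impI)
  have c: "continuous_on Y f" "continuous_on Y g" "inj_on f Y" "inj_on g Y" "g ` Y = Y"
    and fg: "\<And>y. y \<in> Y \<Longrightarrow> f (g y) = y"
    using f(2) by (auto simp: homeomorphism_def intro: inj_on_inverseI)
  fix z r assume zr: "0 < r \<and> cball z r \<subseteq> Y"
  then have g': "continuous_on (cball z r) g" "inj_on g (cball z r)"
    using c by (auto intro: continuous_on_subset inj_on_subset)
  obtain \<rho> s where s: "0 < \<rho>" "0 < s" "s < r" "cball (g z) \<rho> \<subseteq> g ` ball z r"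
    and p: "path_image (g \<circ> circlepath z s) \<subseteq> cball (g z) \<rho> - {g z}"
    using small_circle_image[OF g'] zr by blast
  have sub: "cball (g z) \<rho> \<subseteq> Y" using s(4) zr c(5) by force
  have sr: "cball z s \<subseteq> ball z r" using s by auto
  have sY: "cball z s \<subseteq> Y" using sr zr by (meson ball_subset_cball order_trans)
  have "winding_number (g \<circ> circlepath z s) (g z)
      = winding_number (f \<circ> circlepath (g z) \<rho>) (f (g z)) * winding_number (g \<circ> circlepath z s) (g z)"
    using f(1) s sub by (simp add: orientation_preserving_on_def)
  also have "\<dots> = winding_number (f \<circ> (g \<circ> circlepath z s)) (f (g z))"
  proof (rule winding_number_mult_degree[OF s(1) _ _ _ _ p, symmetric])
    show "continuous_on (cball (g z) \<rho>) f" using c(1) sub by (rule continuous_on_subset)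
    show "f x \<noteq> f (g z)" if "x \<in> cball (g z) \<rho>" "x \<noteq> g z" for x
      using c(3) sub that s(1) by (meson centre_in_cball inj_on_def less_imp_le subsetD)
    show "path (g \<circ> circlepath z s)"
      using g'(1) s by (intro path_continuous_image) (auto intro: continuous_on_subset)
  qed (auto simp: pathfinish_compose pathstart_compose)
  also have "\<dots> = winding_number (circlepath z s) z"
  proof -
    have "z \<in> Y" using zr by (meson centre_in_cball less_imp_le subsetD)
    then have "f (g z) = z" by (rule fg)
    moreover have "winding_number (f \<circ> (g \<circ> circlepath z s)) z = winding_number (circlepath z s) z"
    proof (rule winding_number_cong)
      fix t :: real assume "0 \<le> t" "t \<le> 1"
      then have "circlepath z s t \<in> Y" using circlepath_in_cball[of s t z] s sY by auto
      then show "(f \<circ> (g \<circ> circlepath z s)) t = circlepath z s t" by (simp add: fg)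
    qed
    ultimately show ?thesis by simp
  qed
  also have "\<dots> = 1" using s by (simp add: winding_number_circlepath_centre)
  finally show "winding_number (g \<circ> circlepath z r) (g z) = 1"
    using winding_number_small_circle[OF g' _ s(2) sr] zr by simp
qed

section \<open>Mapping class groups\<close>

lemma Homeo_bdE:
  assumes "f \<in> Homeo_bd Y"
  obtains g where "homeomorphism Y Y f g" "f \<in> extensional Y" "orientation_preserving_on Y f"
    "\<And>z. z \<in> manifold_boundary Y \<Longrightarrow> f z = z"
  using assms unfolding Homeo_bd_def by auto

lemma Homeo_bd_props:
  assumes "f \<in> Homeo_bd Y"
  shows "continuous_on Y f" "f ` Y = Y" "inj_on f Y" "f \<in> extensional Y"
    "orientation_preserving_on Y f" "\<And>z. z \<in> manifold_boundary Y \<Longrightarrow> f z = z"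
  by (rule Homeo_bdE[OF assms]; force simp: homeomorphism_def intro: inj_on_inverseI)+

lemma orientation_preserving_cong:
  assumes "\<And>z. z \<in> Y \<Longrightarrow> f z = g z" "orientation_preserving_on Y f"
  shows "orientation_preserving_on Y g"
  unfolding orientation_preserving_on_def
proof (intro allI impI)
  fix z r assume zr: "0 < r \<and> cball z r \<subseteq> Y"
  have "winding_number (g \<circ> circlepath z r) (g z) = winding_number (f \<circ> circlepath z r) (f z)"
  proof -
    have "z \<in> Y" using zr by (meson centre_in_cball less_imp_le subsetD)
    moreover have "winding_number (g \<circ> circlepath z r) (f z) = winding_number (f \<circ> circlepath z r) (f z)"
    proof (rule winding_number_cong)
      fix t :: real assume "0 \<le> t" "t \<le> 1"
      then have "circlepath z r t \<in> Y" using circlepath_in_cball[of r t z] zr by auto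
      then show "(g \<circ> circlepath z r) t = (f \<circ> circlepath z r) t" using assms(1) by simp
    qed
    ultimately show ?thesis using assms(1) by simp
  qed
  then show "winding_number (g \<circ> circlepath z r) (g z) = 1"
    using assms(2) zr by (simp add: orientation_preserving_on_def)
qed

lemma manifold_boundary_subset: "manifold_boundary Y \<subseteq> Y"
  by (auto simp: manifold_boundary_def)

lemma orientation_preserving_ident: "orientation_preserving_on Y (\<lambda>z. z)"
  by (auto simp: orientation_preserving_on_def comp_def winding_number_circlepath_centre)

lemma ident_in_Homeo_bd: "(\<lambda>z\<in>Y. z) \<in> Homeo_bd Y"
proof -
  have "homeomorphism Y Y (\<lambda>z\<in>Y. z) (\<lambda>z. z)"
    by (auto simp: homeomorphism_def intro: continuous_on_eq[OF continuous_on_id])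
  moreover have "orientation_preserving_on Y (\<lambda>z\<in>Y. z)"
    by (rule orientation_preserving_cong[OF _ orientation_preserving_ident]) auto
  ultimately show ?thesis
    using manifold_boundary_subset by (auto simp: Homeo_bd_def)
qed

lemma compose_in_Homeo_bd:
  assumes f: "f \<in> Homeo_bd Y" and g: "g \<in> Homeo_bd Y"
  shows "compose Y f g \<in> Homeo_bd Y"
proof -
  note F = Homeo_bd_props[OF f] and G = Homeo_bd_props[OF g]
  obtain f' where f': "homeomorphism Y Y f f'" using f by (rule Homeo_bdE)
  obtain g' where g': "homeomorphism Y Y g g'" using g by (rule Homeo_bdE)
  have "homeomorphism Y Y (compose Y f g) (g' \<circ> f')"
    by (rule homeomorphism_cong[OF homeomorphism_compose[OF g' f']]) (auto simp: compose_def)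
  moreover have "orientation_preserving_on Y (compose Y f g)"
    by (rule orientation_preserving_cong[OF _ orientation_preserving_compose[OF F(5,1,3) G(5,1,3)]])
      (auto simp: compose_def G(2))
  moreover have "compose Y f g z = z" if "z \<in> manifold_boundary Y" for z
    using that F(6) G(6) manifold_boundary_subset by (auto simp: compose_def)
  ultimately show ?thesis by (auto simp: Homeo_bd_def compose_def)
qed

lemma inverse_in_Homeo_bd:
  assumes f: "f \<in> Homeo_bd Y"
  obtains g where "g \<in> Homeo_bd Y" "compose Y g f = (\<lambda>z\<in>Y. z)" "compose Y f g = (\<lambda>z\<in>Y. z)"
proof -
  obtain f' where f': "homeomorphism Y Y f f'" "orientation_preserving_on Y f"
      "\<And>z. z \<in> manifold_boundary Y \<Longrightarrow> f z = z"
    using f by (rule Homeo_bdE) blast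
  let ?g = "\<lambda>z\<in>Y. f' z"
  have fg: "\<And>y. y \<in> Y \<Longrightarrow> f (f' y) = y \<and> f' (f y) = y \<and> f y \<in> Y \<and> f' y \<in> Y"
    using f'(1) by (auto simp: homeomorphism_def)
  have h: "homeomorphism Y Y f ?g"
    by (rule homeomorphism_cong[OF f'(1)]) auto
  then have "homeomorphism Y Y ?g f" by (simp add: homeomorphism_symD)
  moreover have "orientation_preserving_on Y ?g"
    using f'(2) h by (rule orientation_preserving_inverse)
  moreover have "?g z = z" if "z \<in> manifold_boundary Y" for z
    using that f'(3)[OF that] fg[of z] manifold_boundary_subset by auto
  ultimately have "?g \<in> Homeo_bd Y" by (auto simp: Homeo_bd_def)
  moreover have "compose Y ?g f = (\<lambda>z\<in>Y. z)" "compose Y f ?g = (\<lambda>z\<in>Y. z)"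
    using fg by (auto simp: compose_def)
  ultimately show thesis by (rule that)
qed

lemma isotopic_in_refl: "f \<in> Homeo_bd Y \<Longrightarrow> isotopic_in Y f f"
  using Homeo_bd_props[of f Y] by (auto simp: isotopic_in_def)

lemma isotopic_in_sym: "isotopic_in Y f g \<Longrightarrow> isotopic_in Y g f"
  by (simp add: isotopic_in_def homotopic_with_sym)

lemma isotopic_in_trans: "isotopic_in Y f g \<Longrightarrow> isotopic_in Y g h \<Longrightarrow> isotopic_in Y f h"
  unfolding isotopic_in_def by (rule homotopic_with_trans)

text \<open>Isotopy as joint continuity in time and position.\<close>

lemma isotopic_in_iff:
  "isotopic_in Y f g \<longleftrightarrow>
    (\<exists>h. continuous_on ({0..1} \<times> Y) (\<lambda>(t, x). h t x) \<and> h 0 = f \<and> h 1 = g \<and>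
      (\<forall>t\<in>{0..1::real}. h t \<in> Homeo_bd Y))" (is "_ \<longleftrightarrow> ?R")
proof
  assume "isotopic_in Y f g"
  then obtain k where k: "continuous_on ({0..1} \<times> Y) k" "\<And>x. k (0, x) = f x" "\<And>x. k (1, x) = g x"
      "\<And>t. t \<in> {0..1::real} \<Longrightarrow> (\<lambda>x. k (t, x)) \<in> Homeo_bd Y"
    unfolding isotopic_in_def homotopic_with_def by auto
  show ?R
    by (rule exI[of _ "\<lambda>t x. k (t, x)"]) (use k in \<open>auto simp: case_prod_unfold\<close>)
next
  assume ?R
  then obtain h where h: "continuous_on ({0..1} \<times> Y) (\<lambda>(t, x). h t x)" "h 0 = f" "h 1 = g"
      "\<And>t. t \<in> {0..1::real} \<Longrightarrow> h t \<in> Homeo_bd Y" by auto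
  have hY: "h t x \<in> Y" if "t \<in> {0..1}" "x \<in> Y" for t x
    using Homeo_bd_props(2)[OF h(4)[OF that(1)]] that(2) by blast
  then show "isotopic_in Y f g"
    unfolding isotopic_in_def homotopic_with_def
    by (intro exI[of _ "\<lambda>(t, x). h t x"]) (use h hY in auto)
qed

lemma isotopic_in_compose:
  assumes "isotopic_in Y f f'" "isotopic_in Y g g'"
  shows "isotopic_in Y (compose Y f g) (compose Y f' g')"
proof -
  obtain h where h: "continuous_on ({0..1} \<times> Y) (\<lambda>(t, x). h t x)" "h 0 = f" "h 1 = f'"
      "\<And>t. t \<in> {0..1::real} \<Longrightarrow> h t \<in> Homeo_bd Y"
    using assms(1) by (auto simp: isotopic_in_iff)
  obtain k where k: "continuous_on ({0..1} \<times> Y) (\<lambda>(t, x). k t x)" "k 0 = g" "k 1 = g'"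
      "\<And>t. t \<in> {0..1::real} \<Longrightarrow> k t \<in> Homeo_bd Y"
    using assms(2) by (auto simp: isotopic_in_iff)
  have kY: "k t x \<in> Y" if "t \<in> {0..1}" "x \<in> Y" for t x
    using Homeo_bd_props(2)[OF k(4)[OF that(1)]] that(2) by blast
  have "continuous_on ({0..1} \<times> Y) (\<lambda>p. (\<lambda>(t, x). h t x) (fst p, (\<lambda>(t, x). k t x) p))"
    using kY by (intro continuous_on_compose2[OF h(1)] continuous_intros k(1)) auto
  then have "continuous_on ({0..1} \<times> Y) (\<lambda>(t, x). compose Y (h t) (k t) x)"
    by (rule continuous_on_eq) (auto simp: compose_def)
  then show ?thesis
    unfolding isotopic_in_iff
    by (intro exI[of _ "\<lambda>t. compose Y (h t) (k t)"]) (use h k compose_in_Homeo_bd in auto)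
qed

lemma isotopy_class_eq: "isotopic_in Y f g \<Longrightarrow> isotopy_class Y f = isotopy_class Y g"
  by (auto simp: isotopy_class_def intro: isotopic_in_trans isotopic_in_sym)

lemma in_isotopy_class: "f \<in> Homeo_bd Y \<Longrightarrow> f \<in> isotopy_class Y f"
  by (simp add: isotopy_class_def isotopic_in_refl)

lemma UN_isotopy_class:
  assumes "f \<in> Homeo_bd Y" "\<And>f'. isotopic_in Y f f' \<Longrightarrow> F f' = F f"
  shows "(\<Union>f'\<in>isotopy_class Y f. F f') = F f"
proof -
  have "F f' = F f" if "f' \<in> isotopy_class Y f" for f'
    using that assms(2) unfolding isotopy_class_def by blast
  then have "(\<Union>f'\<in>isotopy_class Y f. F f') = (\<Union>f'\<in>isotopy_class Y f. F f)"
    by (rule SUP_cong[OF refl])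
  also have "\<dots> = F f" using in_isotopy_class[OF assms(1)] by auto
  finally show ?thesis .
qed

lemma mult_mapping_class:
  assumes "f \<in> Homeo_bd Y" "g \<in> Homeo_bd Y"
  shows "isotopy_class Y f \<otimes>\<^bsub>mapping_class_group Y\<^esub> isotopy_class Y g = isotopy_class Y (compose Y f g)"
proof -
  have 1: "(\<Union>g'\<in>isotopy_class Y g. isotopy_class Y (compose Y f' g')) = isotopy_class Y (compose Y f' g)"
    if "f' \<in> Homeo_bd Y" for f'
    by (rule UN_isotopy_class[OF assms(2)], rule isotopy_class_eq[symmetric],
        rule isotopic_in_compose[OF isotopic_in_refl[OF that]])
  have in_class: "f' \<in> Homeo_bd Y" if "f' \<in> isotopy_class Y f" for f'
    using that by (simp add: isotopy_class_def)
  have "(\<Union>f'\<in>isotopy_class Y f. isotopy_class Y (compose Y f' g)) = isotopy_class Y (compose Y f g)"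
    by (rule UN_isotopy_class[OF assms(1)], rule isotopy_class_eq[symmetric],
        rule isotopic_in_compose[OF _ isotopic_in_refl[OF assms(2)]])
  then show ?thesis
    by (simp add: mapping_class_group_def) (metis (no_types, lifting) 1 SUP_cong in_class)
qed

lemma carrier_mapping_class_group: "carrier (mapping_class_group Y) = isotopy_class Y ` Homeo_bd Y"
  by (simp add: mapping_class_group_def)

lemma group_mapping_class_group: "group (mapping_class_group Y)"
proof (rule groupI)
  show "\<one>\<^bsub>mapping_class_group Y\<^esub> \<in> carrier (mapping_class_group Y)"
    by (auto simp: mapping_class_group_def ident_in_Homeo_bd)
  fix x assume "x \<in> carrier (mapping_class_group Y)"
  then obtain f where f: "f \<in> Homeo_bd Y" "x = isotopy_class Y f" by (auto simp: carrier_mapping_class_group)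
  have one: "\<one>\<^bsub>mapping_class_group Y\<^esub> = isotopy_class Y (\<lambda>z\<in>Y. z)" by (simp add: mapping_class_group_def)
  have "compose Y (\<lambda>z\<in>Y. z) f = f"
    using Homeo_bd_props(2,4)[OF f(1)] by (auto simp: compose_def extensional_def fun_eq_iff)
  then show "\<one>\<^bsub>mapping_class_group Y\<^esub> \<otimes>\<^bsub>mapping_class_group Y\<^esub> x = x"
    using f by (simp add: one mult_mapping_class ident_in_Homeo_bd)
  obtain g where g: "g \<in> Homeo_bd Y" "compose Y g f = (\<lambda>z\<in>Y. z)" using inverse_in_Homeo_bd[OF f(1)] by metis
  show "\<exists>y\<in>carrier (mapping_class_group Y). y \<otimes>\<^bsub>mapping_class_group Y\<^esub> x = \<one>\<^bsub>mapping_class_group Y\<^esub>"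
    using f g by (intro bexI[of _ "isotopy_class Y g"]) (auto simp: one mult_mapping_class carrier_mapping_class_group)
  fix y assume "y \<in> carrier (mapping_class_group Y)"
  then obtain g where g: "g \<in> Homeo_bd Y" "y = isotopy_class Y g" by (auto simp: carrier_mapping_class_group)
  then show "x \<otimes>\<^bsub>mapping_class_group Y\<^esub> y \<in> carrier (mapping_class_group Y)"
    using f by (auto simp: mult_mapping_class compose_in_Homeo_bd carrier_mapping_class_group)
  fix z assume "z \<in> carrier (mapping_class_group Y)"
  then obtain h where h: "h \<in> Homeo_bd Y" "z = isotopy_class Y h" by (auto simp: carrier_mapping_class_group)
  have "compose Y (compose Y f g) h = compose Y f (compose Y g h)"
    using Homeo_bd_props(2)[OF h(1)] by (auto simp: compose_def fun_eq_iff)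
  then show "x \<otimes>\<^bsub>mapping_class_group Y\<^esub> y \<otimes>\<^bsub>mapping_class_group Y\<^esub> z =
      x \<otimes>\<^bsub>mapping_class_group Y\<^esub> (y \<otimes>\<^bsub>mapping_class_group Y\<^esub> z)"
    using f g h by (simp add: mult_mapping_class compose_in_Homeo_bd)
qed

text \<open>Any construction on homeomorphisms that respects isotopy and composition induces a homomorphism of
  mapping class groups, in the set-valued form in which \<^const>\<open>mapping_class_extend\<close> is given.\<close>

lemma mapping_class_homI:
  assumes F: "\<And>f. f \<in> Homeo_bd X \<Longrightarrow> F f \<in> Homeo_bd S"
    and iso: "\<And>f f'. isotopic_in X f f' \<Longrightarrow> isotopic_in S (F f) (F f')"
    and mult: "\<And>f g. f \<in> Homeo_bd X \<Longrightarrow> g \<in> Homeo_bd X \<Longrightarrow> F (compose X f g) = compose S (F f) (F g)"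
  shows "(\<lambda>A. \<Union>f\<in>A. isotopy_class S (F f)) \<in> hom (mapping_class_group X) (mapping_class_group S)"
    and "\<And>f. f \<in> Homeo_bd X \<Longrightarrow> (\<Union>f'\<in>isotopy_class X f. isotopy_class S (F f')) = isotopy_class S (F f)"
proof -
  show *: "(\<Union>f'\<in>isotopy_class X f. isotopy_class S (F f')) = isotopy_class S (F f)" if "f \<in> Homeo_bd X" for f
    by (rule UN_isotopy_class[OF that], rule isotopy_class_eq[symmetric], rule iso)
  show "(\<lambda>A. \<Union>f\<in>A. isotopy_class S (F f)) \<in> hom (mapping_class_group X) (mapping_class_group S)"
  proof (rule homI)
    fix x assume "x \<in> carrier (mapping_class_group X)"
    then obtain f where f: "f \<in> Homeo_bd X" "x = isotopy_class X f" by (auto simp: carrier_mapping_class_group)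
    then show "(\<Union>f\<in>x. isotopy_class S (F f)) \<in> carrier (mapping_class_group S)"
      by (simp add: * carrier_mapping_class_group F)
    fix y assume "y \<in> carrier (mapping_class_group X)"
    then obtain g where g: "g \<in> Homeo_bd X" "y = isotopy_class X g" by (auto simp: carrier_mapping_class_group)
    show "(\<Union>f\<in>x \<otimes>\<^bsub>mapping_class_group X\<^esub> y. isotopy_class S (F f)) =
        (\<Union>f\<in>x. isotopy_class S (F f)) \<otimes>\<^bsub>mapping_class_group S\<^esub> (\<Union>f\<in>y. isotopy_class S (F f))"
      using f g by (simp add: * mult_mapping_class compose_in_Homeo_bd F mult)
  qed
qed

section \<open>Finite-type subsurfaces are bounded\<close>

text \<open>Invariance of domain. Consequently the topological frontier of \<open>X\<close> within the plane without the lattice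
  belongs to the manifold boundary, where all homeomorphisms in question are the identity; this is why they
  extend by the identity.\<close>

lemma manifold_interior_subset: "manifold_interior X \<subseteq> interior X"
proof
  fix x assume "x \<in> manifold_interior X"
  then obtain U V where U: "x \<in> U" "openin (top_of_set X) U" "open (V :: complex set)" "U homeomorphic V"
    by (auto simp: manifold_interior_def)
  then obtain f g where fg: "homeomorphism U V f g" by (auto simp: homeomorphic_def)
  then have g: "continuous_on V g" "g ` V = U" "inj_on g V"
    by (auto simp: homeomorphism_def intro: inj_on_inverseI)
  have "open U" using invariance_of_domain[OF g(1) U(3) g(3)] g(2) by simp
  then show "x \<in> interior X" using U openin_imp_subset[OF U(2)] by (intro interiorI[of U])
qed

lemma frontier_points_in_manifold_boundary: "z \<in> X \<Longrightarrow> z \<notin> interior X \<Longrightarrow> z \<in> manifold_boundary X"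
  using manifold_interior_subset by (auto simp: manifold_boundary_def)

lemma closed_integer_lattice: "closed integer_lattice"
proof -
  have "integer_lattice = Re -` \<int> \<inter> Im -` \<int>" by (auto simp: integer_lattice_def)
  moreover have "closed (Re -` \<int> \<inter> Im -` \<int>)"
    by (intro closed_Int closed_vimage closed_Ints continuous_intros)
  ultimately show ?thesis by simp
qed

lemma countable_integer_lattice: "countable integer_lattice"
proof -
  have "integer_lattice \<subseteq> (\<lambda>(x, y). Complex x y) ` (\<int> \<times> \<int>)"
    by (auto simp: integer_lattice_def image_iff complex_eq_iff)
  moreover have "countable ((\<lambda>(x, y). Complex x y) ` (\<int> \<times> \<int>))"
    by (intro countable_image countable_SIGMA countable_int)
  ultimately show ?thesis by (rule countable_subset)
qed

lemma loops_atD: "p \<in> loops_at X a \<Longrightarrow> path p \<and> path_image p \<subseteq> X \<and> pathstart p = a \<and> pathfinish p = a"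
  by (simp add: loops_at_def)

lemma loops_at_join: "p \<in> loops_at X a \<Longrightarrow> q \<in> loops_at X a \<Longrightarrow> p +++ q \<in> loops_at X a"
  by (auto simp: loops_at_def path_image_join)

lemma loop_class_eq: "homotopic_paths X p q \<Longrightarrow> loop_class X a p = loop_class X a q"
  unfolding loop_class_def by (metis homotopic_paths_sym homotopic_paths_trans)

lemma in_loop_class: "p \<in> loops_at X a \<Longrightarrow> p \<in> loop_class X a p"
  by (simp add: loop_class_def loops_at_def)

lemma in_loop_classD: "q \<in> loop_class X a p \<Longrightarrow> q \<in> loops_at X a \<and> homotopic_paths X p q"
  by (simp add: loop_class_def)

lemma carrier_fundamental_group: "carrier (fundamental_group X a) = loop_class X a ` loops_at X a"
  by (simp add: fundamental_group_def)

lemma mult_loop_class: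
  assumes p: "p \<in> loops_at X a" and q: "q \<in> loops_at X a"
  shows "loop_class X a p \<otimes>\<^bsub>fundamental_group X a\<^esub> loop_class X a q = loop_class X a (p +++ q)"
proof -
  have eq: "loop_class X a (p' +++ q') = loop_class X a (p +++ q)"
    if "p' \<in> loop_class X a p" "q' \<in> loop_class X a q" for p' q'
  proof (rule loop_class_eq, rule homotopic_paths_join)
    show "homotopic_paths X p' p" "homotopic_paths X q' q"
      using in_loop_classD[OF that(1)] in_loop_classD[OF that(2)] by (auto intro: homotopic_paths_sym)
    show "pathfinish p' = pathstart q'"
      using in_loop_classD[OF that(1)] in_loop_classD[OF that(2)] by (auto dest!: loops_atD)
  qed
  have "(\<Union>p'\<in>loop_class X a p. \<Union>q'\<in>loop_class X a q. loop_class X a (p' +++ q')) =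
      (\<Union>p'\<in>loop_class X a p. \<Union>q'\<in>loop_class X a q. loop_class X a (p +++ q))"
    by (intro SUP_cong refl eq)
  also have "\<dots> = loop_class X a (p +++ q)"
    using in_loop_class[OF p] in_loop_class[OF q] by auto
  finally show ?thesis by (simp add: fundamental_group_def)
qed

lemma one_fundamental_group:
  fixes a :: "'a::real_normed_vector"
  shows "\<one>\<^bsub>fundamental_group X a\<^esub> = loop_class X a (linepath a a)"
  by (simp add: fundamental_group_def linepath_refl)

text \<open>The group laws control the inverses that occur in a generated subgroup.\<close>

lemma group_fundamental_group:
  fixes a :: "'a::real_normed_vector"
  assumes "a \<in> X"
  shows "group (fundamental_group X a)"
proof (rule groupI)
  have c: "linepath a a \<in> loops_at X a" using assms by (auto simp: loops_at_def)
  then show "\<one>\<^bsub>fundamental_group X a\<^esub> \<in> carrier (fundamental_group X a)"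
    by (simp add: one_fundamental_group carrier_fundamental_group)
  fix x assume "x \<in> carrier (fundamental_group X a)"
  then obtain p where p: "p \<in> loops_at X a" "x = loop_class X a p" by (auto simp: carrier_fundamental_group)
  note p' = loops_atD[OF p(1)]
  show "\<one>\<^bsub>fundamental_group X a\<^esub> \<otimes>\<^bsub>fundamental_group X a\<^esub> x = x"
    unfolding one_fundamental_group p(2) mult_loop_class[OF c p(1)]
    using p' by (intro loop_class_eq homotopic_paths_lid') auto
  have r: "reversepath p \<in> loops_at X a" using p' by (auto simp: loops_at_def)
  show "\<exists>y\<in>carrier (fundamental_group X a). y \<otimes>\<^bsub>fundamental_group X a\<^esub> x = \<one>\<^bsub>fundamental_group X a\<^esub>"
  proof
    show "loop_class X a (reversepath p) \<in> carrier (fundamental_group X a)"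
      using r by (simp add: carrier_fundamental_group)
    show "loop_class X a (reversepath p) \<otimes>\<^bsub>fundamental_group X a\<^esub> x = \<one>\<^bsub>fundamental_group X a\<^esub>"
      unfolding one_fundamental_group p(2) mult_loop_class[OF r p(1)]
      using p' homotopic_paths_linv[of p X] by (intro loop_class_eq) auto
  qed
  fix y assume "y \<in> carrier (fundamental_group X a)"
  then obtain q where q: "q \<in> loops_at X a" "y = loop_class X a q" by (auto simp: carrier_fundamental_group)
  show "x \<otimes>\<^bsub>fundamental_group X a\<^esub> y \<in> carrier (fundamental_group X a)"
    using p q by (simp add: mult_loop_class loops_at_join carrier_fundamental_group)
  fix z assume "z \<in> carrier (fundamental_group X a)"
  then obtain r where r: "r \<in> loops_at X a" "z = loop_class X a r" by (auto simp: carrier_fundamental_group)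
  have "loop_class X a ((p +++ q) +++ r) = loop_class X a (p +++ (q +++ r))"
    using loops_atD[OF p(1)] loops_atD[OF q(1)] loops_atD[OF r(1)]
    by (intro loop_class_eq homotopic_paths_sym[OF homotopic_paths_assoc]) auto
  then show "x \<otimes>\<^bsub>fundamental_group X a\<^esub> y \<otimes>\<^bsub>fundamental_group X a\<^esub> z =
      x \<otimes>\<^bsub>fundamental_group X a\<^esub> (y \<otimes>\<^bsub>fundamental_group X a\<^esub> z)"
    using p q r by (simp add: mult_loop_class loops_at_join)
qed

text \<open>Winding around a point outside \<open>X\<close> is a homomorphism on the fundamental group, so it vanishes on the
  subgroup generated by a set on which it vanishes.\<close>

lemma generate_winding_number_zero:
  assumes a: "a \<in> X" and w: "w \<notin> X" and A: "A \<subseteq> carrier (fundamental_group X a)"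
    and zero: "\<And>B q. B \<in> A \<Longrightarrow> q \<in> B \<Longrightarrow> winding_number q w = 0"
    and B: "B \<in> generate (fundamental_group X a) A"
  shows "B \<in> carrier (fundamental_group X a) \<and> (\<forall>q\<in>B. winding_number q w = 0)"
proof -
  interpret F: group "fundamental_group X a" using a by (rule group_fundamental_group)
  have hom: "winding_number q w = winding_number p w" if "homotopic_paths X p q" for p q
  proof (rule winding_number_homotopic_paths)
    have "X \<subseteq> - {w}" using w by auto
    then show "homotopic_paths (- {w}) q p"
      by (rule homotopic_paths_subset[OF homotopic_paths_sym[OF that]])
  qed
  have cls: "\<forall>q\<in>loop_class X a p. winding_number q w = winding_number p w" for p
    using hom unfolding loop_class_def by blast
  have join: "winding_number (p +++ q) w = winding_number p w + winding_number q w"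
    if "p \<in> loops_at X a" "q \<in> loops_at X a" for p q
    using loops_atD[OF that(1)] loops_atD[OF that(2)] w by (intro winding_number_join) auto
  have c: "linepath a a \<in> loops_at X a" using a by (auto simp: loops_at_def)
  have "w \<noteq> a" using a w by auto
  then have c0: "winding_number (linepath a a) w = 0" by simp
  show ?thesis using B
  proof (induction B rule: generate.induct)
    case one
    then show ?case using cls[of "linepath a a"] c0 F.one_closed by (simp add: one_fundamental_group)
  next
    case (incl h)
    then show ?case using A zero by blast
  next
    case (inv h)
    then have h: "h \<in> carrier (fundamental_group X a)" "\<And>q. q \<in> h \<Longrightarrow> winding_number q w = 0" using A zero by blast+
    then obtain p where p: "p \<in> loops_at X a" "h = loop_class X a p" by (auto simp: carrier_fundamental_group)
    have ih: "inv\<^bsub>fundamental_group X a\<^esub> h \<in> carrier (fundamental_group X a)" using h(1) by simp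
    then obtain q where q: "q \<in> loops_at X a" "inv\<^bsub>fundamental_group X a\<^esub> h = loop_class X a q"
      by (auto simp: carrier_fundamental_group)
    have "loop_class X a (q +++ p) = loop_class X a (linepath a a)"
      using F.l_inv[OF h(1)] p q by (simp add: mult_loop_class one_fundamental_group)
    then have "q +++ p \<in> loop_class X a (linepath a a)"
      using in_loop_class[OF loops_at_join[OF q(1) p(1)]] by simp
    then have "winding_number (q +++ p) w = 0" using cls[of "linepath a a"] c0 by auto
    moreover have "winding_number p w = 0" using h(2)[of p] p in_loop_class[OF p(1)] by simp
    ultimately have "winding_number q w = 0" using join[OF q(1) p(1)] by simp
    then show ?case using cls[of q] q(2) ih by auto
  next
    case (eng h1 h2)
    then obtain p q where pq: "p \<in> loops_at X a" "h1 = loop_class X a p" "q \<in> loops_at X a" "h2 = loop_class X a q"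
      by (auto simp: carrier_fundamental_group)
    moreover have "winding_number p w = 0" "winding_number q w = 0"
      using eng.IH in_loop_class[OF pq(1)] in_loop_class[OF pq(3)] pq(2,4) by blast+
    ultimately show ?case
      using F.m_closed[of h1 h2] eng.IH cls[of "p +++ q"] join[OF pq(1,3)] pq mult_loop_class[OF pq(1,3)] by auto
  qed
qed

text \<open>If \<open>X\<close> is unbounded then it contains every point outside the lattice that lies far enough from the
  origin, since this region is connected and contains no boundary point of \<open>X\<close>. Given finitely many loops,
  some lattice point \<open>w\<close> lies outside a disc that contains them, so they do not wind around it; but a small
  circle around \<open>w\<close>, joined to the base point, is a loop in \<open>X\<close> that does.\<close>

lemma finite_type_imp_bounded:
  assumes X: "X \<subseteq> - integer_lattice" "closedin (top_of_set (- integer_lattice)) X"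
    and bd: "compact (manifold_boundary X)" and fin: "finite_type X"
  shows "bounded X"
proof (rule ccontr)
  assume unb: "\<not> bounded X"
  obtain R where R: "R > 0" "manifold_boundary X \<subseteq> ball 0 R"
    using bd compact_imp_bounded bounded_subset_ballD[of "manifold_boundary X" 0] by blast
  define Q where "Q = - cball 0 R - integer_lattice"
  have Q: "path_connected Q"
  proof -
    have "connected (- cball (0::complex) R)"
      by (intro connected_complement_bounded_convex) auto
    then show ?thesis unfolding Q_def
      by (intro path_connected_open_diff_countable countable_integer_lattice) auto
  qed
  have "Q \<subseteq> X"
  proof -
    have "Q \<inter> X = Q \<inter> interior X"
      using R frontier_points_in_manifold_boundary interior_subset by (fastforce simp: Q_def)
    then have "openin (top_of_set Q) (Q \<inter> X)" by (metis open_interior openin_open_Int)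
    moreover have "closedin (top_of_set Q) (Q \<inter> X)"
    proof -
      obtain C where "closed C" "X = (- integer_lattice) \<inter> C" using X(2) by (auto simp: closedin_closed)
      then have "Q \<inter> X = Q \<inter> C" by (auto simp: Q_def)
      then show ?thesis using \<open>closed C\<close> by (simp add: closedin_closed_Int)
    qed
    ultimately have "Q \<inter> X = {} \<or> Q \<inter> X = Q"
      using path_connected_imp_connected[OF Q] by (auto simp: connected_clopen)
    moreover have "Q \<inter> X \<noteq> {}"
    proof
      assume "Q \<inter> X = {}"
      have "X \<subseteq> cball 0 R"
      proof
        fix x assume x: "x \<in> X"
        then have "x \<notin> integer_lattice" "x \<notin> Q" using X(1) \<open>Q \<inter> X = {}\<close> by auto
        then show "x \<in> cball 0 R" by (auto simp: Q_def)
      qed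
      then show False using unb bounded_subset bounded_cball by blast
    qed
    ultimately show ?thesis by blast
  qed
  have "\<not> X \<subseteq> cball 0 R" using unb bounded_subset bounded_cball by blast
  then obtain a where a': "a \<in> X" "a \<notin> cball 0 R" by blast
  then have a: "a \<in> Q" "a \<in> X" using X(1) by (auto simp: Q_def)
  interpret F: group "fundamental_group X a" using a(2) by (rule group_fundamental_group)
  obtain A where A: "finite A" "A \<subseteq> carrier (fundamental_group X a)"
      "generate (fundamental_group X a) A = carrier (fundamental_group X a)"
    using fin a(2) by (auto simp: finite_type_def finitely_generated_group_def)
  have "\<forall>B\<in>A. \<exists>q. q \<in> loops_at X a \<and> B = loop_class X a q" using A(2) by (auto simp: carrier_fundamental_group)
  then obtain q where q: "\<And>B. B \<in> A \<Longrightarrow> q B \<in> loops_at X a \<and> B = loop_class X a (q B)" by metis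
  have "bounded (\<Union>B\<in>A. path_image (q B))"
    using A(1) q by (intro bounded_UN) (auto simp: loops_at_def bounded_path_image)
  then obtain M where M: "(\<Union>B\<in>A. path_image (q B)) \<subseteq> ball 0 M"
    using bounded_subset_ballD[of _ "0::complex"] by blast
  obtain m :: nat where m: "real m > max M (R + 1)" using reals_Archimedean2 by blast
  \<comment> \<open>a lattice point beyond all generators and beyond the boundary of \<open>X\<close>\<close>
  define w :: complex where "w = of_nat m"
  have w: "w \<in> integer_lattice" "norm w = m" by (auto simp: w_def integer_lattice_def)
  then have wX: "w \<notin> X" using X(1) by auto
  have zero: "winding_number p w = 0" if "B \<in> A" "p \<in> B" for B p
  proof -
    have B: "B = loop_class X a (q B)" "q B \<in> loops_at X a" using q[OF that(1)] by auto
    then have "homotopic_paths X (q B) p" using that(2) in_loop_classD by blast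
    then have "homotopic_paths (- {w}) (q B) p" by (rule homotopic_paths_subset) (use wX in auto)
    then have "winding_number p w = winding_number (q B) w" by (simp add: winding_number_homotopic_paths)
    also have "\<dots> = 0"
      by (rule winding_number_zero_outside[of _ "ball 0 M"])
        (use loops_atD[OF B(2)] M that(1) m w in auto)
    finally show ?thesis .
  qed
  have circ: "path_image (circlepath w (1/2)) \<subseteq> Q"
  proof -
    have "z \<in> Q" if z: "z \<in> sphere w (1/2)" for z
    proof -
      have d: "norm (z - w) = 1/2" using z by (simp add: dist_norm norm_minus_commute)
      have "norm w - norm (z - w) \<le> norm z" using norm_triangle_ineq4[of z "z - w"] by simp
      then have "norm z > R" using d w(2) m by auto
      moreover have "z \<notin> integer_lattice"
      proof
        assume "z \<in> integer_lattice"
        then obtain i j :: int where ij: "Re (z - w) = of_int i" "Im (z - w) = of_int j"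
          using w(1) by (auto simp: integer_lattice_def elim!: Ints_cases) (metis Ints_cases Ints_diff Ints_of_int)
        have "(norm (z - w))\<^sup>2 = of_int (i\<^sup>2 + j\<^sup>2)" unfolding cmod_power2 ij by simp
        then have "(of_int (i\<^sup>2 + j\<^sup>2) :: real) = 1/4" by (simp add: d power2_eq_square)
        then have "(of_int (4 * (i\<^sup>2 + j\<^sup>2)) :: real) = of_int 1" by simp
        then have "4 * (i\<^sup>2 + j\<^sup>2) = 1" by (simp only: of_int_eq_iff)
        then show False by presburger
      qed
      ultimately show ?thesis by (simp add: Q_def)
    qed
    then show ?thesis by auto
  qed
  have "w + 1/2 \<in> Q"
    using circ pathstart_in_path_image[of "circlepath w (1/2)"] by auto
  then obtain g where g: "path g" "path_image g \<subseteq> Q" "pathstart g = a" "pathfinish g = w + 1/2"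
    using Q a(1) unfolding path_connected_def by blast
  define L where "L = g +++ (circlepath w (1/2) +++ reversepath g)"
  have L: "L \<in> loops_at X a"
    using g circ \<open>Q \<subseteq> X\<close> by (auto simp: L_def loops_at_def path_image_join)
  then have "loop_class X a L \<in> generate (fundamental_group X a) A"
    by (simp add: A(3) carrier_fundamental_group)
  then have "winding_number L w = 0"
    using generate_winding_number_zero[OF a(2) wX A(2)] zero in_loop_class[OF L] by blast
  moreover have "winding_number L w = 1"
  proof -
    have wg: "w \<notin> path_image g" "w \<notin> path_image (circlepath w (1/2))"
      using g(2) circ w(1) by (auto simp: Q_def)
    then have "winding_number L w = winding_number g w + (winding_number (circlepath w (1/2)) w + winding_number (reversepath g) w)"
      using g unfolding L_def
      by (subst winding_number_join; (subst winding_number_join)?) (auto simp: path_image_join)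
    then show ?thesis using g wg by (simp add: winding_number_reversepath winding_number_circlepath_centre)
  qed
  ultimately show False by simp
qed

section \<open>Translated copies of a bounded subsurface\<close>

abbreviation lattice_complement :: "complex set" where "lattice_complement \<equiv> UNIV - integer_lattice"

lemma open_lattice_complement: "open lattice_complement"
  using closed_integer_lattice by (simp add: open_Diff)

lemma connected_lattice_complement: "connected lattice_complement"
  by (intro path_connected_imp_connected path_connected_open_diff_countable countable_integer_lattice) auto

lemma integer_lattice_add: "p \<in> integer_lattice \<Longrightarrow> z + p \<in> integer_lattice \<longleftrightarrow> z \<in> integer_lattice"
  using Ints_diff[of "Re z + Re p" "Re p"] Ints_diff[of "Im z + Im p" "Im p"]
  by (auto simp: integer_lattice_def)

lemma manifold_boundary_open: "open Y \<Longrightarrow> manifold_boundary Y = {}"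
  by (auto simp: manifold_boundary_def manifold_interior_def
      intro!: exI[of _ Y] homeomorphic_refl openin_subtopology_self)

lemma continuous_on_locally:
  fixes f :: "'a::t2_space \<Rightarrow> 'b::topological_space"
  assumes "\<And>x. x \<in> A \<Longrightarrow> \<exists>U. open U \<and> x \<in> U \<and> continuous_on (A \<inter> U) f"
  shows "continuous_on A f"
  unfolding continuous_on_eq_continuous_within
proof
  fix x assume x: "x \<in> A"
  then obtain U where U: "open U" "x \<in> U" "continuous_on (A \<inter> U) f" using assms by blast
  then have "continuous (at x within (A \<inter> U)) f"
    using x by (simp add: continuous_on_eq_continuous_within)
  moreover have "at x within (A \<inter> U) = at x within A"
    by (rule at_within_nhd[of x U]) (use U in auto)
  ultimately show "continuous (at x within A) f" by simp
qed

text \<open>All homeomorphisms constructed below are the identity in a lower left quadrant. Since the plane without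
  the lattice is connected, this makes them preserve the orientation.\<close>

lemma Homeo_bd_lattice_complementI:
  assumes f: "continuous_on lattice_complement f" "f ` lattice_complement \<subseteq> lattice_complement" and g: "continuous_on lattice_complement g" "g ` lattice_complement \<subseteq> lattice_complement"
    and inv: "\<And>z. z \<in> lattice_complement \<Longrightarrow> g (f z) = z" "\<And>z. z \<in> lattice_complement \<Longrightarrow> f (g z) = z"
    and ext: "f \<in> extensional lattice_complement"
    and idf: "\<And>z. Re z < - real R - 1 \<Longrightarrow> Im z < - real R - 1 \<Longrightarrow> z \<in> lattice_complement \<Longrightarrow> f z = z"
  shows "f \<in> Homeo_bd lattice_complement"
proof -
  have h: "homeomorphism lattice_complement lattice_complement f g"
    using f g inv by (intro homeomorphismI) auto
  have inj: "inj_on f lattice_complement" using inv(1) by (rule inj_on_inverseI)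
  \<comment> \<open>a point between two columns of the lattice, with a disc around it in which \<open>f\<close> is the identity\<close>
  define z0 where "z0 = Complex (- real R - 3/2) (- real R - 3/2)"
  have near: "Re z < - real R - 1 \<and> Im z < - real R - 1 \<and> z \<in> lattice_complement" if "z \<in> cball z0 (1/4)" for z
  proof -
    have "norm (z - z0) \<le> 1/4" using that by (simp add: dist_norm norm_minus_commute)
    then have "\<bar>Re (z - z0)\<bar> \<le> 1/4" "\<bar>Im (z - z0)\<bar> \<le> 1/4"
      using abs_Re_le_cmod[of "z - z0"] abs_Im_le_cmod[of "z - z0"] by linarith+
    moreover have e: "Re (z - z0) = Re z + real R + 3/2" "Im (z - z0) = Im z + real R + 3/2"
      by (simp_all add: z0_def)
    ultimately have b: "\<bar>Re z + real R + 3/2\<bar> \<le> 1/4" "\<bar>Im z + real R + 3/2\<bar> \<le> 1/4"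
      by (simp_all only: e)
    have "Re z \<notin> \<int>"
    proof
      assume "Re z \<in> \<int>"
      then obtain n :: int where "Re z = of_int n" by (auto elim: Ints_cases)
      with b(1) have "-2 < real_of_int n + real R" "real_of_int n + real R < -1" by linarith+
      then have "of_int (-2) < (of_int (n + int R) :: real)" "(of_int (n + int R) :: real) < of_int (-1)" by simp_all
      then have "-2 < n + int R" "n + int R < -1" unfolding of_int_less_iff by simp_all
      then show False by linarith
    qed
    then have "z \<in> lattice_complement" by (simp add: integer_lattice_def)
    moreover have "Re z < - real R - 1" "Im z < - real R - 1" using b by linarith+
    ultimately show ?thesis by blast
  qed
  have "winding_number (f \<circ> circlepath z0 (1/4)) (f z0) = winding_number (circlepath z0 (1/4)) z0"
  proof -
    have "f z0 = z0" using near[of z0] idf by auto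
    moreover have "winding_number (f \<circ> circlepath z0 (1/4)) z0 = winding_number (circlepath z0 (1/4)) z0"
    proof (rule winding_number_cong)
      fix t :: real assume "0 \<le> t" "t \<le> 1"
      then have "circlepath z0 (1/4) t \<in> cball z0 (1/4)" by (intro circlepath_in_cball) auto
      then show "(f \<circ> circlepath z0 (1/4)) t = circlepath z0 (1/4) t"
        using near idf by auto
    qed
    ultimately show ?thesis by simp
  qed
  then have "winding_number (f \<circ> circlepath z0 (1/4)) (f z0) = 1"
    by (simp add: winding_number_circlepath_centre)
  then have "orientation_preserving_on lattice_complement f"
    using near
    by (intro orientation_preserving_connected[OF open_lattice_complement connected_lattice_complement f(1) inj, of "1/4" z0]) auto
  then show ?thesis
    using h ext manifold_boundary_open[OF open_lattice_complement] by (auto simp: Homeo_bd_def)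
qed

locale bounded_subsurface =
  fixes X :: "complex set" and R :: nat
  assumes XS: "X \<subseteq> lattice_complement" and closedX: "closedin (top_of_set lattice_complement) X" and XR: "X \<subseteq> cball 0 (real R)"
begin

text \<open>Admissible sets of positions for copies of \<open>X\<close>. The distance leaves a gap of width \<open>2\<close> between the discs
  of radius \<open>R\<close> that contain the copies, so that a disc of radius \<open>1/2\<close> meets at most one of them. The
  restriction to a quadrant keeps the opposite quadrant free of copies.\<close>

definition spread :: "complex set \<Rightarrow> bool" where
  "spread P \<longleftrightarrow> P \<subseteq> {p \<in> integer_lattice. 0 \<le> Re p \<and> 0 \<le> Im p} \<and>
     (\<forall>p\<in>P. \<forall>q\<in>P. p \<noteq> q \<longrightarrow> 2 * real R + 2 \<le> dist p q)"

text \<open>Simultaneous action of \<open>f\<close> on all copies \<open>X + p\<close>. For a \<open>spread\<close> set \<open>P\<close> the copies are disjoint, and the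
  choice of \<open>p\<close> is unique.\<close>

definition place :: "complex set \<Rightarrow> (complex \<Rightarrow> complex) \<Rightarrow> complex \<Rightarrow> complex" where
  "place P f = (\<lambda>z\<in>lattice_complement. if \<exists>p\<in>P. z - p \<in> X then (let p = SOME p. p \<in> P \<and> z - p \<in> X in f (z - p) + p) else z)"

lemma spreadD: "spread P \<Longrightarrow> p \<in> P \<Longrightarrow> p \<in> integer_lattice"
  by (auto simp: spread_def)

lemma spread_subset: "spread Q \<Longrightarrow> P \<subseteq> Q \<Longrightarrow> spread P"
  by (auto simp: spread_def)

lemma spread_unique:
  assumes "spread P" "p \<in> P" "q \<in> P" "norm (z - p) \<le> real R + 1/2" "norm (z - q) \<le> real R + 1/2"
  shows "p = q"
proof (rule ccontr)
  assume "p \<noteq> q"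
  then have "2 * real R + 2 \<le> dist p q" using assms by (simp add: spread_def)
  also have "dist p q \<le> norm (z - q) + norm (z - p)"
    using norm_triangle_ineq4[of "z - q" "z - p"] by (simp add: dist_norm)
  finally show False using assms by simp
qed

lemma normX: "x \<in> X \<Longrightarrow> norm x \<le> real R"
  using XR by auto

lemma place_copy:
  assumes P: "spread P" "p \<in> P" and x: "x \<in> X"
  shows "place P f (x + p) = f x + p"
proof -
  have S: "x + p \<in> lattice_complement" using XS x integer_lattice_add[OF spreadD[OF P], of x] by auto
  have "(SOME q. q \<in> P \<and> x + p - q \<in> X) = p"
  proof (rule some_equality)
    fix q assume "q \<in> P \<and> x + p - q \<in> X"
    then show "q = p"
      using normX[of "x + p - q"] normX[OF x] P
      by (intro spread_unique[OF P(1), of q p "x + p"]) auto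
  qed (use P x in auto)
  moreover have "\<exists>q\<in>P. x + p - q \<in> X" using P x by (intro bexI[of _ p]) auto
  ultimately show ?thesis using S by (simp add: place_def)
qed

lemma place_outside: "z \<in> lattice_complement \<Longrightarrow> (\<And>p. p \<in> P \<Longrightarrow> z - p \<notin> X) \<Longrightarrow> place P f z = z"
  by (auto simp: place_def)

lemma place_cases:
  assumes "spread P" "z \<in> lattice_complement"
  obtains p x where "p \<in> P" "x \<in> X" "z = x + p" "\<And>f. place P f z = f x + p"
  | "\<And>p. p \<in> P \<Longrightarrow> z - p \<notin> X" "\<And>f. place P f z = z"
proof (cases "\<exists>p\<in>P. z - p \<in> X")
  case True
  then obtain p where p: "p \<in> P" "z - p \<in> X" by blast
  then show ?thesis using place_copy[OF assms(1) p] that(1)[of p "z - p"] by simp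
next
  case False
  then show ?thesis using that(2) place_outside[OF assms(2)] by blast
qed

lemma add_in_lattice_complement: "spread P \<Longrightarrow> p \<in> P \<Longrightarrow> x \<in> X \<Longrightarrow> x + p \<in> lattice_complement"
  using XS integer_lattice_add[OF spreadD, of P p x] by auto

lemma place_in_lattice_complement:
  assumes "spread P" "f ` X \<subseteq> X" "z \<in> lattice_complement"
  shows "place P f z \<in> lattice_complement"
  by (rule place_cases[OF assms(1,3)]) (use assms add_in_lattice_complement in auto)

lemma place_compose:
  assumes "spread P" "g ` X \<subseteq> X"
  shows "place P (compose X f g) = compose lattice_complement (place P f) (place P g)"
proof
  fix z
  show "place P (compose X f g) z = compose lattice_complement (place P f) (place P g) z"
  proof (cases "z \<in> lattice_complement")
    case True
    show ?thesis
    proof (rule place_cases[OF assms(1) True])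
      fix p x assume "p \<in> P" "x \<in> X" "z = x + p" "\<And>f. place P f z = f x + p"
      moreover from this have "g x \<in> X" using assms(2) by auto
      ultimately show ?thesis using True place_copy[OF assms(1), of p "g x" f] by (simp add: compose_def)
    qed (use True in \<open>auto simp: compose_def\<close>)
  qed (auto simp: compose_def place_def)
qed

lemma place_ident:
  assumes "spread P"
  shows "place P (\<lambda>z\<in>X. z) = (\<lambda>z\<in>lattice_complement. z)"
proof
  fix z
  show "place P (\<lambda>z\<in>X. z) z = (\<lambda>z\<in>lattice_complement. z) z"
  proof (cases "z \<in> lattice_complement")
    case True
    show ?thesis by (rule place_cases[OF assms True]) (use True in auto)
  qed (auto simp: place_def)
qed

lemma place_Un:
  assumes "spread (P \<union> Q)" "P \<inter> Q = {}" "f ` X \<subseteq> X"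
  shows "place (P \<union> Q) f = compose lattice_complement (place P f) (place Q f)"
proof
  fix z
  have P: "spread P" and Q: "spread Q" using assms(1) by (auto intro: spread_subset)
  show "place (P \<union> Q) f z = compose lattice_complement (place P f) (place Q f) z"
  proof (cases "z \<in> lattice_complement")
    case True
    show ?thesis
    proof (rule place_cases[OF assms(1) True])
      fix p x assume p: "p \<in> P \<union> Q" "x \<in> X" "z = x + p" "\<And>f. place (P \<union> Q) f z = f x + p"
      have fx: "f x \<in> X" using assms(3) p by auto
      have *: "y + p - q \<notin> X" if "q \<in> P \<union> Q" "q \<noteq> p" "y \<in> X" for q y
        using spread_unique[OF assms(1) p(1) that(1), of "y + p"] normX[OF that(3)] normX[of "y + p - q"] that(2)
        by auto
      have in_S: "y + p \<in> lattice_complement" if "y \<in> X" for y using add_in_lattice_complement[OF assms(1) p(1) that] .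
      show ?thesis
      proof (cases "p \<in> Q")
        case pQ: True
        then have "place Q f z = f x + p" using p(2,3) place_copy[OF Q] by simp
        moreover have "place P f (f x + p) = f x + p"
          using pQ assms(2) *[OF _ _ fx] by (intro place_outside in_S[OF fx]) auto
        ultimately show ?thesis using True p(4) by (simp add: compose_def)
      next
        case False
        then have pP: "p \<in> P" using p by auto
        then have "place Q f z = z"
          using False *[OF _ _ p(2)] p(3) by (intro place_outside True) auto
        moreover have "place P f z = f x + p" using pP p(2,3) place_copy[OF P] by simp
        ultimately show ?thesis using True p(4) by (simp add: compose_def)
      qed
    next
      assume "\<And>p. p \<in> P \<union> Q \<Longrightarrow> z - p \<notin> X" "\<And>f. place (P \<union> Q) f z = z"
      then show ?thesis using True by (simp add: compose_def place_outside)
    qed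
  qed (auto simp: compose_def place_def)
qed

text \<open>A homeomorphism that translates each copy of \<open>X\<close> to another copy conjugates the actions on the copies.
  All the relations needed for the swindle are instances: commutation with homeomorphisms that fix the
  copies pointwise (\<open>\<rho>\<close> the identity) as well as the shift of a row.\<close>

lemma place_conj:
  assumes P: "spread P" and Q: "spread (\<rho> ` P)" and f: "f ` X \<subseteq> X"
    and s: "s ` lattice_complement \<subseteq> lattice_complement" "inj_on s lattice_complement" and move: "\<And>p x. p \<in> P \<Longrightarrow> x \<in> X \<Longrightarrow> s (x + p) = x + \<rho> p"
  shows "compose lattice_complement s (place P f) = compose lattice_complement (place (\<rho> ` P) f) s"
proof
  fix z
  show "compose lattice_complement s (place P f) z = compose lattice_complement (place (\<rho> ` P) f) s z"
  proof (cases "z \<in> lattice_complement")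
    case True
    show ?thesis
    proof (rule place_cases[OF P True])
      fix p x assume p: "p \<in> P" "x \<in> X" "z = x + p" "\<And>f. place P f z = f x + p"
      then have "f x \<in> X" using f by auto
      then show ?thesis
        using True p move place_copy[OF Q, of "\<rho> p" x f] by (simp add: compose_def)
    next
      assume z: "\<And>p. p \<in> P \<Longrightarrow> z - p \<notin> X" "\<And>f. place P f z = z"
      have "s z - \<rho> p \<notin> X" if p: "p \<in> P" for p
      proof
        assume x: "s z - \<rho> p \<in> X"
        have "s ((s z - \<rho> p) + p) = s z" using move[OF p x] by simp
        then have "(s z - \<rho> p) + p = z"
          using s(2) True add_in_lattice_complement[OF P p x] by (auto simp: inj_on_def)
        then have "z - p = s z - \<rho> p" by (metis add_diff_cancel_right')
        then show False using z(1)[OF p] x by simp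
      qed
      moreover have "s z \<in> lattice_complement" using s(1) True by auto
      ultimately show ?thesis using True z(2) by (auto simp: compose_def intro: place_outside[symmetric])
    qed
  qed (auto simp: compose_def)
qed

text \<open>Pasting along the frontier of the copy, on which \<open>h t\<close> is the identity.\<close>

lemma continuous_on_single_copy:
  fixes T :: "'t::t2_space set"
  assumes h: "continuous_on (T \<times> X) (\<lambda>(t, x). h t x)"
    and fix_bd: "\<And>t x. t \<in> T \<Longrightarrow> x \<in> X - interior X \<Longrightarrow> h t x = x" and p: "p \<in> integer_lattice"
  shows "continuous_on (T \<times> lattice_complement) (\<lambda>(t, z). if z - p \<in> X then h t (z - p) + p else z)"
proof -
  let ?A = "{z \<in> lattice_complement. z - p \<in> X}" and ?B = "{z \<in> lattice_complement. z - p \<notin> interior X}"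
  obtain C where C: "closed C" "X = lattice_complement \<inter> C" using closedX by (auto simp: closedin_closed)
  have shift: "z - p \<in> lattice_complement \<longleftrightarrow> z \<in> lattice_complement" for z using integer_lattice_add[OF p, of "z - p"] by simp
  have "?A = lattice_complement \<inter> (\<lambda>z. z - p) -` C" using C(2) shift by auto
  moreover have "closed ((\<lambda>z. z - p) -` C)" using C(1) by (intro closed_vimage continuous_intros)
  ultimately have A: "closedin (top_of_set lattice_complement) ?A" by (simp add: closedin_closed_Int)
  have "?B = lattice_complement \<inter> (\<lambda>z. z - p) -` (- interior X)" by auto
  moreover have "closed ((\<lambda>z. z - p) -` (- interior X))" by (intro closed_vimage continuous_intros) auto
  ultimately have B: "closedin (top_of_set lattice_complement) ?B" by (simp add: closedin_closed_Int)
  have AB: "T \<times> ?A \<union> T \<times> ?B = T \<times> lattice_complement" using interior_subset by auto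
  have cA: "closedin (top_of_set (T \<times> ?A \<union> T \<times> ?B)) (T \<times> ?A)"
    "closedin (top_of_set (T \<times> ?A \<union> T \<times> ?B)) (T \<times> ?B)"
    unfolding AB using A B by (auto intro: closedin_Times)
  have "continuous_on (T \<times> ?A \<union> T \<times> ?B) (\<lambda>y. if snd y - p \<in> X then h (fst y) (snd y - p) + p else snd y)"
  proof (rule continuous_on_cases_local[OF cA])
    have "continuous_on (T \<times> ?A) (\<lambda>y. (\<lambda>(t, x). h t x) (fst y, snd y - p) + p)"
      by (intro continuous_intros continuous_on_compose2[OF h]) auto
    then show "continuous_on (T \<times> ?A) (\<lambda>y. h (fst y) (snd y - p) + p)" by simp
    show "continuous_on (T \<times> ?B) snd" by (intro continuous_intros)
    fix y assume "y \<in> T \<times> ?A \<and> \<not> snd y - p \<in> X \<or> y \<in> T \<times> ?B \<and> snd y - p \<in> X"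
    then have "fst y \<in> T" "snd y - p \<in> X - interior X" by auto
    then show "h (fst y) (snd y - p) + p = snd y" using fix_bd by simp
  qed
  then show ?thesis unfolding AB by (simp add: case_prod_unfold)
qed

text \<open>The copies are locally finite, so near each point at most one of them matters. The parameter \<open>t\<close> makes
  the lemma apply to isotopies too.\<close>

lemma continuous_on_place:
  fixes T :: "'t::t2_space set"
  assumes P: "spread P" and h: "continuous_on (T \<times> X) (\<lambda>(t, x). h t x)"
    and fix_bd: "\<And>t x. t \<in> T \<Longrightarrow> x \<in> X - interior X \<Longrightarrow> h t x = x"
  shows "continuous_on (T \<times> lattice_complement) (\<lambda>(t, z). place P (h t) z)"
proof (rule continuous_on_locally)
  fix y assume y: "y \<in> T \<times> lattice_complement"
  let ?U = "UNIV \<times> ball (snd y) (1/2)"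
  have "continuous_on (T \<times> lattice_complement \<inter> ?U) (\<lambda>(t, z). place P (h t) z)"
  proof (cases "\<exists>p\<in>P. norm (snd y - p) \<le> real R + 1/2")
    case True
    then obtain p where p: "p \<in> P" "norm (snd y - p) \<le> real R + 1/2" by blast
    have "continuous_on (T \<times> lattice_complement \<inter> ?U) (\<lambda>(t, z). if z - p \<in> X then h t (z - p) + p else z)"
      by (rule continuous_on_subset[OF continuous_on_single_copy[OF h fix_bd spreadD[OF P p(1)]]]) auto
    then show ?thesis
    proof (rule continuous_on_eq)
      fix u assume u: "u \<in> T \<times> lattice_complement \<inter> ?U"
      obtain t z where tz: "u = (t, z)" by (cases u)
      have z: "z \<in> lattice_complement" "norm (snd y - z) < 1/2" using u tz by (auto simp: dist_norm)
      show "(case u of (t, z) \<Rightarrow> if z - p \<in> X then h t (z - p) + p else z) = (case u of (t, z) \<Rightarrow> place P (h t) z)"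
      proof (rule place_cases[OF P z(1)])
        fix q x assume q: "q \<in> P" "x \<in> X" "z = x + q" "\<And>f. place P f z = f x + q"
        have "norm (snd y - q) \<le> norm (snd y - z) + norm x"
          using norm_triangle_ineq[of "snd y - z" x] q(3) by (simp add: algebra_simps)
        then have "norm (snd y - q) \<le> real R + 1/2" using z(2) normX[OF q(2)] by simp
        then have "q = p" by (intro spread_unique[OF P q(1) p(1) _ p(2)])
        then show ?thesis using q tz by simp
      next
        assume "\<And>p. p \<in> P \<Longrightarrow> z - p \<notin> X" "\<And>f. place P f z = z"
        then show ?thesis using tz p by simp
      qed
    qed
  next
    case False
    have "continuous_on (T \<times> lattice_complement \<inter> ?U) snd" by (intro continuous_intros)
    then show ?thesis
    proof (rule continuous_on_eq)
      fix u assume u: "u \<in> T \<times> lattice_complement \<inter> ?U"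
      obtain t z where tz: "u = (t, z)" by (cases u)
      have z: "z \<in> lattice_complement" "norm (snd y - z) < 1/2" using u tz by (auto simp: dist_norm)
      have "place P (h t) z = z"
      proof (rule place_outside[OF z(1)])
        fix q assume q: "q \<in> P"
        show "z - q \<notin> X"
        proof
          assume "z - q \<in> X"
          then have "norm (z - q) \<le> real R" by (rule normX)
          moreover have "norm (snd y - q) \<le> norm (snd y - z) + norm (z - q)"
            using norm_triangle_ineq[of "snd y - z" "z - q"] by simp
          ultimately show False using z(2) False q by force
        qed
      qed
      then show "snd u = (case u of (t, z) \<Rightarrow> place P (h t) z)" using tz by simp
    qed
  qed
  moreover have "open ?U" "y \<in> ?U" by (auto intro: open_Times simp: mem_Times_iff)
  ultimately show "\<exists>U. open U \<and> y \<in> U \<and> continuous_on (T \<times> lattice_complement \<inter> U) (\<lambda>(t, z). place P (h t) z)" by blast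
qed

lemma Homeo_bd_fixes: "f \<in> Homeo_bd X \<Longrightarrow> x \<in> X - interior X \<Longrightarrow> f x = x"
  using Homeo_bd_props(6) frontier_points_in_manifold_boundary by blast

lemma continuous_on_place_single:
  assumes "spread P" "f \<in> Homeo_bd X"
  shows "continuous_on lattice_complement (place P f)"
proof -
  have "continuous_on ({0::real} \<times> X) (\<lambda>(t, x). f x)"
    using Homeo_bd_props(1)[OF assms(2)]
    by (auto simp: case_prod_unfold intro!: continuous_on_compose2[of X f] continuous_intros)
  then have "continuous_on ({0::real} \<times> lattice_complement) (\<lambda>(t, z). place P f z)"
    using Homeo_bd_fixes[OF assms(2)] by (intro continuous_on_place[OF assms(1)]) auto
  then have "continuous_on lattice_complement (\<lambda>z. (\<lambda>(t, z). place P f z) (0::real, z))"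
    by (rule continuous_on_compose2) (auto intro!: continuous_intros)
  then show ?thesis by simp
qed

lemma place_in_Homeo_bd:
  assumes P: "spread P" and f: "f \<in> Homeo_bd X"
  shows "place P f \<in> Homeo_bd lattice_complement"
proof -
  obtain g where g: "g \<in> Homeo_bd X" "compose X g f = (\<lambda>z\<in>X. z)" "compose X f g = (\<lambda>z\<in>X. z)"
    using inverse_in_Homeo_bd[OF f] by metis
  have fX: "f ` X \<subseteq> X" "g ` X \<subseteq> X" using Homeo_bd_props(2) f g(1) by auto
  have fg: "compose lattice_complement (place P f) (place P g) = (\<lambda>z\<in>lattice_complement. z)" "compose lattice_complement (place P g) (place P f) = (\<lambda>z\<in>lattice_complement. z)"
    using place_compose[OF P fX(2), of f] place_compose[OF P fX(1), of g] g place_ident[OF P] by simp_all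
  show ?thesis
  proof (rule Homeo_bd_lattice_complementI)
    show "place P g (place P f z) = z" "place P f (place P g z) = z" if "z \<in> lattice_complement" for z
      using fun_cong[OF fg(1), of z] fun_cong[OF fg(2), of z] that by (simp_all add: compose_def)
    show "place P f \<in> extensional lattice_complement" by (simp add: place_def)
    show "place P f z = z" if z: "Re z < - real R - 1" "z \<in> lattice_complement" for z
    proof (rule place_outside[OF z(2)])
      fix p assume "p \<in> P"
      then have "0 \<le> Re p" using P by (auto simp: spread_def)
      then have "\<bar>Re (z - p)\<bar> > real R" using z by simp
      then have "norm (z - p) > real R" using abs_Re_le_cmod[of "z - p"] by linarith
      then show "z - p \<notin> X" using normX[of "z - p"] by auto
    qed
  qed (use continuous_on_place_single[OF P] place_in_lattice_complement[OF P] fX f g in auto)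
qed

lemma place_isotopic:
  assumes P: "spread P" and "isotopic_in X f f'"
  shows "isotopic_in lattice_complement (place P f) (place P f')"
proof -
  obtain h where h: "continuous_on ({0..1} \<times> X) (\<lambda>(t, x). h t x)" "h 0 = f" "h 1 = f'"
      "\<And>t. t \<in> {0..1::real} \<Longrightarrow> h t \<in> Homeo_bd X"
    using assms(2) by (auto simp: isotopic_in_iff)
  have "continuous_on ({0..1} \<times> lattice_complement) (\<lambda>(t, z). place P (h t) z)"
    using Homeo_bd_fixes[OF h(4)] by (intro continuous_on_place[OF P h(1)]) auto
  then show ?thesis
    unfolding isotopic_in_iff
    by (intro exI[of _ "\<lambda>t. place P (h t)"]) (use h place_in_Homeo_bd[OF P] in auto)
qed

lemma place_origin: "place {0} f = extend_by_id X lattice_complement f"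
proof -
  have "spread {0}" by (auto simp: spread_def integer_lattice_def)
  note copy = place_copy[OF this, of 0 _ f]
  show ?thesis
  proof
    fix z
    consider "z \<in> X" | "z \<in> lattice_complement - X" | "z \<notin> lattice_complement" by blast
    then show "place {0} f z = extend_by_id X lattice_complement f z"
    proof cases
      case 1
      then have "z \<in> lattice_complement" using XS by blast
      with 1 show ?thesis using copy[of z] by (simp add: extend_by_id_def)
    next
      case 2
      then show ?thesis using place_outside[of z "{0}" f] by (simp add: extend_by_id_def)
    qed (auto simp: place_def extend_by_id_def)
  qed
qed

end

section \<open>Shears that shift a row of copies\<close>

text \<open>Both the map and its inverse \<open>z \<mapsto> z - \<delta> z\<close> preserve the lattice, as \<open>\<delta>\<close> takes lattice points to lattice
  points.\<close>

lemma displacement_in_Homeo_bd: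
  assumes c: "continuous_on UNIV \<delta>" and inv: "\<And>z. \<delta> (z + \<delta> z) = \<delta> z" "\<And>z. \<delta> (z - \<delta> z) = \<delta> z"
    and lat: "\<And>z. z \<in> integer_lattice \<Longrightarrow> \<delta> z \<in> integer_lattice"
    and zero: "\<And>z. Re z < - real R - 1 \<Longrightarrow> Im z < - real R - 1 \<Longrightarrow> \<delta> z = 0"
  shows "(\<lambda>z\<in>lattice_complement. z + \<delta> z) \<in> Homeo_bd lattice_complement"
proof (rule Homeo_bd_lattice_complementI)
  have c': "continuous_on A \<delta>" for A using c by (rule continuous_on_subset) auto
  have S: "z + \<delta> z \<in> lattice_complement \<and> z - \<delta> z \<in> lattice_complement" if z: "z \<in> lattice_complement" for z
  proof -
    have "z + \<delta> z \<notin> integer_lattice"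
    proof
      assume l: "z + \<delta> z \<in> integer_lattice"
      then have "\<delta> z \<in> integer_lattice" using lat[OF l] inv(1) by simp
      with l z show False using integer_lattice_add by auto
    qed
    moreover have "z - \<delta> z \<notin> integer_lattice"
    proof
      assume l: "z - \<delta> z \<in> integer_lattice"
      then have "\<delta> z \<in> integer_lattice" using lat[OF l] inv(2) by simp
      with l z show False using integer_lattice_add[of "\<delta> z" "z - \<delta> z"] by auto
    qed
    ultimately show ?thesis by blast
  qed
  show "continuous_on lattice_complement (\<lambda>z\<in>lattice_complement. z + \<delta> z)"
    by (rule continuous_on_eq[of _ "\<lambda>z. z + \<delta> z"]) (auto intro!: continuous_intros c')
  show "continuous_on lattice_complement (\<lambda>z. z - \<delta> z)" by (intro continuous_intros c')
  show "(\<lambda>z\<in>lattice_complement. z + \<delta> z) ` lattice_complement \<subseteq> lattice_complement" "(\<lambda>z. z - \<delta> z) ` lattice_complement \<subseteq> lattice_complement"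
    using S by (auto simp: image_subset_iff)
  show "(\<lambda>z\<in>lattice_complement. z + \<delta> z) z - \<delta> ((\<lambda>z\<in>lattice_complement. z + \<delta> z) z) = z" if "z \<in> lattice_complement" for z
    using that inv by simp
  show "(\<lambda>z\<in>lattice_complement. z + \<delta> z) (z - \<delta> z) = z" if "z \<in> lattice_complement" for z
    using S[OF that] inv by simp
  show "(\<lambda>z\<in>lattice_complement. z + \<delta> z) z = z" if "Re z < - real R - 1" "Im z < - real R - 1" "z \<in> lattice_complement" for z
    using that zero by simp
qed auto

context bounded_subsurface
begin

text \<open>A cut-off function, equal to \<open>1\<close> up to distance \<open>R\<close> from \<open>0\<close> and to \<open>0\<close> from distance \<open>R + 1\<close> on. As \<open>R\<close>
  is an integer it takes integral values at integers, so that the shears built from it preserve the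
  lattice.\<close>

definition bump :: "real \<Rightarrow> real" where
  "bump t = max 0 (min 1 (real R + 1 - \<bar>t\<bar>))"

lemma bump_one: "\<bar>t\<bar> \<le> real R \<Longrightarrow> bump t = 1"
  by (simp add: bump_def)

lemma bump_zero: "real R + 1 \<le> \<bar>t\<bar> \<Longrightarrow> bump t = 0"
  by (simp add: bump_def)

lemma bump_Ints: "t \<in> \<int> \<Longrightarrow> bump t \<in> \<int>"
proof -
  assume "t \<in> \<int>"
  then obtain n :: int where n: "t = of_int n" by (auto elim: Ints_cases)
  have "\<bar>n\<bar> \<le> int R \<or> int R + 1 \<le> \<bar>n\<bar>" by linarith
  then have "real_of_int \<bar>n\<bar> \<le> real_of_int (int R) \<or> real_of_int (int R + 1) \<le> real_of_int \<bar>n\<bar>"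
    by (simp only: of_int_le_iff)
  then have "\<bar>t\<bar> \<le> real R \<or> real R + 1 \<le> \<bar>t\<bar>" using n by simp
  then show ?thesis using bump_one bump_zero by auto
qed

lemma continuous_on_bump [continuous_intros]: "continuous_on A f \<Longrightarrow> continuous_on A (\<lambda>x. bump (f x))"
  unfolding bump_def by (intro continuous_intros)

text \<open>Wide enough that positions on the grid of this mesh are \<open>spread\<close> and that a shear supported within
  \<open>R + 1\<close> of one row or column fixes the copies in all the others.\<close>

definition step :: nat where "step = 2 * R + 3"

definition pos :: "nat \<Rightarrow> nat \<Rightarrow> complex" where
  "pos m l = Complex (real (step * m)) (real (step * l))"

definition hshear :: "nat \<Rightarrow> complex \<Rightarrow> complex" where
  "hshear l = (\<lambda>z\<in>lattice_complement. z + of_real (real step * bump (Im z - real (step * l))))"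

definition vshear :: "nat \<Rightarrow> complex \<Rightarrow> complex" where
  "vshear l = (\<lambda>z\<in>lattice_complement. z + \<i> * of_real (real (step * l) * bump (Re z)))"

lemma hshear_in_Homeo_bd: "hshear l \<in> Homeo_bd lattice_complement"
  unfolding hshear_def
proof (rule displacement_in_Homeo_bd[where R = R])
  show "continuous_on UNIV (\<lambda>z. of_real (real step * bump (Im z - real (step * l))) :: complex)"
    by (intro continuous_intros)
  show "of_real (real step * bump (Im z - real (step * l))) \<in> integer_lattice" if "z \<in> integer_lattice" for z
    using that by (auto simp: integer_lattice_def intro!: Ints_mult bump_Ints Ints_diff)
  show "of_real (real step * bump (Im z - real (step * l))) = (0::complex)"
    if "Re z < - real R - 1" "Im z < - real R - 1" for z
  proof -
    have "0 \<le> real (step * l)" by simp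
    then have "bump (Im z - real (step * l)) = 0" using that by (intro bump_zero) linarith
    then show ?thesis by simp
  qed
qed simp_all

lemma vshear_in_Homeo_bd: "vshear l \<in> Homeo_bd lattice_complement"
  unfolding vshear_def
proof (rule displacement_in_Homeo_bd[where R = R])
  show "continuous_on UNIV (\<lambda>z. \<i> * of_real (real (step * l) * bump (Re z)) :: complex)"
    by (intro continuous_intros)
  show "\<i> * of_real (real (step * l) * bump (Re z)) \<in> integer_lattice" if "z \<in> integer_lattice" for z
    using that by (auto simp: integer_lattice_def intro!: Ints_mult bump_Ints Ints_diff)
  show "\<i> * of_real (real (step * l) * bump (Re z)) = (0::complex)"
    if "Re z < - real R - 1" "Im z < - real R - 1" for z
  proof -
    have "bump (Re z) = 0" using that by (intro bump_zero) linarith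
    then show ?thesis by simp
  qed
qed simp_all

text \<open>Row and column \<open>0\<close> contain no position of any row: the original copy sits at their intersection, and
  column \<open>0\<close> is the path along which it is moved to the beginning of a row.\<close>

definition row :: "nat \<Rightarrow> complex set" where
  "row l = (\<lambda>m. pos (Suc m) (Suc l)) ` UNIV"

lemma step_dist: "m \<noteq> m' \<Longrightarrow> real step \<le> \<bar>real (step * m) - real (step * m')\<bar>"
proof -
  assume "m \<noteq> m'"
  then have "1 \<le> \<bar>real m - real m'\<bar>" by linarith
  then have "real step * 1 \<le> real step * \<bar>real m - real m'\<bar>" by (rule mult_left_mono) simp
  also have "\<dots> = \<bar>real (step * m) - real (step * m')\<bar>"
    by (simp add: right_diff_distrib[symmetric] abs_mult)
  finally show ?thesis by simp
qed

lemma pos_inject: "pos m l = pos m' l' \<longleftrightarrow> m = m' \<and> l = l'"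
  by (auto simp: pos_def step_def)

lemma spread_pos: "spread (range (\<lambda>(m, l). pos m l))"
proof -
  have "2 * real R + 2 \<le> dist (pos m l) (pos m' l')" if "pos m l \<noteq> pos m' l'" for m l m' l'
  proof -
    have "m \<noteq> m' \<or> l \<noteq> l'" using that by auto
    then have "real step \<le> \<bar>Re (pos m l - pos m' l')\<bar> \<or> real step \<le> \<bar>Im (pos m l - pos m' l')\<bar>"
      using step_dist by (auto simp: pos_def)
    then have "real step \<le> norm (pos m l - pos m' l')"
      using abs_Re_le_cmod abs_Im_le_cmod order_trans by blast
    then show ?thesis by (simp add: dist_norm step_def)
  qed
  then show ?thesis
    by (auto simp: spread_def integer_lattice_def pos_def)
qed

lemma zero_eq_pos: "0 = pos 0 0"
  by (simp add: pos_def complex_eq_iff)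

lemma spread_of_pos: "(\<And>p. p \<in> P \<Longrightarrow> \<exists>m l. p = pos m l) \<Longrightarrow> spread P"
  by (rule spread_subset[OF spread_pos]) force

lemma spread_row: "spread (row l)" "spread {0}" "spread (insert 0 (row l))" "spread (row l \<union> row k)"
  by (rule spread_of_pos; auto simp: row_def zero_eq_pos)+

lemma Re_Im_X: "x \<in> X \<Longrightarrow> \<bar>Re x\<bar> \<le> real R \<and> \<bar>Im x\<bar> \<le> real R"
  using normX[of x] abs_Re_le_cmod[of x] abs_Im_le_cmod[of x] by linarith

lemma hshear_pos:
  assumes x: "x \<in> X"
  shows "hshear l (x + pos m k) = x + (if k = l then pos (Suc m) k else pos m k)"
proof -
  have "x + pos m k \<in> lattice_complement"
    by (rule add_in_lattice_complement[OF spread_pos _ x]) auto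
  moreover have "bump (Im (x + pos m k) - real (step * l)) = (if k = l then 1 else 0)"
  proof (cases "k = l")
    case False
    have "real step \<le> \<bar>real (step * k) - real (step * l)\<bar>" using False by (rule step_dist)
    then have "real R + 1 \<le> \<bar>Im x + (real (step * k) - real (step * l))\<bar>"
      using Re_Im_X[OF x] by (simp only: step_def) linarith
    then show ?thesis using False by (simp add: pos_def bump_zero algebra_simps)
  qed (use Re_Im_X[OF x] in \<open>simp add: pos_def bump_one\<close>)
  ultimately show ?thesis
    by (auto simp: hshear_def pos_def complex_eq_iff algebra_simps)
qed

lemma vshear_pos:
  assumes x: "x \<in> X"
  shows "vshear l (x + pos m k) = x + (if m = 0 then pos m (k + l) else pos m k)"
proof -
  have "x + pos m k \<in> lattice_complement"
    by (rule add_in_lattice_complement[OF spread_pos _ x]) auto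
  moreover have "bump (Re (x + pos m k)) = (if m = 0 then 1 else 0)"
  proof (cases "m = 0")
    case False
    have "real step \<le> \<bar>real (step * m) - real (step * 0)\<bar>" using False by (rule step_dist)
    then have "real R + 1 \<le> \<bar>Re x + real (step * m)\<bar>"
      using Re_Im_X[OF x] by (simp only: step_def) linarith
    then show ?thesis using False by (simp add: pos_def bump_zero)
  qed (use Re_Im_X[OF x] in \<open>simp add: pos_def bump_one\<close>)
  ultimately show ?thesis
    by (auto simp: vshear_def pos_def complex_eq_iff algebra_simps)
qed

text \<open>The original copy is moved up to row \<open>Suc l\<close>, which is then shifted to the right by one step.\<close>

definition shift :: "nat \<Rightarrow> complex \<Rightarrow> complex" where
  "shift l = compose lattice_complement (hshear (Suc l)) (vshear (Suc l))"

lemma shift_in_Homeo_bd: "shift l \<in> Homeo_bd lattice_complement"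
  unfolding shift_def by (intro compose_in_Homeo_bd hshear_in_Homeo_bd vshear_in_Homeo_bd)

lemma shift_pos:
  assumes x: "x \<in> X"
  shows "shift l (x + pos 0 0) = x + pos 1 (Suc l)"
    "shift l (x + pos (Suc m) k) = x + (if k = Suc l then pos (Suc (Suc m)) k else pos (Suc m) k)"
proof -
  have "x + pos m k \<in> lattice_complement" for m k
    by (rule add_in_lattice_complement[OF spread_pos _ x]) auto
  then have s: "shift l (x + pos m k) = hshear (Suc l) (vshear (Suc l) (x + pos m k))" for m k
    by (simp add: shift_def compose_def)
  show "shift l (x + pos 0 0) = x + pos 1 (Suc l)"
    "shift l (x + pos (Suc m) k) = x + (if k = Suc l then pos (Suc (Suc m)) k else pos (Suc m) k)"
    unfolding s vshear_pos[OF x] by (auto simp: hshear_pos[OF x])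
qed

definition row_class :: "nat \<Rightarrow> (complex \<Rightarrow> complex) set \<Rightarrow> (complex \<Rightarrow> complex) set" where
  "row_class l A = (\<Union>f\<in>A. isotopy_class lattice_complement (place (row l) f))"

lemma place_hom:
  assumes "spread P"
  shows "(\<lambda>A. \<Union>f\<in>A. isotopy_class lattice_complement (place P f)) \<in> hom (mapping_class_group X) (mapping_class_group lattice_complement)"
    and "\<And>f. f \<in> Homeo_bd X \<Longrightarrow> (\<Union>f'\<in>isotopy_class X f. isotopy_class lattice_complement (place P f')) = isotopy_class lattice_complement (place P f)"
  using mapping_class_homI[of X "place P" lattice_complement] place_in_Homeo_bd[OF assms] place_isotopic[OF assms]
    place_compose[OF assms] Homeo_bd_props(2)
  by auto

lemma mapping_class_extend_eq: "mapping_class_extend X lattice_complement A = (\<Union>f\<in>A. isotopy_class lattice_complement (place {0} f))"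
  by (simp add: mapping_class_extend_def place_origin)

lemma Homeo_bd_lattice_complementD: "s \<in> Homeo_bd lattice_complement \<Longrightarrow> s ` lattice_complement \<subseteq> lattice_complement \<and> inj_on s lattice_complement"
  using Homeo_bd_props by auto

lemma place_commute:
  assumes "spread (P \<union> Q)" "P \<inter> Q = {}" and f: "f \<in> Homeo_bd X" and g: "g \<in> Homeo_bd X"
  shows "compose lattice_complement (place P f) (place Q g) = compose lattice_complement (place Q g) (place P f)"
proof -
  have P: "spread P" and Q: "spread Q" using assms(1) by (auto intro: spread_subset)
  have move: "place P f (x + q) = x + q" if "q \<in> Q" "x \<in> X" for q x
  proof (rule place_outside)
    show "x + q \<in> lattice_complement" using that by (rule add_in_lattice_complement[OF Q])
    show "x + q - p \<notin> X" if "p \<in> P" for p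
    proof
      assume "x + q - p \<in> X"
      then have "p = q"
        using spread_unique[OF assms(1), of p q "x + q"] normX[of x] normX[of "x + q - p"] that
          \<open>q \<in> Q\<close> \<open>x \<in> X\<close> by auto
      then show False using that \<open>q \<in> Q\<close> assms(2) by auto
    qed
  qed
  show ?thesis
    using place_conj[OF Q, of "\<lambda>q. q" g "place P f"] Q move Homeo_bd_lattice_complementD[OF place_in_Homeo_bd[OF P f]]
      Homeo_bd_props(2)[OF g] by simp
qed

text \<open>The swindle: \<open>shift l\<close> carries the original copy together with \<open>row l\<close> to \<open>row l\<close>, and fixes all other
  rows.\<close>

lemma homology_extend_zero:
  assumes n: "1 \<le> n"
    and c: "c \<in> chains_on (simplices n (carrier (mapping_class_group X)))" "bar_boundary (mapping_class_group X) c = 0"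
  shows "push (map (mapping_class_extend X lattice_complement)) c \<in>
    (bar_boundary (mapping_class_group lattice_complement) ` chains_on (simplices (Suc n) (carrier (mapping_class_group lattice_complement))) :: (_ \<Rightarrow>\<^sub>0 'k::field) set)"
proof (rule homology_vanishes_of_shifts[OF group_mapping_class_group group_mapping_class_group _ _ _ _ _ _ _ n c])
  let ?G = "mapping_class_group X" and ?M = "mapping_class_group lattice_complement"
  have ext: "mapping_class_extend X lattice_complement (isotopy_class X f) = isotopy_class lattice_complement (place {0} f)" if "f \<in> Homeo_bd X" for f
    unfolding mapping_class_extend_eq using place_hom(2)[OF spread_row(2) that] .
  have row: "row_class l (isotopy_class X f) = isotopy_class lattice_complement (place (row l) f)" if "f \<in> Homeo_bd X" for l f
    unfolding row_class_def using place_hom(2)[OF spread_row(1) that] .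
  have zero_row: "{0} \<inter> row l = {}" for l by (auto simp: row_def zero_eq_pos pos_inject)
  show "mapping_class_extend X lattice_complement \<in> hom ?G ?M"
    using place_hom(1)[OF spread_row(2)] by (simp add: mapping_class_extend_eq[abs_def])
  show "row_class l \<in> hom ?G ?M" for l
    using place_hom(1)[OF spread_row(1)] by (simp add: row_class_def[abs_def])
  show "isotopy_class lattice_complement (shift l) \<in> carrier ?M" for l
    by (simp add: carrier_mapping_class_group shift_in_Homeo_bd)
  fix a assume "a \<in> carrier ?G"
  then obtain f where f: "f \<in> Homeo_bd X" "a = isotopy_class X f" by (auto simp: carrier_mapping_class_group)
  note H = place_in_Homeo_bd[OF spread_row(1)] place_in_Homeo_bd[OF spread_row(2)] shift_in_Homeo_bd
  have fX: "f ` X \<subseteq> X" using Homeo_bd_props(2)[OF f(1)] by simp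
  {
    fix b assume "b \<in> carrier ?G"
    then obtain g where g: "g \<in> Homeo_bd X" "b = isotopy_class X g" by (auto simp: carrier_mapping_class_group)
    show "mapping_class_extend X lattice_complement a \<otimes>\<^bsub>?M\<^esub> row_class l b = row_class l b \<otimes>\<^bsub>?M\<^esub> mapping_class_extend X lattice_complement a" for l
      using f g H place_commute[of "{0}" "row l" f g] spread_row(3) zero_row
      by (simp add: ext row mult_mapping_class)
    show "row_class k a \<otimes>\<^bsub>?M\<^esub> row_class l b = row_class l b \<otimes>\<^bsub>?M\<^esub> row_class k a" if "k < l" for k l
    proof -
      have "row k \<inter> row l = {}" using that by (auto simp: row_def pos_inject)
      then show ?thesis
        using f g H place_commute[of "row k" "row l" f g] spread_row(4)
        by (simp add: row mult_mapping_class)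
    qed
  }
  show "isotopy_class lattice_complement (shift k) \<otimes>\<^bsub>?M\<^esub> row_class l a = row_class l a \<otimes>\<^bsub>?M\<^esub> isotopy_class lattice_complement (shift k)" if "k < l" for k l
  proof -
    have "compose lattice_complement (shift k) (place (row l) f) = compose lattice_complement (place ((\<lambda>p. p) ` row l) f) (shift k)"
      using that shift_pos(2) Homeo_bd_lattice_complementD[OF shift_in_Homeo_bd] spread_row(1)
      by (intro place_conj spread_row fX) (auto simp: row_def)
    then show ?thesis using f H by (simp add: row mult_mapping_class)
  qed
  show "isotopy_class lattice_complement (shift l) \<otimes>\<^bsub>?M\<^esub> (mapping_class_extend X lattice_complement a \<otimes>\<^bsub>?M\<^esub> row_class l a) =
      row_class l a \<otimes>\<^bsub>?M\<^esub> isotopy_class lattice_complement (shift l)" for l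
  proof -
    \<comment> \<open>The original copy goes to the first position of the row, and each position of the row to the next.\<close>
    define \<rho> where "\<rho> p = (if p = 0 then pos 1 (Suc l) else p + of_nat step)" for p
    have \<rho>: "\<rho> (pos 0 0) = pos 1 (Suc l)" "\<rho> (pos (Suc m) k) = pos (Suc (Suc m)) k" for m k
      by (auto simp: \<rho>_def zero_eq_pos pos_inject) (simp add: pos_def complex_eq_iff algebra_simps)
    have im: "\<rho> ` insert 0 (row l) = row l"
    proof -
      have "\<rho> ` insert 0 (row l) = insert (pos (Suc 0) (Suc l)) (range (\<lambda>m. pos (Suc (Suc m)) (Suc l)))"
        by (simp add: row_def image_image \<rho> zero_eq_pos)
      also have "\<dots> = row l"
      proof -
        have "(UNIV :: nat set) = insert 0 (range Suc)" by (auto simp: image_iff) (metis not0_implies_Suc)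
        then have "row l = (\<lambda>m. pos (Suc m) (Suc l)) ` insert 0 (range Suc)" by (simp only: row_def)
        then show ?thesis by (simp add: image_image)
      qed
      finally show ?thesis .
    qed
    have mv: "shift l (x + p) = x + \<rho> p" if "p \<in> insert 0 (row l)" "x \<in> X" for p x
      using that shift_pos[OF that(2)] by (auto simp: row_def zero_eq_pos \<rho>)
    have "compose lattice_complement (shift l) (place (insert 0 (row l)) f) = compose lattice_complement (place (\<rho> ` insert 0 (row l)) f) (shift l)"
      using mv Homeo_bd_lattice_complementD[OF shift_in_Homeo_bd]
      by (intro place_conj spread_row fX) (auto simp only: im spread_row)
    moreover have "place (insert 0 (row l)) f = compose lattice_complement (place {0} f) (place (row l) f)"
      using place_Un[of "{0}" "row l" f] spread_row(3) zero_row fX by simp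
    ultimately show ?thesis
      using f H unfolding im by (simp add: ext row mult_mapping_class compose_in_Homeo_bd)
  qed
qed

end

section \<open>Vanishing of the map on homology\<close>

text \<open>In terms of cosets: a homomorphism is zero on homology if it sends cycles to boundaries.\<close>

lemma group_homology_map_trivial:
  assumes \<phi>: "\<phi> \<in> hom G H"
    and van: "\<And>c. c \<in> chains_on (simplices n (carrier G)) \<Longrightarrow> bar_boundary G c = 0 \<Longrightarrow>
      push (map \<phi>) c \<in> (bar_boundary H ` chains_on (simplices (Suc n) (carrier H)) :: (_ \<Rightarrow>\<^sub>0 'k::field) set)"
  shows "trivial_homomorphism (group_homology TYPE('k) n G) (group_homology TYPE('k) n H) (group_homology_map n H \<phi>)"
proof -
  let ?BG = "bar_boundaries n G :: (_ \<Rightarrow>\<^sub>0 'k) set" and ?BH = "bar_boundaries n H :: (_ \<Rightarrow>\<^sub>0 'k) set"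
  let ?ZG = "bar_cycle_group n G :: (_ \<Rightarrow>\<^sub>0 'k) monoid" and ?ZH = "bar_cycle_group n H :: (_ \<Rightarrow>\<^sub>0 'k) monoid"
  have sub: "chain.subspace (bar_boundaries n L :: ('x list \<Rightarrow>\<^sub>0 'k) set)" for L :: "('x, 'y) monoid_scheme"
    unfolding bar_boundaries_def bar_chains_eq bar_boundary_eq_lin
    by (auto simp: chain.subspace_def lin_simps[symmetric] intro!: imageI chains_on_closed image_eqI[of 0 _ 0])
  have coset: "bar_boundaries n L #>\<^bsub>bar_cycle_group n L\<^esub> c = (\<lambda>b. b + c) ` bar_boundaries n L"
    for L :: "('x, 'y) monoid_scheme" and c :: "'x list \<Rightarrow>\<^sub>0 'k"
    by (auto simp: r_coset_def bar_cycle_group_def)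
  have mem: "c \<in> ?BH \<Longrightarrow> ?BH #>\<^bsub>?ZH\<^esub> c = ?BH" for c
  proof -
    assume c: "c \<in> ?BH"
    have "b \<in> (\<lambda>b. b + c) ` ?BH" if "b \<in> ?BH" for b
      using chain.subspace_diff[OF sub that c] by (intro image_eqI[of _ _ "b - c"]) auto
    then show ?thesis unfolding coset using chain.subspace_add[OF sub _ c] by auto
  qed
  have zero: "group_homology_map n H \<phi> A = ?BH" if A: "A \<in> carrier (group_homology TYPE('k) n G)" for A
  proof -
    obtain z where z: "z \<in> bar_chains n G" "bar_boundary G z = 0" "A = (\<lambda>b. b + z) ` ?BG"
      using A by (auto simp: group_homology_def FactGroup_def RCOSETS_def coset) (auto simp: bar_cycle_group_def)
    have pz: "push (map \<phi>) z \<in> ?BH"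
      using van[of z] z by (simp add: bar_chains_eq bar_boundaries_def)
    have pB: "push (map \<phi>) b \<in> ?BH" if b: "b \<in> ?BG" for b
    proof -
      obtain e where e: "e \<in> chains_on (simplices (Suc n) (carrier G))" "b = bar_boundary G e"
        using b by (auto simp: bar_boundaries_def bar_chains_eq)
      have "push (map \<phi>) b = lin (\<lambda>w. push (map \<phi>) (bar_bd G w)) e"
        by (simp add: e(2) bar_boundary_eq_lin lin_lin)
      also have "\<dots> = lin (\<lambda>w. bar_bd H (map \<phi> w)) e"
        by (rule lin_cong_on[OF e(1)]) (simp add: push_bar_bd[OF \<phi>] simplices_def)
      also have "\<dots> = bar_boundary H (push (map \<phi>) e)"
        by (simp add: bar_boundary_eq_lin lin_lin)
      finally have "push (map \<phi>) b = bar_boundary H (push (map \<phi>) e)" .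
      moreover have "push (map \<phi>) e \<in> chains_on (simplices (Suc n) (carrier H))"
        by (rule lin_in_chains_on[OF e(1)], rule single_in_chains_on, rule map_hom_simplices[OF \<phi>])
      ultimately show ?thesis by (simp add: bar_boundaries_def bar_chains_eq)
    qed
    have "?BH #>\<^bsub>?ZH\<^esub> bar_chain_map \<phi> c = ?BH" if "c \<in> A" for c
    proof (rule mem)
      obtain b where b: "b \<in> ?BG" "c = b + z" using \<open>c \<in> A\<close> z(3) by auto
      show "bar_chain_map \<phi> c \<in> ?BH"
        unfolding bar_chain_map_eq_push b(2) lin_add by (rule chain.subspace_add[OF sub pB[OF b(1)] pz])
    qed
    moreover have "A \<noteq> {}" using z(3) chain.subspace_0[OF sub] by auto
    ultimately show ?thesis unfolding group_homology_map_def by auto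
  qed
  have closed: "A \<otimes>\<^bsub>group_homology TYPE('k) n G\<^esub> B \<in> carrier (group_homology TYPE('k) n G)"
    if A: "A \<in> carrier (group_homology TYPE('k) n G)" and B: "B \<in> carrier (group_homology TYPE('k) n G)" for A B
  proof -
    obtain y where y: "y \<in> bar_chains n G" "bar_boundary G y = 0" "A = (\<lambda>b. b + y) ` ?BG"
      using A by (auto simp: group_homology_def FactGroup_def RCOSETS_def coset) (auto simp: bar_cycle_group_def)
    obtain z where z: "z \<in> bar_chains n G" "bar_boundary G z = 0" "B = (\<lambda>b. b + z) ` ?BG"
      using B by (auto simp: group_homology_def FactGroup_def RCOSETS_def coset) (auto simp: bar_cycle_group_def)
    have "y + z \<in> carrier ?ZG"
      using y z by (auto simp: bar_cycle_group_def bar_chains_eq bar_boundary_eq_lin lin_add intro: chains_on_closed)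
    moreover have "A <#>\<^bsub>?ZG\<^esub> B = (\<lambda>b. b + (y + z)) ` ?BG"
    proof -
      have "(b + y) + (b' + z) \<in> (\<lambda>b. b + (y + z)) ` ?BG" if "b \<in> ?BG" "b' \<in> ?BG" for b b'
        using chain.subspace_add[OF sub that] by (intro image_eqI[of _ _ "b + b'"]) (auto simp: algebra_simps)
      moreover have "\<exists>b'\<in>?BG. \<exists>b''\<in>?BG. b + (y + z) = (b' + y) + (b'' + z)" if "b \<in> ?BG" for b
        using that chain.subspace_0[OF sub] by (intro bexI[of _ b] bexI[of _ 0]) (auto simp: algebra_simps)
      ultimately show ?thesis unfolding y(3) z(3) set_mult_def bar_cycle_group_def by fastforce
    qed
    ultimately show ?thesis
      unfolding group_homology_def FactGroup_def RCOSETS_def by (auto simp: coset)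
  qed
  have "?BH <#>\<^bsub>?ZH\<^esub> ?BH = ?BH"
  proof -
    have "b \<in> ?BH <#>\<^bsub>?ZH\<^esub> ?BH" if "b \<in> ?BH" for b
      using that chain.subspace_0[OF sub] unfolding set_mult_def bar_cycle_group_def by fastforce
    then show ?thesis
      using chain.subspace_add[OF sub] by (auto simp: set_mult_def bar_cycle_group_def)
  qed
  moreover have "?BH \<in> carrier (group_homology TYPE('k) n H)"
  proof -
    have "0 \<in> carrier ?ZH"
      by (simp add: bar_cycle_group_def bar_chains_eq bar_boundary_eq_lin chains_on_closed)
    moreover have "?BH = ?BH #>\<^bsub>?ZH\<^esub> 0" by (simp add: coset)
    ultimately show ?thesis unfolding group_homology_def FactGroup_def RCOSETS_def by auto
  qed
  ultimately show ?thesis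
    unfolding trivial_homomorphism_def
    by (intro conjI homI ballI) (simp_all add: zero closed, simp_all add: group_homology_def FactGroup_def)
qed

theorem corollary7:
  fixes S X :: "complex set" and i :: nat
  defines "S \<equiv> UNIV - integer_lattice"
  assumes "properly_embedded_subsurface X S"
    and "finite_type X \<or> compact X"
    and "i \<ge> 1"
  shows "trivial_homomorphism
           (group_homology TYPE('k::field) i (mapping_class_group X))
           (group_homology TYPE('k) i (mapping_class_group S))
           (group_homology_map i (mapping_class_group S) (mapping_class_extend X S))"
proof -
  have X: "X \<subseteq> lattice_complement" "closedin (top_of_set lattice_complement) X" "compact (manifold_boundary X)"
    using assms(2) by (auto simp: S_def properly_embedded_subsurface_def planar_surface_def)
  have "bounded X"
    using assms(3) finite_type_imp_bounded[of X] X compact_imp_bounded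
    by (auto simp: Compl_eq_Diff_UNIV)
  then obtain r where "X \<subseteq> ball 0 r" using bounded_subset_ballD[of X 0] by blast
  then have r: "X \<subseteq> cball 0 r" by auto
  obtain R :: nat where R: "r \<le> real R" using real_arch_simple by blast
  interpret bounded_subsurface X R
    using X r R by unfold_locales (auto intro: order_trans)
  show ?thesis
    unfolding S_def
  proof (rule group_homology_map_trivial)
    show "mapping_class_extend X lattice_complement \<in> hom (mapping_class_group X) (mapping_class_group lattice_complement)"
      using place_hom(1)[OF spread_row(2)] by (simp add: mapping_class_extend_eq[abs_def])
  qed (rule homology_extend_zero[OF assms(4)])
qed

end
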